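(* The identity checking problem $\textsc{Check-Id}(\mathcal{J}_4)$ for the Jones monoid $\mathcal{J}_4$ lies in the complexity class $\mathsf{P}$.
   Context: Jones monoid. Let $[n]=\{1,\dots,n\}$ and $[n]'=\{1',\dots,n'\}$ be disjoint copies. A (circle-free) wire diagram is a partition of $[n]\cup[n]'$ into 2-element blocks (wires); the points of $[n]$ (left points) are placed in order $1,\dots,n$ from bottom to top on the left side of a rectangle, the points of $[n]'$ (right points) in order $1',\dots,n'$ from bottom to top on its right side, and wires are drawn as curves inside the rectangle. The underlying set of $\mathcal{J}_n$ consists of all such diagrams that can be drawn with no two wires crossing. To multiply two diagrams $\xi,\eta\in\mathcal{J}_n$, identify each right point $u'$ of $\xi$ with the left point $u$ of $\eta$; two of the remaining outer points (left points of $\xi$, right points of $\eta$) are connected by a wire in $\xi\eta$ if and only if one can be reached from the other by walking along consecutive wires of $\xi$ and $\eta$; any closed curves (circles) formed are removed. This makes $\mathcal{J}_n$ a finite monoid; $\mathcal{J}_4$ has 14 elements. $X$ is a fixed countably infinite set (alphabet) and $X^+$ is the free semigroup over $X$ (nonempty finite words under concatenation). An identity is an expression $w\bumpeq w'$ with $w,w'\in X^+$; it holds in a semigroup $\mathcal{S}$ if $w\varphi=w'\varphi$ for every semigroup homomorphism $\varphi\colon X^+\to\mathcal{S}$. For a fixed semigroup $\mathcal{S}$, the problem $\textsc{Check-Id}(\mathcal{S})$ is the decision problem whose instance is an arbitrary identity $w\bumpeq w'$, with answer YES if the identity holds in $\mathcal{S}$ and NO otherwise. Here $\mathcal{S}$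 is fixed and complexity is measured in terms of the length $|ww'|$ of the word $ww'$. *)

theory Defs
  imports
    "HOL-Algebra.Group"
    "HOL-Library.Disjoint_Sets"
    "HOL-Computational_Algebra.Polynomial"
begin

section \<open>The Jones monoid\<close>

text \<open>\<open>LP i\<close> is the left point \<open>i\<close>, \<open>RP i\<close> is the right point \<open>i'\<close>.\<close>

datatype point = LP nat | RP nat

definition points :: "nat \<Rightarrow> point set" where
  "points n = LP ` {1..n} \<union> RP ` {1..n}"

type_synonym diagram = "point set set"

definition wire_diagram :: "nat \<Rightarrow> diagram \<Rightarrow> bool" where
  "wire_diagram n D \<longleftrightarrow> partition_on (points n) D \<and> (\<forall>b\<in>D. card b = 2)"

text \<open>Position of a point when one walks once around the boundary of the rectangle: up the left
  side and then down the right side.  Two wires can be drawn inside the rectangle without crossing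
  iff their end points do not alternate along the boundary.\<close>

fun boundary_pos :: "nat \<Rightarrow> point \<Rightarrow> nat" where
  "boundary_pos n (LP i) = i"
| "boundary_pos n (RP i) = 2 * n + 1 - i"

definition noncrossing :: "nat \<Rightarrow> diagram \<Rightarrow> bool" where
  "noncrossing n D \<longleftrightarrow>
     \<not> (\<exists>a b c d. {a, b} \<in> D \<and> {c, d} \<in> D \<and>
          boundary_pos n a < boundary_pos n c \<and>
          boundary_pos n c < boundary_pos n b \<and>
          boundary_pos n b < boundary_pos n d)"

definition jones_diagrams :: "nat \<Rightarrow> diagram set" where
  "jones_diagrams n = {D. wire_diagram n D \<and> noncrossing n D}"

text \<open>Stacking \<open>\<xi>\<close> and \<open>\<eta>\<close> gives three columns of points, numbered 0, 1, 2; column 1 consists of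
  the right points of \<open>\<xi>\<close> identified with the left points of \<open>\<eta>\<close>.  The map \<open>place k\<close> puts a diagram
  between the columns \<open>k\<close> and \<open>k + 1\<close>, and \<open>outer\<close> embeds the points of the product.\<close>

fun place :: "nat \<Rightarrow> point \<Rightarrow> nat \<times> nat" where
  "place k (LP i) = (k, i)"
| "place k (RP i) = (k + 1, i)"

fun outer :: "point \<Rightarrow> nat \<times> nat" where
  "outer (LP i) = (0, i)"
| "outer (RP i) = (2, i)"

definition wire_steps :: "nat \<Rightarrow> diagram \<Rightarrow> ((nat \<times> nat) \<times> (nat \<times> nat)) set" where
  "wire_steps k D = {(place k a, place k b) | a b. {a, b} \<in> D}"

definition diagram_mult :: "nat \<Rightarrow> diagram \<Rightarrow> diagram \<Rightarrow> diagram" where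
  "diagram_mult n \<xi> \<eta> =
     {{a, b} | a b. a \<in> points n \<and> b \<in> points n \<and> a \<noteq> b \<and>
                    (outer a, outer b) \<in> (wire_steps 0 \<xi> \<union> wire_steps 1 \<eta>)\<^sup>*}"

definition jones :: "nat \<Rightarrow> diagram monoid" where
  "jones n = \<lparr>carrier = jones_diagrams n,
              monoid.mult = diagram_mult n,
              one = {{LP i, RP i} | i. i \<in> {1..n}}\<rparr>"


section \<open>Identities\<close>

text \<open>The alphabet is \<open>{x\<^sub>0, x\<^sub>1, \<dots>}\<close>, and \<open>x\<^sub>i\<close> is represented by its index.  Elements of the free
  semigroup are the nonempty words.\<close>

type_synonym word = "nat list"

definition word_hom :: "('a, 'b) monoid_scheme \<Rightarrow> (word \<Rightarrow> 'a) \<Rightarrow> bool" where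
  "word_hom S \<phi> \<longleftrightarrow>
     (\<forall>u. u \<noteq> [] \<longrightarrow> \<phi> u \<in> carrier S) \<and>
     (\<forall>u v. u \<noteq> [] \<longrightarrow> v \<noteq> [] \<longrightarrow> \<phi> (u @ v) = \<phi> u \<otimes>\<^bsub>S\<^esub> \<phi> v)"

definition identity_holds :: "('a, 'b) monoid_scheme \<Rightarrow> word \<Rightarrow> word \<Rightarrow> bool" where
  "identity_holds S w w' \<longleftrightarrow> (\<forall>\<phi>. word_hom S \<phi> \<longrightarrow> \<phi> w = \<phi> w')"


section \<open>Multi-tape Turing machines and the class P\<close>

text \<open>States and tape symbols are natural numbers from fixed finite sets.  Symbol 0 is the blank,
  symbols 1 and 2 are the input symbols \<open>False\<close> and \<open>True\<close>.  The tapes are two-way infinite.\<close>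

datatype move = Go_Left | Stay | Go_Right

record tm =
  tape_count :: nat
  states :: "nat set"
  symbols :: "nat set"
  start :: nat
  acc :: nat
  rej :: nat
  delta :: "nat \<Rightarrow> nat list \<Rightarrow> nat \<times> (nat \<times> move) list"

definition well_formed_tm :: "tm \<Rightarrow> bool" where
  "well_formed_tm M \<longleftrightarrow>
     tape_count M \<ge> 1 \<and>
     finite (states M) \<and> start M \<in> states M \<and> acc M \<in> states M \<and> rej M \<in> states M \<and>
     acc M \<noteq> rej M \<and>
     finite (symbols M) \<and> {0, 1, 2} \<subseteq> symbols M \<and>
     (\<forall>q\<in>states M - {acc M, rej M}. \<forall>xs. length xs = tape_count M \<longrightarrow> set xs \<subseteq> symbols M \<longrightarrow>
        fst (delta M q xs) \<in> states M \<and>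
        length (snd (delta M q xs)) = tape_count M \<and>
        fst ` set (snd (delta M q xs)) \<subseteq> symbols M)"

type_synonym tape = "(int \<Rightarrow> nat) \<times> int"  \<comment> \<open>contents and head position\<close>
type_synonym config = "nat \<times> tape list"

fun offset :: "move \<Rightarrow> int" where
  "offset Go_Left = -1"
| "offset Stay = 0"
| "offset Go_Right = 1"

fun read_tape :: "tape \<Rightarrow> nat" where
  "read_tape (f, h) = f h"

fun act :: "nat \<times> move \<Rightarrow> tape \<Rightarrow> tape" where
  "act (s, m) (f, h) = (f(h := s), h + offset m)"

definition tm_step :: "tm \<Rightarrow> config \<Rightarrow> config" where
  "tm_step M c =
     (let (q, ts) = c in
      if q = acc M \<or> q = rej M then c
      else let (q', as) = delta M q (map read_tape ts) in (q', map2 act as ts))"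

definition input_tape :: "bool list \<Rightarrow> tape" where
  "input_tape x =
     (\<lambda>i. if 0 \<le> i \<and> i < int (length x) then (if x ! nat i then 2 else 1) else 0, 0)"

definition initial_config :: "tm \<Rightarrow> bool list \<Rightarrow> config" where
  "initial_config M x =
     (start M, input_tape x # replicate (tape_count M - 1) (\<lambda>_. 0, 0))"

definition state_after :: "tm \<Rightarrow> bool list \<Rightarrow> nat \<Rightarrow> nat" where
  "state_after M x t = fst ((tm_step M ^^ t) (initial_config M x))"

text \<open>Since a halted machine stays put, the following says that \<open>M\<close> halts within \<open>T |x|\<close> steps with
  the right answer on every input \<open>x\<close>.\<close>

definition decides_in_time :: "tm \<Rightarrow> bool list set \<Rightarrow> (nat \<Rightarrow> nat) \<Rightarrow> bool" where
  "decides_in_time M L T \<longleftrightarrow>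
     (\<forall>x. state_after M x (T (length x)) = (if x \<in> L then acc M else rej M))"

definition class_P :: "bool list set set" where
  "class_P = {L. \<exists>M (p :: nat poly). well_formed_tm M \<and> decides_in_time M L (poly p)}"


section \<open>The identity checking problem\<close>

text \<open>Letters are given by the binary digits of their index, least significant first.  Every
  symbol of an instance takes two bits: \<open>[True, b]\<close> is the digit \<open>b\<close>, \<open>[False, False]\<close> ends a letter
  and \<open>[False, True]\<close> separates the two sides of the identity.\<close>

fun binary :: "nat \<Rightarrow> bool list" where
  "binary i = (if i = 0 then [] else odd i # binary (i div 2))"

declare binary.simps [simp del]

definition encode_letter :: "nat \<Rightarrow> bool list" where
  "encode_letter i = concat (map (\<lambda>b. [True, b]) (binary i)) @ [False, False]"

definition encode_word :: "word \<Rightarrow> bool list" where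
  "encode_word w = concat (map encode_letter w)"

definition encode_identity :: "word \<Rightarrow> word \<Rightarrow> bool list" where
  "encode_identity w w' = encode_word w @ [False, True] @ encode_word w'"

definition Check_Id :: "('a, 'b) monoid_scheme \<Rightarrow> bool list set" where
  "Check_Id S =
     {encode_identity w w' | w w'. w \<noteq> [] \<and> w' \<noteq> [] \<and> identity_holds S w w'}"


subsection \<open>The encoding and the length of the word \<open>ww'\<close>\<close>

text \<open>Instances matter only up to renaming of letters (\<open>identity_holds_rename\<close>), so the letters of
  \<open>w\<close> and \<open>w'\<close> may be assumed to be among \<open>x\<^sub>0, \<dots>, x\<^sub>N\<^sub>-\<^sub>1\<close> with \<open>N = |ww'|\<close>.  For such instances, the
  length of the encoding is polynomial in \<open>N\<close>, so membership in \<open>class_P\<close> gives a running time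
  polynomial in \<open>|ww'|\<close> (\<open>class_P_word_length\<close>).\<close>

lemma binary_inject: "binary i = binary j \<Longrightarrow> i = j"
proof (induction i arbitrary: j rule: less_induct)
  case (less i)
  show ?case
  proof (cases "i = 0 \<or> j = 0")
    case True
    then show ?thesis
      using less.prems by (subst (asm) (1 2) binary.simps) (auto split: if_splits)
  next
    case False
    then have "odd i = odd j" and eq: "binary (i div 2) = binary (j div 2)"
      using less.prems by (subst (asm) (1 2) binary.simps, simp)+
    moreover have "i div 2 = j div 2"
      using less.IH[OF _ eq] False by simp
    ultimately show ?thesis
      by (metis odd_two_times_div_two_succ even_two_times_div_two)
  qed
qed

lemma length_binary: "length (binary i) \<le> i"
proof (induction i rule: less_induct)
  case (less i)
  show ?case
  proof (cases "i = 0")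
    case False
    then have "length (binary (i div 2)) \<le> i div 2" using less.IH by simp
    then show ?thesis using False by (subst binary.simps) simp
  qed (simp add: binary.simps)
qed

lemma digits_append_eq:
  "concat (map (\<lambda>b. [True, b]) bs) @ False # r = concat (map (\<lambda>b. [True, b]) cs) @ False # s
   \<Longrightarrow> bs = cs \<and> r = s"
proof (induction bs arbitrary: cs)
  case Nil
  then show ?case by (cases cs) auto
next
  case (Cons b bs)
  then show ?case by (cases cs) auto
qed

lemma encode_letter_append_eq:
  "encode_letter i @ r = encode_letter j @ s \<Longrightarrow> i = j \<and> r = s"
  using digits_append_eq[of "binary i" "False # r" "binary j" "False # s"]
  by (auto simp: encode_letter_def dest: binary_inject)

lemma encode_letter_neq_sep: "encode_letter i @ r \<noteq> False # True # s"
  by (cases "binary i") (auto simp: encode_letter_def)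

lemma encode_word_append_eq:
  "encode_word w @ False # True # r = encode_word v @ False # True # s \<Longrightarrow> w = v \<and> r = s"
proof (induction w arbitrary: v)
  case Nil
  then show ?case
    by (cases v) (auto simp: encode_word_def encode_letter_neq_sep[symmetric])
next
  case (Cons i w)
  then show ?case
  proof (cases v)
    case Nil
    then show ?thesis using Cons.prems by (simp add: encode_word_def encode_letter_neq_sep)
  next
    case v: (Cons j v')
    then have "encode_letter i @ (encode_word w @ False # True # r)
             = encode_letter j @ (encode_word v' @ False # True # s)"
      using Cons.prems by (simp add: encode_word_def)
    from encode_letter_append_eq[OF this] show ?thesis
      using Cons.IH v by auto
  qed
qed

lemma encode_identity_inject:
  "encode_identity w w' = encode_identity v v' \<longleftrightarrow> w = v \<and> w' = v'"
  using encode_word_append_eq[of w "encode_word w'" v "encode_word v'"]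
        encode_word_append_eq[of w' "[]" v' "[]"]
  by (auto simp: encode_identity_def)

lemma encode_identity_in_Check_Id:
  assumes "w \<noteq> []" "w' \<noteq> []"
  shows "encode_identity w w' \<in> Check_Id S \<longleftrightarrow> identity_holds S w w'"
  using assms by (auto simp: Check_Id_def encode_identity_inject)

lemma length_encode_word:
  assumes "set w \<subseteq> {..<N}"
  shows "length (encode_word w) \<le> 2 * N * length w"
  using assms
proof (induction w)
  case (Cons i w)
  have "length (concat (map (\<lambda>b. [True, b]) bs)) = 2 * length bs" for bs
    by (induction bs) auto
  then have "length (encode_letter i) \<le> 2 * N"
    using length_binary[of i] Cons.prems by (auto simp: encode_letter_def)
  then show ?case using Cons by (simp add: encode_word_def)
qed (simp add: encode_word_def)

lemma length_encode_identity:
  assumes "set (w @ w') \<subseteq> {..<N}" and "N = length (w @ w')"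
  shows "length (encode_identity w w') \<le> 2 * N ^ 2 + 2"
proof -
  have "length (encode_identity w w') \<le> 2 * N * length w + 2 * N * length w' + 2"
    using length_encode_word[of w N] length_encode_word[of w' N] assms(1)
    by (simp add: encode_identity_def)
  also have "\<dots> = 2 * N ^ 2 + 2"
    using assms(2) by (simp add: power2_eq_square algebra_simps)
  finally show ?thesis .
qed

lemma word_hom_map:
  assumes "word_hom S \<phi>"
  shows "word_hom S (\<lambda>u. \<phi> (map r u))"
  using assms by (simp add: word_hom_def)

lemma identity_holds_map:
  assumes "identity_holds S w w'"
  shows "identity_holds S (map r w) (map r w')"
  using assms word_hom_map[of S _ r] unfolding identity_holds_def by blast

lemma identity_holds_rename:
  assumes "inj_on r (set (w @ w'))"
  shows "identity_holds S (map r w) (map r w') \<longleftrightarrow> identity_holds S w w'"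
proof
  let ?s = "the_inv_into (set (w @ w')) r"
  assume "identity_holds S (map r w) (map r w')"
  then have "identity_holds S (map ?s (map r w)) (map ?s (map r w'))"
    by (rule identity_holds_map)
  moreover have "map ?s (map r w) = w" "map ?s (map r w') = w'"
    using the_inv_into_f_f[OF assms] by (auto intro!: map_idI)
  ultimately show "identity_holds S w w'" by simp
qed (rule identity_holds_map)

lemma poly_nat_mono:
  fixes p :: "nat poly"
  assumes "m \<le> n"
  shows "poly p m \<le> poly p n"
  using assms by (induction p) (auto intro!: add_mono mult_mono)

lemma state_after_halted:
  assumes "state_after M x t \<in> {acc M, rej M}" and "t \<le> t'"
  shows "state_after M x t' = state_after M x t"
  using assms(2)
proof (induction t' rule: dec_induct)
  case (step m)
  then show ?case using assms(1)
    by (auto simp: state_after_def tm_step_def split: prod.splits)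
qed simp

lemma class_P_word_length:
  assumes "Check_Id S \<in> class_P"
  shows "\<exists>M (p :: nat poly). well_formed_tm M \<and>
           (\<forall>w w'. w \<noteq> [] \<longrightarrow> w' \<noteq> [] \<longrightarrow> set (w @ w') \<subseteq> {..<length (w @ w')} \<longrightarrow>
              state_after M (encode_identity w w') (poly p (length (w @ w'))) =
                (if identity_holds S w w' then acc M else rej M))"
proof -
  from assms obtain M and p :: "nat poly"
    where M: "well_formed_tm M" and dec: "decides_in_time M (Check_Id S) (poly p)"
    by (auto simp: class_P_def)
  let ?q = "pcompose p [:2, 0, 2:]"
  have "state_after M (encode_identity w w') (poly ?q (length (w @ w'))) =
          (if identity_holds S w w' then acc M else rej M)"
    if ne: "w \<noteq> []" "w' \<noteq> []" and letters: "set (w @ w') \<subseteq> {..<length (w @ w')}" for w w'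
  proof -
    let ?x = "encode_identity w w'"
    have eq: "state_after M ?x (poly p (length ?x)) =
            (if identity_holds S w w' then acc M else rej M)"
      using dec ne by (simp add: decides_in_time_def encode_identity_in_Check_Id)
    have "length ?x \<le> poly [:2, 0, 2:] (length (w @ w'))"
      using length_encode_identity[OF letters refl] by (simp add: power2_eq_square algebra_simps)
    then have "poly p (length ?x) \<le> poly ?q (length (w @ w'))"
      unfolding poly_pcompose by (rule poly_nat_mono)
    from state_after_halted[OF _ this] eq show ?thesis by simp
  qed
  with M show ?thesis by blast
qed

end

theory Submission
  imports Defs
begin

text \<open>
  There are two parts: a combinatorial description of the identities of the Jones monoid
  \<open>\<J>\<^sub>4\<close>, and the fact that this description can be tested in polynomial time.

  Apart from the identity, a diagram in \<open>\<J>\<^sub>4\<close> either has one cup on each side and two wires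
  running through, or it has no wire running through.  In the first case it is determined by the
  positions of its two cups, and a product of two such diagrams keeps its through wires unless
  the two cups that meet in the middle are the bottom one and the top one.  In the second case
  each side carries either two adjacent or two nested cups.  So, deleting the letters sent to
  the identity, the value of a word is determined by the following data: whether some letter
  has no through wires, whether two consecutive letters have cups that clash in this way, and
  the first and the last letter.  Hence \<open>w \<bumpeq> w'\<close> holds in \<open>\<J>\<^sub>4\<close> iff, for each set of letters, the subwords
  that \<open>w\<close> and \<open>w'\<close> induce on this set have the same factors of length 2, where the ends of a
  word are marked by an extra symbol (\<open>word_value_eq_if_factors_eq\<close> and
  \<open>factors_subset_if_word_value_eq\<close>).

  This is a condition on exponentially many sets of letters, but the worst set for a given
  occurrence of a factor \<open>xy\<close> is known in advance: it is the complement of the set of letters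
  between \<open>x\<close> and \<open>y\<close>.  So the condition says that for any two positions \<open>p < q\<close> in one of the
  words there are positions \<open>p' < q'\<close> in the other one with the same letters at the ends and
  no new letters in between.  This relation is called \<open>covers\<close> below, and
  \<open>identity_holds_jones_iff\<close> is the resulting description.

  Being first-order in the positions, the relation can be tested by nested loops.  To obtain a
  Turing machine without programming one by hand, a small query language is introduced whose
  variables are tape heads standing on copies of the input.  Its only loop moves several heads
  in lockstep, which is enough to compare positions and to compare binary numerals.  A machine
  that evaluates a fixed query by walking through the query with a stack of bounded depth
  takes polynomial time (\<open>query_in_class_P\<close>), and \<open>Criterion\<close> is a query that expresses both
  that the input encodes an identity and that this identity satisfies the description
  (\<open>sat_Criterion\<close>, \<open>Criterion_iff\<close>).
\<close>

section \<open>Products of wire diagrams\<close>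

lemma wire_unique:
  assumes "wire_diagram n D" "{a, b} \<in> D" "{a, c} \<in> D"
  shows "b = c"
proof -
  have "disjoint D" using assms(1) by (simp add: wire_diagram_def partition_on_def)
  then have "{a, b} = {a, c}"
    using disjointD[of D "{a, b}" "{a, c}"] assms(2,3) by blast
  then show ?thesis by (auto simp: doubleton_eq_iff)
qed

lemma wire_neq: "wire_diagram n D \<Longrightarrow> {a, b} \<in> D \<Longrightarrow> a \<noteq> b"
  by (auto simp: wire_diagram_def)

lemma place_inject [simp]: "place k a = place k b \<longleftrightarrow> a = b"
  by (cases a; cases b) auto

lemma outer_inject [simp]: "outer a = outer b \<longleftrightarrow> a = b"
  by (cases a; cases b) auto

lemma wire_steps_sym: "(x, y) \<in> wire_steps k D \<Longrightarrow> (y, x) \<in> wire_steps k D"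
  by (auto simp: wire_steps_def) (metis insert_commute)

lemma wire_steps_unique:
  "wire_diagram n D \<Longrightarrow> (x, y) \<in> wire_steps k D \<Longrightarrow> (x, z) \<in> wire_steps k D \<Longrightarrow> y = z"
  by (auto simp: wire_steps_def dest: wire_unique)

lemma fst_place: "fst (place k a) = k \<or> fst (place k a) = k + 1"
  by (cases a) auto

lemma wire_steps_column: "(x, y) \<in> wire_steps k D \<Longrightarrow> fst x = k \<or> fst x = k + 1"
  using fst_place by (force simp: wire_steps_def)

text \<open>In the graph formed by the wires of both diagrams, outer points have degree 1 and middle
  points have degree 2, so a walk that never turns back has no choice.  The Boolean of a state
  records which diagram the next wire has to come from (\<open>True\<close> for the left one); this makes
  the walk deterministic.\<close>

definition walk_steps :: "diagram \<Rightarrow> diagram \<Rightarrow> (((nat \<times> nat) \<times> bool) \<times> ((nat \<times> nat) \<times> bool)) set" where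
  "walk_steps \<xi> \<eta> =
     {((x, k), (y, \<not> k)) | x k y. (x, y) \<in> (if k then wire_steps 0 \<xi> else wire_steps 1 \<eta>)}"

lemma walk_steps_iff:
  "((x, k), (y, l)) \<in> walk_steps \<xi> \<eta> \<longleftrightarrow>
     l = (\<not> k) \<and> (x, y) \<in> (if k then wire_steps 0 \<xi> else wire_steps 1 \<eta>)"
  by (cases x; cases y) (auto simp: walk_steps_def)

lemma walk_steps_single_valued:
  assumes "wire_diagram n \<xi>" "wire_diagram n \<eta>"
  shows "single_valued (walk_steps \<xi> \<eta>)"
  using wire_steps_unique[OF assms(1)] wire_steps_unique[OF assms(2)]
  by (auto simp: single_valued_def walk_steps_iff split: if_splits)

text \<open>A step of the graph from a visited point either continues the walk or goes back along the
  wire by which the point was entered, and then it leads to a point visited before.\<close>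

lemma reachable_by_walk:
  assumes wd: "wire_diagram n \<xi>" "wire_diagram n \<eta>"
    and reach: "(outer a, x) \<in> (wire_steps 0 \<xi> \<union> wire_steps 1 \<eta>)\<^sup>*"
  shows "\<exists>k. ((outer a, fst (outer a) = 0), (x, k)) \<in> (walk_steps \<xi> \<eta>)\<^sup>*"
  using reach
proof (induction rule: rtrancl_induct)
  case base
  then show ?case by blast
next
  case (step x z)
  then obtain k where k: "((outer a, fst (outer a) = 0), (x, k)) \<in> (walk_steps \<xi> \<eta>)\<^sup>*" by blast
  let ?S = "\<lambda>k. if k then wire_steps 0 \<xi> else wire_steps 1 \<eta>"
  have "(x, z) \<in> ?S k \<or> (x, z) \<in> ?S (\<not> k)" using step.hyps(2) by auto
  then show ?case
  proof
    assume "(x, z) \<in> ?S k"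
    then have "((x, k), (z, \<not> k)) \<in> walk_steps \<xi> \<eta>" by (simp add: walk_steps_iff)
    with k show ?thesis by (meson rtrancl.rtrancl_into_rtrancl)
  next
    assume rev: "(x, z) \<in> ?S (\<not> k)"
    from k show ?thesis
    proof (cases rule: rtranclE)
      case base
      then have "x = outer a" "k = (fst x = 0)" by auto
      with rev wire_steps_column[of x z] have False
        by (cases a) (fastforce split: if_splits)+
      then show ?thesis ..
    next
      case (step d)
      obtain y l where d: "d = (y, l)" by (cases d)
      have "k = (\<not> l)" "(y, x) \<in> ?S (\<not> k)"
        using step(2) by (auto simp: d walk_steps_iff)
      then have "(x, y) \<in> ?S (\<not> k)" by (auto intro: wire_steps_sym split: if_splits)
      with rev have "z = y"
        using wire_steps_unique[OF wd(1)] wire_steps_unique[OF wd(2)] by (auto split: if_splits)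
      with step(1) d show ?thesis by blast
    qed
  qed
qed

text \<open>The walk is deterministic and cannot leave an outer point that it has entered, so it enters
  at most one.\<close>

lemma outer_reach_unique:
  assumes wd: "wire_diagram n \<xi>" "wire_diagram n \<eta>"
    and b: "(outer a, outer b) \<in> (wire_steps 0 \<xi> \<union> wire_steps 1 \<eta>)\<^sup>*" "a \<noteq> b"
    and c: "(outer a, outer c) \<in> (wire_steps 0 \<xi> \<union> wire_steps 1 \<eta>)\<^sup>*" "a \<noteq> c"
  shows "b = c"
proof -
  let ?s = "(outer a, fst (outer a) = 0)"
  have final: "d = (outer e, l)"
    if walk: "(?s, (outer e, l)) \<in> (walk_steps \<xi> \<eta>)\<^sup>*" and "a \<noteq> e"
      and next_d: "((outer e, l), d) \<in> (walk_steps \<xi> \<eta>)\<^sup>*" for e l d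
  proof -
    obtain y k where "((y, k), (outer e, l)) \<in> walk_steps \<xi> \<eta>"
      using walk \<open>a \<noteq> e\<close> by (cases rule: rtranclE) auto
    then have l: "l = (fst (outer e) \<noteq> 0)"
      using wire_steps_column[of "outer e" y, OF wire_steps_sym]
      by (cases e) (fastforce simp: walk_steps_iff split: if_splits)+
    from next_d show ?thesis
    proof (cases rule: converse_rtranclE)
      case (step f)
      then show ?thesis using l wire_steps_column[of "outer e" "fst f"]
        by (cases f; cases e) (fastforce simp: walk_steps_iff split: if_splits)+
    qed simp
  qed
  obtain k l where k: "(?s, (outer b, k)) \<in> (walk_steps \<xi> \<eta>)\<^sup>*"
    and l: "(?s, (outer c, l)) \<in> (walk_steps \<xi> \<eta>)\<^sup>*"
    using reachable_by_walk[OF wd] b c by blast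
  from single_valued_confluent[OF walk_steps_single_valued[OF wd] k l]
  show ?thesis using final[OF k b(2), of "(outer c, l)"] final[OF l c(2), of "(outer b, k)"] by auto
qed

text \<open>Since wires of the product are unique, a full set of paths determines the product: one need
  not check that other pairs of outer points are not connected.\<close>

lemma diagram_mult_eqI:
  assumes wd: "wire_diagram n \<xi>" "wire_diagram n \<eta>" "wire_diagram n \<zeta>"
    and reach: "\<And>a b. {a, b} \<in> \<zeta> \<Longrightarrow>
      (outer a, outer b) \<in> (wire_steps 0 \<xi> \<union> wire_steps 1 \<eta>)\<^sup>*"
  shows "diagram_mult n \<xi> \<eta> = \<zeta>"
proof
  have wire: "\<exists>a b. x = {a, b} \<and> a \<noteq> b \<and> a \<in> points n \<and> b \<in> points n" if "x \<in> \<zeta>" for x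
  proof -
    have "card x = 2" "x \<subseteq> points n"
      using that wd(3) by (auto simp: wire_diagram_def partition_on_def)
    then show ?thesis by (auto simp: card_2_iff)
  qed
  show "\<zeta> \<subseteq> diagram_mult n \<xi> \<eta>"
  proof
    fix x assume x: "x \<in> \<zeta>"
    then show "x \<in> diagram_mult n \<xi> \<eta>"
      using wire[OF x] reach unfolding diagram_mult_def by blast
  qed
  show "diagram_mult n \<xi> \<eta> \<subseteq> \<zeta>"
  proof
    fix x assume "x \<in> diagram_mult n \<xi> \<eta>"
    then obtain a b where x: "x = {a, b}" "a \<in> points n" "a \<noteq> b"
      "(outer a, outer b) \<in> (wire_steps 0 \<xi> \<union> wire_steps 1 \<eta>)\<^sup>*"
      by (auto simp: diagram_mult_def)
    have "points n = \<Union>\<zeta>" using wd(3) by (auto simp: wire_diagram_def partition_on_def)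
    then obtain y where y: "y \<in> \<zeta>" "a \<in> y" using x(2) by blast
    then obtain c where c: "{a, c} \<in> \<zeta>" "a \<noteq> c"
      using wire[OF y(1)] by (auto simp: insert_commute)
    have "b = c" using outer_reach_unique[OF wd(1,2) x(4,3) reach[OF c(1)] c(2)] .
    with c x show "x \<in> \<zeta>" by simp
  qed
qed

section \<open>A model of the Jones monoid with explicit multiplication\<close>

datatype cup = Bot | Mid | Top
text \<open>\<open>Hook c d\<close> has the left cup \<open>c\<close>, the right cup \<open>d\<close> and two wires running through;
  \<open>Cut a b\<close> has no wire running through, and its left (right) cups are nested iff \<open>a\<close>
  (\<open>b\<close>).\<close>

datatype jones4 = Ident | Hook cup cup | Cut bool bool

text \<open>Which of the two cup patterns arises when the two wires running through next to the cup
  \<open>c\<close> are turned back: around the middle cup they close to a nested pair, beside the other cups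
  to an adjacent pair.\<close>

definition nested :: "cup \<Rightarrow> bool" where "nested c \<longleftrightarrow> c = Mid"

definition clash :: "cup \<Rightarrow> cup \<Rightarrow> bool" where
  "clash c d \<longleftrightarrow> c = Bot \<and> d = Top \<or> c = Top \<and> d = Bot"

fun mul :: "jones4 \<Rightarrow> jones4 \<Rightarrow> jones4" where
  "mul Ident t = t"
| "mul t Ident = t"
| "mul (Hook i j) (Hook k l) = (if clash j k then Cut (nested i) (nested l) else Hook i l)"
| "mul (Hook i j) (Cut a b) = Cut (nested i) b"
| "mul (Cut a b) (Hook i j) = Cut a (nested j)"
| "mul (Cut a b) (Cut c d) = Cut a d"

lemma mul_Ident_right [simp]: "mul t Ident = t"
  by (cases t) auto

lemma mul_assoc: "mul (mul s t) u = mul s (mul t u)"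
  by (cases s; cases t; cases u) auto

fun cup_wire :: "(nat \<Rightarrow> point) \<Rightarrow> cup \<Rightarrow> point \<times> point" where
  "cup_wire P Bot = (P 1, P 2)"
| "cup_wire P Mid = (P 2, P 3)"
| "cup_wire P Top = (P 3, P 4)"

fun free_points :: "cup \<Rightarrow> nat list" where
  "free_points Bot = [3, 4]"
| "free_points Mid = [1, 4]"
| "free_points Top = [1, 2]"

fun wires :: "jones4 \<Rightarrow> (point \<times> point) list" where
  "wires Ident = map (\<lambda>i. (LP i, RP i)) [1, 2, 3, 4]"
| "wires (Hook c d) = cup_wire LP c # cup_wire RP d #
     zip (map LP (free_points c)) (map RP (free_points d))"
| "wires (Cut a b) =
    (if a then [(LP 1, LP 4), (LP 2, LP 3)] else [(LP 1, LP 2), (LP 3, LP 4)]) @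
    (if b then [(RP 1, RP 4), (RP 2, RP 3)] else [(RP 1, RP 2), (RP 3, RP 4)])"

definition diag :: "jones4 \<Rightarrow> diagram" where
  "diag t = (\<lambda>(a, b). {a, b}) ` set (wires t)"

lemma points4: "points 4 = {LP 1, LP 2, LP 3, LP 4, RP 1, RP 2, RP 3, RP 4}"
proof -
  have "{1..4} = {1, 2, 3, 4::nat}" by auto
  then show ?thesis by (auto simp: points_def)
qed

lemma wire_diagram_wires:
  assumes "distinct (concat (map (\<lambda>(a, b). [a, b]) ws))"
    and "set (concat (map (\<lambda>(a, b). [a, b]) ws)) = points n"
  shows "wire_diagram n ((\<lambda>(a, b). {a, b}) ` set ws)"
proof -
  have "disjoint ((\<lambda>(a, b). {a, b}) ` set ws) \<and> (\<forall>(a, b)\<in>set ws. a \<noteq> b)"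
    using assms(1)
  proof (induction ws)
    case (Cons w ws)
    obtain a b where w: "w = (a, b)" by (cases w)
    have "{a, b} \<inter> S = {}" if "S \<in> (\<lambda>(a, b). {a, b}) ` set ws" for S
      using that Cons.prems by (auto simp: w)
    with Cons show ?case by (auto simp: w disjoint_def)
  qed (simp add: disjoint_def)
  moreover have "\<Union>((\<lambda>(a, b). {a, b}) ` set ws) = points n"
    unfolding assms(2)[symmetric] by (auto split: prod.splits)
  ultimately show ?thesis
    unfolding wire_diagram_def partition_on_def by auto
qed

lemma noncrossing_wires:
  assumes "\<forall>(a, b)\<in>set (ws @ map prod.swap ws). \<forall>(c, d)\<in>set (ws @ map prod.swap ws).
     \<not> (boundary_pos n a < boundary_pos n c \<and> boundary_pos n c < boundary_pos n b \<and>
        boundary_pos n b < boundary_pos n d)"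
  shows "noncrossing n ((\<lambda>(a, b). {a, b}) ` set ws)"
proof -
  have "(a, b) \<in> set (ws @ map prod.swap ws)" if "{a, b} \<in> (\<lambda>(a, b). {a, b}) ` set ws" for a b
    using that by (force simp: doubleton_eq_iff)
  note oriented = this
  have "\<not> (boundary_pos n a < boundary_pos n c \<and> boundary_pos n c < boundary_pos n b \<and>
        boundary_pos n b < boundary_pos n d)"
    if "(a, b) \<in> set (ws @ map prod.swap ws)" "(c, d) \<in> set (ws @ map prod.swap ws)" for a b c d
    using bspec[OF bspec[OF assms that(1), unfolded split_conv] that(2)] unfolding split_conv .
  note compare = this
  show ?thesis
    unfolding noncrossing_def using compare[OF oriented oriented] by iprover
qed

text \<open>Facts about the 14 elements and their 196 products are verified by rewriting over this
  list.\<close>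

definition all_elements :: "jones4 list" where
  "all_elements = Ident # [Hook c d. c \<leftarrow> [Bot, Mid, Top], d \<leftarrow> [Bot, Mid, Top]] @
     [Cut a b. a \<leftarrow> [True, False], b \<leftarrow> [True, False]]"

lemma in_all_elements [simp]: "t \<in> set all_elements"
proof (cases t)
  case (Hook c d)
  then show ?thesis by (cases c; cases d) (auto simp: all_elements_def)
qed (auto simp: all_elements_def)

lemma wires_distinct: "distinct (concat (map (\<lambda>(a, b). [a, b]) (wires t)))"
proof -
  have "list_all (\<lambda>t. distinct (concat (map (\<lambda>(a, b). [a, b]) (wires t)))) all_elements"
    by code_simp
  then show ?thesis by (simp add: list_all_iff)
qed

lemma wires_points: "set (concat (map (\<lambda>(a, b). [a, b]) (wires t))) = points 4"
proof -
  have "list_all (\<lambda>t. set (concat (map (\<lambda>(a, b). [a, b]) (wires t))) =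
     {LP 1, LP 2, LP 3, LP 4, RP 1, RP 2, RP 3, RP 4}) all_elements"
    by code_simp
  then show ?thesis unfolding points4 list_all_iff by (metis in_all_elements)
qed

lemma wire_diagram_diag: "wire_diagram 4 (diag t)"
  unfolding diag_def using wires_distinct wires_points by (rule wire_diagram_wires)

lemma noncrossing_diag: "noncrossing 4 (diag t)"
proof -
  have "list_all (\<lambda>t. \<forall>(a, b)\<in>set (wires t @ map prod.swap (wires t)).
       \<forall>(c, d)\<in>set (wires t @ map prod.swap (wires t)).
       \<not> (boundary_pos 4 a < boundary_pos 4 c \<and> boundary_pos 4 c < boundary_pos 4 b \<and>
          boundary_pos 4 b < boundary_pos 4 d)) all_elements"
    by code_simp
  then show ?thesis unfolding diag_def list_all_iff
    by (intro noncrossing_wires) (drule bspec[OF _ in_all_elements[of t]])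
qed

text \<open>The walk of the previous section in executable form: the two lists of placed wires are
  used in turn.\<close>

fun walk :: "nat \<Rightarrow> ('a \<times> 'a) list \<Rightarrow> ('a \<times> 'a) list \<Rightarrow> 'a \<Rightarrow> 'a \<Rightarrow> bool" where
  "walk 0 E F x z \<longleftrightarrow> x = z"
| "walk (Suc n) E F x z \<longleftrightarrow> x = z \<or>
     (case map_of E x of None \<Rightarrow> False | Some y \<Rightarrow> walk n F E y z)"

lemma walk_sound: "walk n E F x z \<Longrightarrow> set E \<subseteq> R \<Longrightarrow> set F \<subseteq> R \<Longrightarrow> (x, z) \<in> R\<^sup>*"
proof (induction n E F x z rule: walk.induct)
  case (2 n E F x z)
  show ?case
  proof (cases "x = z")
    case False
    then obtain y where "map_of E x = Some y" "walk n F E y z"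
      using "2.prems"(1) by (auto split: option.splits)
    moreover from this have "(x, y) \<in> R" using "2.prems"(2) map_of_SomeD by fast
    ultimately show ?thesis using 2 by (meson converse_rtrancl_into_rtrancl)
  qed simp
qed simp

definition placed_wires :: "nat \<Rightarrow> jones4 \<Rightarrow> ((nat \<times> nat) \<times> (nat \<times> nat)) list" where
  "placed_wires k t =
     map (\<lambda>(a, b). (place k a, place k b)) (wires t @ map prod.swap (wires t))"

lemma placed_wires: "set (placed_wires k t) \<subseteq> wire_steps k (diag t)"
  unfolding placed_wires_def wire_steps_def diag_def by (force simp: insert_commute)

text \<open>A product of two diagrams in \<open>\<J>\<^sub>4\<close> has paths of at most five wires: a path can visit
  each of the four middle points once.\<close>

lemma mult_walks:
  assumes "(a, b) \<in> set (wires (mul s t))"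
  shows "(outer a, outer b) \<in> (wire_steps 0 (diag s) \<union> wire_steps 1 (diag t))\<^sup>*"
proof -
  have "list_all (\<lambda>s. list_all (\<lambda>t. list_all (\<lambda>(a, b).
      (let E = placed_wires 0 s; F = placed_wires 1 t in
       if fst (outer a) = 0 then walk 5 E F (outer a) (outer b)
       else walk 5 F E (outer a) (outer b))) (wires (mul s t))) all_elements) all_elements"
    by code_simp
  then have "walk 5 (placed_wires 0 s) (placed_wires 1 t) (outer a) (outer b) \<or>
      walk 5 (placed_wires 1 t) (placed_wires 0 s) (outer a) (outer b)"
    using assms unfolding list_all_iff Let_def
    by (auto dest!: bspec[OF bspec[OF _ in_all_elements[of s]] in_all_elements[of t]] split: if_splits)
  then show ?thesis using placed_wires[of 0 s] placed_wires[of 1 t]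
    by (auto elim!: walk_sound)
qed

lemma diag_mul: "diagram_mult 4 (diag s) (diag t) = diag (mul s t)"
proof (rule diagram_mult_eqI[OF wire_diagram_diag wire_diagram_diag wire_diagram_diag])
  fix a b assume "{a, b} \<in> diag (mul s t)"
  then have ab: "(a, b) \<in> set (wires (mul s t)) \<or> (b, a) \<in> set (wires (mul s t))"
    by (force simp: diag_def doubleton_eq_iff)
  have "sym (wire_steps 0 (diag s) \<union> wire_steps 1 (diag t))"
    using wire_steps_sym by (intro sym_Un symI)
  then have "sym ((wire_steps 0 (diag s) \<union> wire_steps 1 (diag t))\<^sup>*)" by (rule sym_rtrancl)
  with ab show "(outer a, outer b) \<in> (wire_steps 0 (diag s) \<union> wire_steps 1 (diag t))\<^sup>*"
    using mult_walks symD by metis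
qed

text \<open>Both families of blocks partition the same set.\<close>

lemma wire_diagram_subset:
  assumes "wire_diagram n D" "wire_diagram n D'" "D \<subseteq> D'"
  shows "D = D'"
proof (rule antisym[OF assms(3)], rule subsetI)
  fix x assume x: "x \<in> D'"
  have "x \<noteq> {}" "x \<subseteq> \<Union>D" using x assms(1,2) by (auto simp: wire_diagram_def partition_on_def)
  then obtain y p where y: "y \<in> D" "p \<in> x" "p \<in> y" by blast
  have "disjoint D'" using assms(2) by (simp add: wire_diagram_def partition_on_def)
  from disjointD[OF this x, of y] y assms(3) have "x = y" by blast
  with y show "x \<in> D" by simp
qed

lemma inj_diag: "diag s = diag t \<Longrightarrow> s = t"
proof -
  assume eq: "diag s = diag t"
  have "list_all (\<lambda>s. list_all (\<lambda>t. s = t \<or>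
     (\<exists>(a, b)\<in>set (wires s). (a, b) \<notin> set (wires t) \<and> (b, a) \<notin> set (wires t))) all_elements) all_elements"
    by code_simp
  then have *: "s = t \<or>
     (\<exists>(a, b)\<in>set (wires s). (a, b) \<notin> set (wires t) \<and> (b, a) \<notin> set (wires t))"
    by (simp add: list_all_iff)
  have "(a, b) \<in> set (wires t) \<or> (b, a) \<in> set (wires t)" if "(a, b) \<in> set (wires s)" for a b
  proof -
    have "{a, b} \<in> diag s" unfolding diag_def using that by force
    with eq have "{a, b} \<in> diag t" by simp
    then show ?thesis by (force simp: diag_def doubleton_eq_iff)
  qed
  with * show ?thesis by auto
qed

definition interleave :: "nat \<Rightarrow> nat \<Rightarrow> nat \<Rightarrow> nat \<Rightarrow> bool" where
  "interleave a b c d \<longleftrightarrow> a < c \<and> c < b \<and> b < d"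

text \<open>Boundary positions \<open>i\<close> and \<open>j\<close> with partners \<open>x\<close> and \<open>y\<close>: the wires \<open>ix\<close> and \<open>jy\<close> are
  the same or disjoint, and they do not cross.\<close>

definition compatible :: "nat \<Rightarrow> nat \<Rightarrow> nat \<Rightarrow> nat \<Rightarrow> bool" where
  "compatible i x j y \<longleftrightarrow> x \<noteq> y \<and> (x = j \<longleftrightarrow> y = i) \<and>
     (\<forall>(a, b)\<in>{(i, x), (x, i)}. \<forall>(c, d)\<in>{(j, y), (y, j)}.
        \<not> interleave a b c d \<and> \<not> interleave c d a b)"

text \<open>The number of noncrossing matchings is small enough for an exhaustive search over
  the partners of the boundary positions 1 to 8, provided that conflicting choices are discarded
  as early as possible.\<close>

fun partner_lists :: "nat \<Rightarrow> nat list list" where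
  "partner_lists 0 = [[]]"
| "partner_lists (Suc n) =
     concat (map (\<lambda>xs. map (\<lambda>y. xs @ [y]) (filter (\<lambda>y. y \<noteq> Suc n \<and>
        (\<forall>i\<in>set [0..<n]. compatible (Suc i) (xs ! i) (Suc n) y)) [1, 2, 3, 4, 5, 6, 7, 8]))
       (partner_lists n))"

lemma partner_lists_SucI:
  assumes xs: "xs \<in> set (partner_lists n)" and y: "y \<in> {1..8}" "y \<noteq> Suc n"
    and comp: "\<And>i. i < n \<Longrightarrow> compatible (Suc i) (xs ! i) (Suc n) y"
  shows "xs @ [y] \<in> set (partner_lists (Suc n))"
proof -
  let ?P = "\<lambda>y. y \<noteq> Suc n \<and> (\<forall>i\<in>set [0..<n]. compatible (Suc i) (xs ! i) (Suc n) y)"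
  have "y \<in> set [1, 2, 3, 4, 5, 6, 7, 8]" using y(1) by auto
  then have "y \<in> set (filter ?P [1, 2, 3, 4, 5, 6, 7, 8])"
    using y(2) comp unfolding set_filter by simp
  then have "xs @ [y] \<in> set (map (\<lambda>y. xs @ [y]) (filter ?P [1, 2, 3, 4, 5, 6, 7, 8]))"
    unfolding set_map by (rule imageI)
  with xs show ?thesis
    unfolding partner_lists.simps set_concat by (subst set_map) (rule UN_I[OF imageI])
qed

lemma map_in_partner_lists:
  assumes "\<And>i. i \<in> {1..n} \<Longrightarrow> f i \<in> {1..8} \<and> f i \<noteq> i"
    and "\<And>i j. i \<in> {1..n} \<Longrightarrow> j \<in> {1..n} \<Longrightarrow> i < j \<Longrightarrow> compatible i (f i) j (f j)"
  shows "map f [1..<Suc n] \<in> set (partner_lists n)"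
  using assms
proof (induction n)
  case (Suc n)
  have IH: "map f [1..<Suc n] \<in> set (partner_lists n)"
    by (rule Suc.IH) (use Suc.prems in auto)
  have "compatible (Suc i) (map f [1..<Suc n] ! i) (Suc n) (f (Suc n))" if "i < n" for i
  proof -
    have "map f [1..<Suc n] ! i = f (Suc i)" using that by (subst nth_map) (auto simp del: upt_Suc)
    then show ?thesis using that Suc.prems(2)[of "Suc i" "Suc n"] by auto
  qed
  with IH have "map f [1..<Suc n] @ [f (Suc n)] \<in> set (partner_lists (Suc n))"
    using Suc.prems(1)[of "Suc n"] by (intro partner_lists_SucI) auto
  then show ?case by (simp del: partner_lists.simps)
qed simp

lemma partner_lists_8:
  assumes "xs \<in> set (partner_lists 8)"
  shows "\<exists>t. \<forall>(a, b)\<in>set (wires t). xs ! (boundary_pos 4 a - 1) = boundary_pos 4 b"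
proof -
  have "list_all (\<lambda>xs. list_ex (\<lambda>t. list_all
      (\<lambda>(a, b). xs ! (boundary_pos 4 a - 1) = boundary_pos 4 b) (wires t)) all_elements) (partner_lists 8)"
    by code_simp
  with assms show ?thesis unfolding list_all_iff list_ex_iff by blast
qed

lemma boundary_pos_bij: "bij_betw (boundary_pos 4) (points 4) {1..8}"
proof -
  have "inj_on (boundary_pos 4) (points 4)" by (auto simp: points4 inj_on_def)
  moreover have "{1..8} = {1, 2, 3, 4, 5, 6, 7, 8::nat}" by auto
  then have "boundary_pos 4 ` points 4 = {1..8}" by (auto simp: points4)
  ultimately show ?thesis by (simp add: bij_betw_def)
qed

lemma jones_diagram_is_diag:
  assumes "D \<in> jones_diagrams 4"
  shows "\<exists>t. D = diag t"
proof -
  have wd: "wire_diagram 4 D" and nc: "noncrossing 4 D"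
    using assms by (auto simp: jones_diagrams_def)
  let ?pos = "boundary_pos 4"
  have "\<exists>q. {p, q} \<in> D" if "p \<in> points 4" for p
  proof -
    have "\<Union>D = points 4" using wd by (simp add: wire_diagram_def partition_on_def)
    with that obtain x where x: "x \<in> D" "p \<in> x" by blast
    then have "card x = 2" using wd by (simp add: wire_diagram_def)
    with x show ?thesis by (auto simp: card_2_iff insert_commute)
  qed
  then obtain g where g: "\<And>p. p \<in> points 4 \<Longrightarrow> {p, g p} \<in> D" by metis
  have g_points: "g p \<in> points 4" if "p \<in> points 4" for p
    using g[OF that] wd by (auto simp: wire_diagram_def partition_on_def)
  define pt where "pt = the_inv_into (points 4) ?pos"
  have pt: "pt i \<in> points 4" "?pos (pt i) = i" if "i \<in> {1..8}" for i
    using that boundary_pos_bij the_inv_into_into[of ?pos "points 4" i "points 4"]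
      f_the_inv_into_f[of ?pos "points 4" i]
    by (auto simp: pt_def bij_betw_def)
  have pt_pos: "pt (?pos p) = p" if "p \<in> points 4" for p
    using that boundary_pos_bij by (simp add: pt_def bij_betw_def the_inv_into_f_f)
  have pos_eq: "?pos p = ?pos q \<longleftrightarrow> p = q" if "p \<in> points 4" "q \<in> points 4" for p q
    using that pt_pos by metis
  define f where "f i = ?pos (g (pt i))" for i
  have f: "f i \<in> {1..8} \<and> f i \<noteq> i" if "i \<in> {1..8}" for i
  proof
    show "f i \<in> {1..8}" using boundary_pos_bij g_points pt[OF that]
      by (auto simp: f_def bij_betw_def simp del: atLeastAtMost_iff)
    have "g (pt i) \<noteq> pt i" using wire_neq[OF wd g] pt(1)[OF that] by metis
    then show "f i \<noteq> i" using pos_eq[of "g (pt i)" "pt i"] g_points pt[OF that] by (auto simp: f_def)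
  qed
  have "compatible i (f i) j (f j)" if ij: "i \<in> {1..8}" "j \<in> {1..8}" "i < j" for i j
  proof -
    let ?p = "pt i" and ?q = "pt j"
    have pts: "?p \<in> points 4" "?q \<in> points 4" "g ?p \<in> points 4" "g ?q \<in> points 4"
      and i: "?pos ?p = i" and j: "?pos ?q = j"
      using ij pt g_points by auto
    have p: "{?p, g ?p} \<in> D" "{g ?p, ?p} \<in> D" and q: "{?q, g ?q} \<in> D" "{g ?q, ?q} \<in> D"
      using g pts by (auto simp: insert_commute)
    have "?p \<noteq> ?q" using i j ij by auto
    then have "g ?p \<noteq> g ?q" using wire_unique[OF wd p(2)] q(2) by metis
    then have "f i \<noteq> f j" using pos_eq pts by (simp add: f_def)
    moreover have "g ?p = ?q \<longleftrightarrow> g ?q = ?p"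
      using wire_unique[OF wd p(2)] wire_unique[OF wd q(2)] p(1) q(1) by metis
    then have "f i = j \<longleftrightarrow> f j = i"
      using pos_eq pts i j unfolding f_def by metis
    moreover have no: "\<not> interleave (?pos a) (?pos b) (?pos c) (?pos d)"
      if "{a, b} \<in> D" "{c, d} \<in> D" for a b c d
      using nc that unfolding noncrossing_def interleave_def by blast
    ultimately show ?thesis unfolding compatible_def
      using no[OF p(1) q(1)] no[OF p(1) q(2)] no[OF p(2) q(1)] no[OF p(2) q(2)]
        no[OF q(1) p(1)] no[OF q(1) p(2)] no[OF q(2) p(1)] no[OF q(2) p(2)] i j
      by (simp add: f_def)
  qed
  then have "map f [1..<Suc 8] \<in> set (partner_lists 8)"
    using f by (intro map_in_partner_lists) auto
  from partner_lists_8[OF this]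
  obtain t where t: "\<forall>(a, b)\<in>set (wires t). map f [1..<Suc 8] ! (?pos a - 1) = ?pos b" ..
  have "{a, b} \<in> D" if ab: "(a, b) \<in> set (wires t)" for a b
  proof -
    have "set ((\<lambda>(a, b). [a, b]) (a, b)) \<subseteq> set (concat (map (\<lambda>(a, b). [a, b]) (wires t)))"
      using ab unfolding set_concat set_map by (intro Union_upper imageI)
    then have pts: "a \<in> points 4" "b \<in> points 4" unfolding wires_points by auto
    then have "?pos a \<in> {1..8}" using boundary_pos_bij by (auto simp: bij_betw_def)
    then have "map f [1..<Suc 8] ! (?pos a - 1) = f (?pos a)"
      by (subst nth_map) (auto simp del: upt_Suc)
    with bspec[OF t ab] have "f (?pos a) = ?pos b" unfolding split_conv by simp
    then have "g a = b" using pts pos_eq g_points by (simp add: f_def pt_pos)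
    then show ?thesis using g pts by auto
  qed
  then have "diag t \<subseteq> D" by (auto simp: diag_def)
  then show ?thesis using wire_diagram_subset[OF wire_diagram_diag wd] by blast
qed

lemma carrier_jones: "carrier (jones 4) = range diag"
  using jones_diagram_is_diag wire_diagram_diag noncrossing_diag
  by (auto simp: jones_def jones_diagrams_def)

lemma mult_jones: "diag s \<otimes>\<^bsub>jones 4\<^esub> diag t = diag (mul s t)"
  by (simp add: jones_def diag_mul)

fun word_value :: "(nat \<Rightarrow> jones4) \<Rightarrow> word \<Rightarrow> jones4" where
  "word_value \<tau> [] = Ident"
| "word_value \<tau> (x # w) = mul (\<tau> x) (word_value \<tau> w)"

lemma word_value_append: "word_value \<tau> (u @ v) = mul (word_value \<tau> u) (word_value \<tau> v)"
  by (induction u) (auto simp: mul_assoc)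

text \<open>A homomorphism from the free semigroup is given by the images of the letters, and the
  model transports them to \<open>jones4\<close>.\<close>

lemma identity_holds_jones:
  assumes "w \<noteq> []" "w' \<noteq> []"
  shows "identity_holds (jones 4) w w' \<longleftrightarrow> (\<forall>\<tau>. word_value \<tau> w = word_value \<tau> w')"
proof
  assume holds: "identity_holds (jones 4) w w'"
  show "\<forall>\<tau>. word_value \<tau> w = word_value \<tau> w'"
  proof
    fix \<tau>
    have "word_hom (jones 4) (\<lambda>u. diag (word_value \<tau> u))"
      by (simp add: word_hom_def carrier_jones mult_jones word_value_append)
    then have "diag (word_value \<tau> w) = diag (word_value \<tau> w')"
      using spec[OF holds[unfolded identity_holds_def], of "\<lambda>u. diag (word_value \<tau> u)"] by simp
    then show "word_value \<tau> w = word_value \<tau> w'" by (rule inj_diag)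
  qed
next
  assume eq: "\<forall>\<tau>. word_value \<tau> w = word_value \<tau> w'"
  show "identity_holds (jones 4) w w'"
    unfolding identity_holds_def
  proof (intro allI impI)
    fix \<phi> assume hom: "word_hom (jones 4) \<phi>"
    then have "\<forall>x. \<exists>t. \<phi> [x] = diag t" by (auto simp: word_hom_def carrier_jones image_iff)
    from choice[OF this] obtain \<tau> where \<tau>: "\<And>x. \<phi> [x] = diag (\<tau> x)" by blast
    have "\<phi> u = diag (word_value \<tau> u)" if "u \<noteq> []" for u
      using that
    proof (induction u rule: list_nonempty_induct)
      case (cons x u)
      have "\<phi> ([x] @ u) = \<phi> [x] \<otimes>\<^bsub>jones 4\<^esub> \<phi> u"
        using hom cons.hyps unfolding word_hom_def by blast
      then show ?case by (simp add: cons.IH \<tau> mult_jones)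
    qed (simp add: \<tau>)
    then show "\<phi> w = \<phi> w'" using eq assms by simp
  qed
qed

section \<open>The identities of the Jones monoid\<close>

fun factors :: "'a list \<Rightarrow> ('a \<times> 'a) set" where
  "factors (x # y # u) = insert (x, y) (factors (y # u))"
| "factors _ = {}"

lemma in_factors_iff: "(x, y) \<in> factors u \<longleftrightarrow> (\<exists>A B. u = A @ x # y # B)"
proof
  show "\<exists>A B. u = A @ x # y # B" if "(x, y) \<in> factors u"
    using that
  proof (induction u rule: factors.induct)
    case (1 a b u)
    show ?case
    proof (cases "(x, y) \<in> factors (b # u)")
      case True
      then obtain A B where "b # u = A @ x # y # B" using "1.IH" by blast
      then have "a # b # u = (a # A) @ x # y # B" by simp
      then show ?thesis by blast
    next
      case False
      then have "a # b # u = [] @ x # y # u" using "1.prems" by simp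
      then show ?thesis by blast
    qed
  qed auto
  have "(x, y) \<in> factors (A @ x # y # B)" for A B
  proof (induction A)
    case (Cons a A)
    then show ?case by (cases A) auto
  qed simp
  then show "(x, y) \<in> factors u" if "\<exists>A B. u = A @ x # y # B" using that by blast
qed

text \<open>\<open>M\<close> may contain \<open>x\<close> or \<open>y\<close>; what is required then follows from the requirement for a closer
  pair of occurrences.\<close>

definition covers :: "'a list \<Rightarrow> 'a list \<Rightarrow> bool" where
  "covers W W' \<longleftrightarrow> (\<forall>A x M y B. W = A @ x # M @ y # B \<longrightarrow>
     (\<exists>A' M' B'. W' = A' @ x # M' @ y # B' \<and> set M' \<subseteq> set M))"

lemma filter_eq_appendD:
  "filter P W = A @ B \<Longrightarrow> \<exists>U V. W = U @ V \<and> filter P U = A \<and> filter P V = B"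
proof (induction A arbitrary: W)
  case Nil
  then show ?case by (metis append_Nil filter.simps(1))
next
  case (Cons a A)
  obtain U V where W: "W = U @ a # V" "\<forall>u\<in>set U. \<not> P u" "P a" "A @ B = filter P V"
    using filter_eq_ConsD[of P W a "A @ B"] Cons.prems by auto
  with Cons.IH[of V] obtain U' V' where "V = U' @ V'" "filter P U' = A" "filter P V' = B" by auto
  with W have "W = (U @ a # U') @ V' \<and> filter P (U @ a # U') = a # A \<and> filter P V' = B"
    by simp
  then show ?case by blast
qed

lemma in_factors_filter_iff:
  "(x, y) \<in> factors (filter P W) \<longleftrightarrow>
     (\<exists>A M B. W = A @ x # M @ y # B \<and> P x \<and> P y \<and> (\<forall>z\<in>set M. \<not> P z))"
proof
  assume "(x, y) \<in> factors (filter P W)"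
  then obtain A B where "filter P W = A @ x # y # B" by (auto simp: in_factors_iff)
  then obtain U V where UV: "W = U @ V" "filter P V = x # y # B"
    by (blast dest: filter_eq_appendD)
  obtain U1 V1 where 1: "V = U1 @ x # V1" "P x" "filter P V1 = y # B"
    using filter_eq_ConsD[OF UV(2)] by metis
  obtain M V2 where 2: "V1 = M @ y # V2" "\<forall>z\<in>set M. \<not> P z" "P y"
    using filter_eq_ConsD[OF 1(3)] by metis
  have "W = (U @ U1) @ x # M @ y # V2" by (simp add: UV 1 2)
  with 1 2 show "\<exists>A M B. W = A @ x # M @ y # B \<and> P x \<and> P y \<and> (\<forall>z\<in>set M. \<not> P z)" by blast
next
  assume "\<exists>A M B. W = A @ x # M @ y # B \<and> P x \<and> P y \<and> (\<forall>z\<in>set M. \<not> P z)"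
  then show "(x, y) \<in> factors (filter P W)"
    by (auto simp: in_factors_iff filter_empty_conv[THEN iffD2]) blast
qed

lemma covers_factors_filter:
  assumes "covers W W'"
  shows "factors (filter P W) \<subseteq> factors (filter P W')"
proof
  fix z assume "z \<in> factors (filter P W)"
  moreover obtain x y where z: "z = (x, y)" by (cases z)
  ultimately obtain A M B where "W = A @ x # M @ y # B" and P: "P x" "P y" "\<forall>z\<in>set M. \<not> P z"
    by (auto simp: in_factors_filter_iff)
  with assms obtain A' M' B' where "W' = A' @ x # M' @ y # B'" "set M' \<subseteq> set M"
    unfolding covers_def by blast
  with P show "z \<in> factors (filter P W')" unfolding z in_factors_filter_iff by blast
qed

text \<open>The end markers turn the first and the last letter into factors of length 2, so that they
  are treated like the others.\<close>

definition framed :: "'a list \<Rightarrow> 'a option list" where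
  "framed w = None # map Some w @ [None]"

lemma filter_framed: "P None \<Longrightarrow> filter P (framed w) = framed (filter (\<lambda>x. P (Some x)) w)"
  by (simp add: framed_def filter_map comp_def)

text \<open>Given positions of \<open>x\<close> and \<open>y\<close> in \<open>w\<close> with \<open>M\<close> in between, keep exactly the letters not in
  \<open>M\<close>.  Then \<open>xy\<close> becomes a factor, and an occurrence of this factor in the subword of \<open>w'\<close>
  comes from a pair of positions with only letters of \<open>M\<close> in between.  If \<open>M\<close> contains \<open>x\<close> or
  \<open>y\<close>, a closer pair does the job, whence the induction.\<close>

lemma covers_framedI:
  assumes "\<And>P. factors (framed (filter P w)) \<subseteq> factors (framed (filter P w'))"
  shows "covers (framed w) (framed w')"
  unfolding covers_def
proof (intro allI impI)
  fix A M B x y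
  assume "framed w = A @ x # M @ y # B"
  then show "\<exists>A' M' B'. framed w' = A' @ x # M' @ y # B' \<and> set M' \<subseteq> set M"
  proof (induction "length M" arbitrary: A M B rule: less_induct)
    case less
    show ?case
    proof (cases "x \<in> set M \<or> y \<in> set M")
      case True
      then show ?thesis
      proof
        assume "x \<in> set M"
        then obtain M1 M2 where M: "M = M1 @ x # M2" by (meson split_list)
        have "\<exists>A' M' B'. framed w' = A' @ x # M' @ y # B' \<and> set M' \<subseteq> set M2"
          by (rule less.hyps[of M2 "A @ x # M1" B]) (simp_all add: M less.prems)
        then show ?thesis unfolding M by fastforce
      next
        assume "y \<in> set M"
        then obtain M1 M2 where M: "M = M1 @ y # M2" by (meson split_list)
        have "\<exists>A' M' B'. framed w' = A' @ x # M' @ y # B' \<and> set M' \<subseteq> set M1"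
          by (rule less.hyps[of M1 A "M2 @ y # B"]) (simp_all add: M less.prems)
        then show ?thesis unfolding M by fastforce
      qed
    next
      case False
      let ?P = "\<lambda>z. z \<notin> set M"
      have "None \<notin> set M"
      proof -
        have "butlast (tl (framed w)) = map Some w" by (simp add: framed_def)
        then have "map Some w = tl (A @ [x]) @ M @ butlast (y # B)"
          unfolding less.prems by (cases A) (auto simp: butlast_append)
        then have "set M \<subseteq> set (map Some w)" by auto
        then show ?thesis by auto
      qed
      then have filt: "factors (filter ?P (framed w)) \<subseteq> factors (filter ?P (framed w'))"
        using assms by (simp add: filter_framed)
      have "(x, y) \<in> factors (filter ?P (framed w))"
        using False less.prems unfolding in_factors_filter_iff by blast
      with filt have "(x, y) \<in> factors (filter ?P (framed w'))" by blast
      then show ?thesis unfolding in_factors_filter_iff by blast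
    qed
  qed
qed

lemma factors_framed:
  assumes "u \<noteq> []"
  shows "factors (framed u) =
    {(None, Some (hd u)), (Some (last u), None)} \<union> map_prod Some Some ` factors u"
proof -
  have "factors (map Some u @ [None]) = insert (Some (last u), None) (map_prod Some Some ` factors u)"
    using assms by (induction u rule: factors.induct) auto
  with assms show ?thesis by (cases u) (auto simp: framed_def)
qed

lemma in_factors_framed_iff:
  assumes "u \<noteq> []"
  shows "(None, Some a) \<in> factors (framed u) \<longleftrightarrow> a = hd u"
    and "(Some a, None) \<in> factors (framed u) \<longleftrightarrow> a = last u"
    and "(Some a, Some b) \<in> factors (framed u) \<longleftrightarrow> (a, b) \<in> factors u"
    and "(None, None) \<notin> factors (framed u)"
  unfolding factors_framed[OF assms] by auto

lemma factors_framed_Nil: "factors (framed []) = {(None, None)}"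
  by (simp add: framed_def)

lemma set_eq_factors: "u \<noteq> [] \<Longrightarrow> set u = insert (hd u) (snd ` factors u)"
  by (induction u rule: factors.induct) auto

fun left_cup :: "jones4 \<Rightarrow> cup" where "left_cup (Hook c d) = c" | "left_cup _ = Bot"
fun right_cup :: "jones4 \<Rightarrow> cup" where "right_cup (Hook c d) = d" | "right_cup _ = Bot"
fun left_nested :: "jones4 \<Rightarrow> bool" where
  "left_nested (Hook c d) = nested c" | "left_nested (Cut a b) = a" | "left_nested Ident = False"
fun right_nested :: "jones4 \<Rightarrow> bool" where
  "right_nested (Hook c d) = nested d" | "right_nested (Cut a b) = b" | "right_nested Ident = False"

text \<open>The words without identity letters whose value still has wires running through.\<close>

definition keeps_rank :: "(nat \<Rightarrow> jones4) \<Rightarrow> word \<Rightarrow> bool" where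
  "keeps_rank \<tau> u \<longleftrightarrow> (\<forall>x\<in>set u. (\<exists>c d. \<tau> x = Hook c d)) \<and>
     (\<forall>(x, y)\<in>factors u. \<not> clash (right_cup (\<tau> x)) (left_cup (\<tau> y)))"

lemma word_value_filter: "word_value \<tau> w = word_value \<tau> (filter (\<lambda>x. \<tau> x \<noteq> Ident) w)"
  by (induction w) auto

text \<open>A product loses its through wires as soon as one letter has none or two consecutive letters
  clash; what remains depends on the two extreme letters only.\<close>

lemma word_value_no_Ident:
  assumes "u \<noteq> []" "\<forall>x\<in>set u. \<tau> x \<noteq> Ident"
  shows "word_value \<tau> u = (if keeps_rank \<tau> u then Hook (left_cup (\<tau> (hd u))) (right_cup (\<tau> (last u)))
    else Cut (left_nested (\<tau> (hd u))) (right_nested (\<tau> (last u))))"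
  using assms
proof (induction u rule: factors.induct)
  case (1 x y u)
  let ?v = "y # u"
  have thr: "keeps_rank \<tau> (x # ?v) \<longleftrightarrow> (\<exists>c d. \<tau> x = Hook c d) \<and> keeps_rank \<tau> ?v \<and>
      \<not> clash (right_cup (\<tau> x)) (left_cup (\<tau> y))"
    by (auto simp: keeps_rank_def)
  have IH: "word_value \<tau> ?v = (if keeps_rank \<tau> ?v then Hook (left_cup (\<tau> y)) (right_cup (\<tau> (last ?v)))
      else Cut (left_nested (\<tau> y)) (right_nested (\<tau> (last ?v))))"
    using 1 by simp
  have last: "keeps_rank \<tau> ?v \<Longrightarrow> right_nested (\<tau> (last ?v)) = nested (right_cup (\<tau> (last ?v)))"
    using last_in_set[of ?v] unfolding keeps_rank_def by fastforce
  have ev: "word_value \<tau> (x # ?v) = mul (\<tau> x) (word_value \<tau> ?v)" by simp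
  have last_v: "last (x # ?v) = last ?v" by simp
  show ?case
  proof (cases "\<tau> x")
    case Ident
    then show ?thesis using 1 by simp
  next
    case (Hook c d)
    then show ?thesis unfolding ev IH thr last_v using last by (auto simp del: word_value.simps last.simps)
  next
    case (Cut a b)
    then show ?thesis unfolding ev IH thr last_v using last by (auto simp del: word_value.simps last.simps)
  qed
next
  case ("2_2" x)
  then show ?case by (cases "\<tau> x") (auto simp: keeps_rank_def)
qed simp

text \<open>The case \<open>P x \<longleftrightarrow> \<tau> x \<noteq> Ident\<close> of the hypothesis settles the value under \<open>\<tau>\<close>.\<close>

lemma word_value_eq_if_factors_eq:
  assumes "\<And>P. factors (framed (filter P w)) = factors (framed (filter P w'))"
  shows "word_value \<tau> w = word_value \<tau> w'"
proof -
  let ?u = "filter (\<lambda>x. \<tau> x \<noteq> Ident) w" and ?u' = "filter (\<lambda>x. \<tau> x \<noteq> Ident) w'"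
  have eq: "factors (framed ?u) = factors (framed ?u')" by (rule assms)
  have empty: "u = [] \<longleftrightarrow> (None, None) \<in> factors (framed u)" for u :: word
    using factors_framed_Nil factors_framed[of u] by (cases "u = []") auto
  have "word_value \<tau> ?u = word_value \<tau> ?u'"
  proof (cases "?u = []")
    case True
    with eq empty[of ?u] empty[of ?u'] show ?thesis by simp
  next
    case False
    with eq empty[of ?u] empty[of ?u'] have False': "?u' \<noteq> []" by simp
    have hd: "hd ?u = hd ?u'"
      using in_factors_framed_iff(1)[OF False] in_factors_framed_iff(1)[OF False'] eq by metis
    have last: "last ?u = last ?u'"
      using in_factors_framed_iff(2)[OF False] in_factors_framed_iff(2)[OF False'] eq by metis
    have "(a, b) \<in> factors ?u \<longleftrightarrow> (a, b) \<in> factors ?u'" for a b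
      using in_factors_framed_iff(3)[OF False] in_factors_framed_iff(3)[OF False'] eq by metis
    then have fac: "factors ?u = factors ?u'" by auto
    have "set ?u = set ?u'"
      using set_eq_factors[OF False] set_eq_factors[OF False'] hd fac by simp
    then have "keeps_rank \<tau> ?u = keeps_rank \<tau> ?u'" using fac by (simp add: keeps_rank_def)
    then show ?thesis
      using word_value_no_Ident[OF False, of \<tau>] word_value_no_Ident[OF False', of \<tau>] hd last by auto
  qed
  then show ?thesis using word_value_filter[of \<tau> w] word_value_filter[of \<tau> w'] by simp
qed

text \<open>If \<open>xy\<close> is a factor on one side only, a single substitution tells the words apart: letters
  outside \<open>P\<close> become the identity, \<open>x\<close> ends in the bottom cup, \<open>y\<close> begins with the top cup,
  and all other cups are middle ones.  Then \<open>xy\<close> is the only clash.  The same substitution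
  works when \<open>x\<close> or \<open>y\<close> is an end marker: no clash occurs, and the value shows the extreme
  letters.\<close>

lemma factors_subset_if_word_value_eq:
  assumes eq: "\<And>\<tau>. word_value \<tau> w = word_value \<tau> w'"
  shows "factors (framed (filter P w)) \<subseteq> factors (framed (filter P w'))"
proof
  fix z assume z: "z \<in> factors (framed (filter P w))"
  obtain x y where xy: "z = (x, y)" by (cases z)
  define \<tau> where "\<tau> a = (if P a then
      Hook (if Some a = y then Top else Mid) (if Some a = x then Bot else Mid) else Ident)" for a
  let ?u = "filter P w" and ?u' = "filter P w'"
  have "(\<lambda>x. \<tau> x \<noteq> Ident) = P" by (auto simp: \<tau>_def)
  then have ev: "word_value \<tau> ?u = word_value \<tau> ?u'"
    using eq[of \<tau>] word_value_filter[of \<tau> w] word_value_filter[of \<tau> w'] by simp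
  have val: "word_value \<tau> u = (if (x, y) \<in> map_prod Some Some ` factors u
      then Cut (left_nested (\<tau> (hd u))) (right_nested (\<tau> (last u)))
      else Hook (if Some (hd u) = y then Top else Mid) (if Some (last u) = x then Bot else Mid))"
    if u: "u \<noteq> []" "\<forall>a\<in>set u. P a" for u
  proof -
    have P: "P (hd u)" "P (last u)" using u by auto
    have fst: "fst ` factors u \<subseteq> set u"
      by (induction u rule: factors.induct) auto
    have "P a \<and> P b" if "(a, b) \<in> factors u" for a b
      using that u fst set_eq_factors[OF u(1)] by (metis fst_conv image_eqI insertCI snd_conv subsetD)
    then have "keeps_rank \<tau> u \<longleftrightarrow> (\<forall>(a, b)\<in>factors u. \<not> (Some a = x \<and> Some b = y))"
      using u(2) by (fastforce simp: keeps_rank_def \<tau>_def clash_def split: if_splits)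
    also have "\<dots> \<longleftrightarrow> (x, y) \<notin> map_prod Some Some ` factors u" by force
    finally show ?thesis
      using word_value_no_Ident[OF u(1), of \<tau>] u(2) P by (auto simp: \<tau>_def)
  qed
  have not_Ident: "word_value \<tau> u \<noteq> Ident" if "u \<noteq> []" "\<forall>a\<in>set u. P a" for u
    unfolding val[OF that] by simp
  have all_P: "\<forall>a\<in>set ?u. P a" "\<forall>a\<in>set ?u'. P a" by auto
  show "z \<in> factors (framed ?u')"
  proof (cases "?u = []")
    case True
    then have "word_value \<tau> ?u' = Ident" using ev by simp
    then have "?u' = []" using not_Ident[OF _ all_P(2)] by blast
    then show ?thesis using True z by simp
  next
    case False
    have False': "?u' \<noteq> []"
    proof
      assume "?u' = []"
      then have "word_value \<tau> ?u = Ident" unfolding ev by simp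
      then show False using not_Ident[OF False all_P(1)] by blast
    qed
    have "(if (x, y) \<in> map_prod Some Some ` factors ?u
      then Cut (left_nested (\<tau> (hd ?u))) (right_nested (\<tau> (last ?u)))
      else Hook (if Some (hd ?u) = y then Top else Mid) (if Some (last ?u) = x then Bot else Mid)) =
      (if (x, y) \<in> map_prod Some Some ` factors ?u'
      then Cut (left_nested (\<tau> (hd ?u'))) (right_nested (\<tau> (last ?u')))
      else Hook (if Some (hd ?u') = y then Top else Mid) (if Some (last ?u') = x then Bot else Mid))"
      using ev unfolding val[OF False all_P(1)] val[OF False' all_P(2)] .
    then show ?thesis
      using z unfolding xy factors_framed[OF False] factors_framed[OF False']
      by (auto split: if_splits)
  qed
qed

theorem identity_holds_jones_iff:
  assumes "w \<noteq> []" "w' \<noteq> []"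
  shows "identity_holds (jones 4) w w' \<longleftrightarrow>
    covers (framed w) (framed w') \<and> covers (framed w') (framed w)"
proof
  assume "identity_holds (jones 4) w w'"
  then have "\<And>\<tau>. word_value \<tau> w = word_value \<tau> w'" using identity_holds_jones[OF assms] by blast
  then show "covers (framed w) (framed w') \<and> covers (framed w') (framed w)"
    by (metis covers_framedI factors_subset_if_word_value_eq)
next
  assume cov: "covers (framed w) (framed w') \<and> covers (framed w') (framed w)"
  have "factors (framed (filter P w)) = factors (framed (filter P w'))" for P
  proof -
    have "filter (\<lambda>x. x = None \<or> P (the x)) (framed v) = framed (filter P v)" for v
      by (subst filter_framed) auto
    with covers_factors_filter[of "framed w" "framed w'" "\<lambda>x. x = None \<or> P (the x)"]
      covers_factors_filter[of "framed w'" "framed w" "\<lambda>x. x = None \<or> P (the x)"] cov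
    show ?thesis by simp
  qed
  then show "identity_holds (jones 4) w w'"
    using identity_holds_jones[OF assms] word_value_eq_if_factors_eq by blast
qed

section \<open>Queries about words and their evaluation\<close>

text \<open>A variable is a head, and its value is the position of this head on its own copy of a fixed
  list of symbols.  \<open>Until \<delta> c \<phi> \<psi>\<close> moves the heads repeatedly in the directions \<open>\<delta>\<close> until
  \<open>\<psi>\<close> holds, as long as \<open>\<phi>\<close> holds.  Here \<open>c\<close> is a head that starts at 0 and moves right: it
  counts the rounds, ends the loop and makes it possible to undo it.\<close>

datatype query =
    Tok nat nat
  | Neg query
  | And query query
  | Shift "nat \<Rightarrow> move" query
  | Until "nat \<Rightarrow> move" nat query query

text \<open>Cells outside the list are blank, and 0 is the blank symbol.\<close>

definition cell :: "nat list \<Rightarrow> int \<Rightarrow> nat" where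
  "cell y i = (if 0 \<le> i \<and> i < int (length y) then y ! nat i else 0)"

definition displace :: "(nat \<Rightarrow> move) \<Rightarrow> int \<Rightarrow> (nat \<Rightarrow> int) \<Rightarrow> nat \<Rightarrow> int" where
  "displace \<delta> k v = (\<lambda>i. v i + k * offset (\<delta> i))"

fun sat :: "nat list \<Rightarrow> (nat \<Rightarrow> int) \<Rightarrow> query \<Rightarrow> bool" where
  "sat y v (Tok i a) \<longleftrightarrow> cell y (v i) = a"
| "sat y v (Neg \<phi>) \<longleftrightarrow> \<not> sat y v \<phi>"
| "sat y v (And \<phi> \<psi>) \<longleftrightarrow> sat y v \<phi> \<and> sat y v \<psi>"
| "sat y v (Shift \<delta> \<phi>) \<longleftrightarrow> sat y (displace \<delta> 1 v) \<phi>"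
| "sat y v (Until \<delta> c \<phi> \<psi>) \<longleftrightarrow>
     (\<exists>k\<le>length y. sat y (displace \<delta> (int k) v) \<psi> \<and> (\<forall>j<k. sat y (displace \<delta> (int j) v) \<phi>))"

text \<open>\<open>Z\<close> is a set of heads known to be at 0 when the query is evaluated.\<close>

fun wf_query :: "nat \<Rightarrow> nat set \<Rightarrow> query \<Rightarrow> bool" where
  "wf_query K Z (Tok i a) \<longleftrightarrow> 1 \<le> i \<and> i \<le> K"
| "wf_query K Z (Neg \<phi>) \<longleftrightarrow> wf_query K Z \<phi>"
| "wf_query K Z (And \<phi> \<psi>) \<longleftrightarrow> wf_query K Z \<phi> \<and> wf_query K Z \<psi>"
| "wf_query K Z (Shift \<delta> \<phi>) \<longleftrightarrow> wf_query K {i \<in> Z. \<delta> i = Stay} \<phi>"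
| "wf_query K Z (Until \<delta> c \<phi> \<psi>) \<longleftrightarrow> c \<in> Z \<and> 1 \<le> c \<and> c \<le> K \<and> \<delta> c = Go_Right \<and>
     wf_query K {i \<in> Z. \<delta> i = Stay} \<phi> \<and> wf_query K {i \<in> Z. \<delta> i = Stay} \<psi>"

text \<open>A frame says what remains to be done with the truth value of the subquery under
  evaluation.  \<open>FGoal\<close> and \<open>FInv\<close> belong to a loop whose current round evaluates its \<open>\<psi>\<close> or its
  \<open>\<phi>\<close>.\<close>

datatype frame =
    FNeg
  | FAnd query
  | FShift "nat \<Rightarrow> move"
  | FGoal "nat \<Rightarrow> move" nat query query
  | FInv "nat \<Rightarrow> move" nat query query

text \<open>\<open>Ev \<phi> S\<close> starts the evaluation of \<open>\<phi>\<close>, \<open>Rt b S\<close> returns the value \<open>b\<close> to the topmost frame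
  of \<open>S\<close>, and \<open>Back\<close> undoes the moves of a loop.  The other states belong to the
  preprocessing and to the end of the computation.\<close>

datatype ctl =
    Init | Copy | Copy1 nat | Rewind | Acc | Rej
  | Ev query "frame list"
  | Rt bool "frame list"
  | Back bool "nat \<Rightarrow> move" nat "frame list"

fun opposite :: "move \<Rightarrow> move" where
  "opposite Go_Left = Go_Right"
| "opposite Stay = Stay"
| "opposite Go_Right = Go_Left"

abbreviation still :: "nat \<Rightarrow> move" where "still \<equiv> \<lambda>_. Stay"

fun ev_step :: "ctl \<Rightarrow> (nat \<Rightarrow> nat) \<Rightarrow> ctl \<times> (nat \<Rightarrow> move)" where
  "ev_step (Ev (Tok i a) S) s = (Rt (s i = a) S, still)"
| "ev_step (Ev (Neg \<phi>) S) s = (Ev \<phi> (FNeg # S), still)"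
| "ev_step (Ev (And \<phi> \<psi>) S) s = (Ev \<phi> (FAnd \<psi> # S), still)"
| "ev_step (Ev (Shift \<delta> \<phi>) S) s = (Ev \<phi> (FShift \<delta> # S), \<delta>)"
| "ev_step (Ev (Until \<delta> c \<phi> \<psi>) S) s = (Ev \<psi> (FGoal \<delta> c \<phi> \<psi> # S), still)"
| "ev_step (Rt b (FNeg # S)) s = (Rt (\<not> b) S, still)"
| "ev_step (Rt b (FAnd \<psi> # S)) s = (if b then Ev \<psi> S else Rt False S, still)"
| "ev_step (Rt b (FShift \<delta> # S)) s = (Rt b S, opposite \<circ> \<delta>)"
| "ev_step (Rt b (FGoal \<delta> c \<phi> \<psi> # S)) s =
     (if b then (Back True \<delta> c S, opposite \<circ> \<delta>) else (Ev \<phi> (FInv \<delta> c \<phi> \<psi> # S), still))"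
| "ev_step (Rt b (FInv \<delta> c \<phi> \<psi> # S)) s =
     (if b \<and> s c \<noteq> 0 then (Ev \<psi> (FGoal \<delta> c \<phi> \<psi> # S), \<delta>)
      else (Back False \<delta> c S, opposite \<circ> \<delta>))"
| "ev_step (Back b \<delta> c S) s =
     (if s c = 0 then (Rt b S, \<delta>) else (Back b \<delta> c S, opposite \<circ> \<delta>))"
| "ev_step q s = (q, still)"

text \<open>The symbols under the heads \<open>1, \<dots>, K\<close> are all that the Turing machine will see; the
  others are replaced by 0 so that both computations make literally the same steps.\<close>

definition ev_next :: "nat \<Rightarrow> nat list \<Rightarrow> ctl \<times> (nat \<Rightarrow> int) \<Rightarrow> ctl \<times> (nat \<Rightarrow> int)" where
  "ev_next K y = (\<lambda>(q, v).
     let (q', \<delta>) = ev_step q (\<lambda>i. if 1 \<le> i \<and> i \<le> K then cell y (v i) else 0)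
     in (q', displace \<delta> 1 v))"

fun time_poly :: "query \<Rightarrow> nat poly" where
  "time_poly (Tok i a) = [:1:]"
| "time_poly (Neg \<phi>) = time_poly \<phi> + [:2:]"
| "time_poly (And \<phi> \<psi>) = time_poly \<phi> + time_poly \<psi> + [:2:]"
| "time_poly (Shift \<delta> \<phi>) = time_poly \<phi> + [:2:]"
| "time_poly (Until \<delta> c \<phi> \<psi>) = [:1, 1:] * (time_poly \<phi> + time_poly \<psi> + [:2:]) + [:5, 1:]"

definition reaches :: "('c \<Rightarrow> 'c) \<Rightarrow> 'c \<Rightarrow> nat \<Rightarrow> 'c \<Rightarrow> bool" where
  "reaches f c n d \<longleftrightarrow> (\<exists>t\<le>n. (f ^^ t) c = d)"

lemma reaches_refl: "reaches f c n c"
  unfolding reaches_def by (metis funpow_0 le0)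

lemma reaches_trans: "reaches f c m d \<Longrightarrow> reaches f d n e \<Longrightarrow> reaches f c (m + n) e"
  unfolding reaches_def
proof (elim exE conjE)
  fix t u assume "t \<le> m" "u \<le> n" "(f ^^ t) c = d" "(f ^^ u) d = e"
  then have "u + t \<le> m + n \<and> (f ^^ (u + t)) c = e" by (simp add: funpow_add)
  then show "\<exists>t\<le>m + n. (f ^^ t) c = e" by blast
qed

lemma reaches_step: "reaches f (f c) n d \<Longrightarrow> reaches f c (Suc n) d"
  using reaches_trans[of f c 1 "f c" n d] unfolding reaches_def by (force intro: exI[of _ 1])

lemma reaches_one: "reaches f c 1 (f c)"
  unfolding reaches_def by (force intro: exI[of _ 1])

lemma reaches_mono: "reaches f c m d \<Longrightarrow> m \<le> n \<Longrightarrow> reaches f c n d"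
  unfolding reaches_def using le_trans by blast

lemma displace_0 [simp]: "displace \<delta> 0 v = v"
  by (simp add: displace_def)

lemma displace_still [simp]: "displace still k v = v"
  by (simp add: displace_def)

lemma displace_shift: "displace \<delta> k (displace \<delta> l v) = displace \<delta> (k + l) v"
  by (simp add: displace_def algebra_simps)

lemma offset_opposite: "offset (opposite m) = - offset m"
  by (cases m) auto

lemma displace_opposite: "displace (opposite \<circ> \<delta>) k v = displace \<delta> (- k) v"
  by (simp add: displace_def offset_opposite)

lemma cell_eq_0_iff:
  assumes "0 \<notin> set y"
  shows "cell y i = 0 \<longleftrightarrow> \<not> (0 \<le> i \<and> i < int (length y))"
proof -
  have "y ! nat i \<noteq> 0" if "0 \<le> i" "i < int (length y)"
  proof -
    have "nat i < length y" using that by (simp add: nat_less_iff)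
    then have "y ! nat i \<in> set y" by (rule nth_mem)
    with assms show ?thesis by metis
  qed
  then show ?thesis by (auto simp: cell_def)
qed

text \<open>The head \<open>c\<close> overshoots to the blank cell at \<open>-1\<close>, which is how the start is recognized, and
  all heads then take one step forward.\<close>

lemma back_reaches:
  assumes y: "0 \<notin> set y" and c: "1 \<le> c" "c \<le> K" "v c = 0" "\<delta> c = Go_Right"
    and k: "k \<le> length y"
  shows "reaches (ev_next K y) (Back b \<delta> c S, displace \<delta> (int k - 1) v) (k + 1) (Rt b S, v)"
  using k
proof (induction k)
  case 0
  have "ev_next K y (Back b \<delta> c S, displace \<delta> (- 1) v) = (Rt b S, v)"
    using c y by (simp add: ev_next_def cell_eq_0_iff displace_shift)
      (simp add: displace_def)
  then show ?case using reaches_one[of "ev_next K y"] by (metis add_0 diff_0 of_nat_0)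
next
  case (Suc k)
  have "ev_next K y (Back b \<delta> c S, displace \<delta> (int (Suc k) - 1) v) =
      (Back b \<delta> c S, displace \<delta> (int k - 1) v)"
    using c y Suc.prems
    by (simp add: ev_next_def cell_eq_0_iff displace_shift displace_opposite)
      (simp add: displace_def)
  with Suc show ?case using reaches_step[of "ev_next K y" _ "k + 1"] by simp
qed

text \<open>A loop makes at most \<open>length y + 1\<close> rounds, so each nesting multiplies the running time by a
  linear factor.  Every subquery leaves the heads where it found them; this is what makes the
  statement inductive.\<close>

lemma eval_reaches:
  assumes y: "0 \<notin> set y" and "wf_query K Z \<phi>" "\<forall>i\<in>Z. v i = 0"
  shows "reaches (ev_next K y) (Ev \<phi> S, v) (poly (time_poly \<phi>) (length y)) (Rt (sat y v \<phi>) S, v)"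
  using assms(2,3)
proof (induction \<phi> arbitrary: Z v S)
  case (Tok i a)
  then have "ev_next K y (Ev (Tok i a) S, v) = (Rt (sat y v (Tok i a)) S, v)"
    by (simp add: ev_next_def)
  then show ?case using reaches_one[of "ev_next K y" "(Ev (Tok i a) S, v)"] by simp
next
  case (Neg \<phi>)
  have 1: "ev_next K y (Ev (Neg \<phi>) S, v) = (Ev \<phi> (FNeg # S), v)"
    by (simp add: ev_next_def)
  have 2: "ev_next K y (Rt (sat y v \<phi>) (FNeg # S), v) = (Rt (sat y v (Neg \<phi>)) S, v)"
    by (simp add: ev_next_def)
  have "reaches (ev_next K y) (Ev \<phi> (FNeg # S), v) (poly (time_poly \<phi>) (length y))
      (Rt (sat y v \<phi>) (FNeg # S), v)"
    using Neg by simp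
  from reaches_trans[OF this reaches_one, unfolded 2] reaches_step[of "ev_next K y" "(Ev (Neg \<phi>) S, v)", unfolded 1]
  show ?case by simp
next
  case (And \<phi> \<psi>)
  have 1: "ev_next K y (Ev (And \<phi> \<psi>) S, v) = (Ev \<phi> (FAnd \<psi> # S), v)"
    by (simp add: ev_next_def)
  have 2: "ev_next K y (Rt (sat y v \<phi>) (FAnd \<psi> # S), v) =
      (if sat y v \<phi> then Ev \<psi> S else Rt False S, v)"
    by (simp add: ev_next_def)
  have "reaches (ev_next K y) (Ev \<phi> (FAnd \<psi> # S), v) (poly (time_poly \<phi>) (length y))
      (Rt (sat y v \<phi>) (FAnd \<psi> # S), v)"
    using And.prems by (intro And.IH(1)[of Z]) auto
  from reaches_trans[OF this reaches_one, unfolded 2]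
  have 3: "reaches (ev_next K y) (Ev (And \<phi> \<psi>) S, v) (Suc (poly (time_poly \<phi>) (length y) + 1))
     (if sat y v \<phi> then Ev \<psi> S else Rt False S, v)"
    by (intro reaches_step) (simp add: 1)
  have 4: "reaches (ev_next K y) (if sat y v \<phi> then Ev \<psi> S else Rt False S, v)
     (poly (time_poly \<psi>) (length y)) (Rt (sat y v (And \<phi> \<psi>)) S, v)"
    using And.IH(2)[of Z v S] And.prems by (auto simp: reaches_refl)
  from reaches_trans[OF 3 4] show ?case by (simp add: algebra_simps)
next
  case (Shift \<delta> \<phi>)
  have 1: "ev_next K y (Ev (Shift \<delta> \<phi>) S, v) = (Ev \<phi> (FShift \<delta> # S), displace \<delta> 1 v)"
    by (simp add: ev_next_def)
  have 2: "ev_next K y (Rt (sat y (displace \<delta> 1 v) \<phi>) (FShift \<delta> # S), displace \<delta> 1 v) =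
      (Rt (sat y v (Shift \<delta> \<phi>)) S, v)"
    by (simp add: ev_next_def displace_opposite displace_shift)
  have "\<forall>i\<in>{i \<in> Z. \<delta> i = Stay}. displace \<delta> 1 v i = 0"
    using Shift.prems by (simp add: displace_def)
  then have "reaches (ev_next K y) (Ev \<phi> (FShift \<delta> # S), displace \<delta> 1 v) (poly (time_poly \<phi>) (length y))
      (Rt (sat y (displace \<delta> 1 v) \<phi>) (FShift \<delta> # S), displace \<delta> 1 v)"
    using Shift.IH Shift.prems by simp
  from reaches_trans[OF this reaches_one, unfolded 2] reaches_step[of "ev_next K y" "(Ev (Shift \<delta> \<phi>) S, v)", unfolded 1]
  show ?case by simp
next
  case (Until \<delta> c \<phi> \<psi>)
  let ?R = "reaches (ev_next K y)" and ?n = "length y"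
  let ?p = "poly (time_poly \<phi>) ?n" and ?q = "poly (time_poly \<psi>) ?n"
  let ?w = "\<lambda>k. displace \<delta> (int k) v"
  have c: "1 \<le> c" "c \<le> K" "v c = 0" "\<delta> c = Go_Right" using Until.prems by auto
  have zero: "\<forall>i\<in>{i \<in> Z. \<delta> i = Stay}. ?w k i = 0" for k
    using Until.prems by (simp add: displace_def)
  have \<phi>: "?R (Ev \<phi> T, ?w k) ?p (Rt (sat y (?w k) \<phi>) T, ?w k)" for k T
    using Until.IH(1)[OF _ zero] Until.prems by simp
  have \<psi>: "?R (Ev \<psi> T, ?w k) ?q (Rt (sat y (?w k) \<psi>) T, ?w k)" for k T
    using Until.IH(2)[OF _ zero] Until.prems by simp
  let ?from = "\<lambda>k. \<exists>l\<le>?n. k \<le> l \<and> sat y (?w l) \<psi> \<and> (\<forall>j. k \<le> j \<longrightarrow> j < l \<longrightarrow> sat y (?w j) \<phi>)"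
  let ?G = "FGoal \<delta> c \<phi> \<psi> # S" and ?I = "FInv \<delta> c \<phi> \<psi> # S"
  have rewind: "?R (Back b \<delta> c S, displace \<delta> (int k - 1) v) (?n + 1) (Rt b S, v)" if "k \<le> ?n" for b k
    by (rule reaches_mono[OF back_reaches[where v = v and \<delta> = \<delta>]]) (use y c that in auto)
  have c_blank: "cell y (?w k c) = 0 \<longleftrightarrow> \<not> k < ?n" for k
    using c by (simp add: cell_eq_0_iff[OF y]) (simp add: displace_def)
  have goal_true: "?R (Ev \<psi> ?G, ?w k) (?q + Suc (?n + 1)) (Rt True S, v)"
    if "k \<le> ?n" "sat y (?w k) \<psi>" for k
  proof -
    have "ev_next K y (Rt True ?G, ?w k) = (Back True \<delta> c S, displace \<delta> (int k - 1) v)"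
      by (simp add: ev_next_def displace_opposite displace_shift)
    with rewind[OF that(1)] have "?R (Rt True ?G, ?w k) (Suc (?n + 1)) (Rt True S, v)"
      by (intro reaches_step) simp
    moreover have "?R (Ev \<psi> ?G, ?w k) ?q (Rt True ?G, ?w k)"
      using \<psi>[of ?G k] that(2) by simp
    ultimately show ?thesis by (rule reaches_trans[rotated])
  qed
  have to_inv: "?R (Ev \<psi> ?G, ?w k) (?q + Suc ?p) (Rt (sat y (?w k) \<phi>) ?I, ?w k)"
    if "\<not> sat y (?w k) \<psi>" for k
  proof -
    have "ev_next K y (Rt False ?G, ?w k) = (Ev \<phi> ?I, ?w k)"
      by (simp add: ev_next_def)
    with \<phi>[of ?I k] have "?R (Rt False ?G, ?w k) (Suc ?p) (Rt (sat y (?w k) \<phi>) ?I, ?w k)"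
      by (intro reaches_step) simp
    moreover have "?R (Ev \<psi> ?G, ?w k) ?q (Rt False ?G, ?w k)"
      using \<psi>[of ?G k] that by simp
    ultimately show ?thesis by (rule reaches_trans[rotated])
  qed
  have inv_true: "?R (Ev \<psi> ?G, ?w k) (?q + Suc ?p + 1) (Ev \<psi> ?G, ?w (Suc k))"
    if "k < ?n" "\<not> sat y (?w k) \<psi>" "sat y (?w k) \<phi>" for k
  proof -
    have "ev_next K y (Rt True ?I, ?w k) = (Ev \<psi> ?G, ?w (Suc k))"
      using c c_blank[of k] that(1) by (simp add: ev_next_def displace_shift)
    then have "?R (Rt True ?I, ?w k) 1 (Ev \<psi> ?G, ?w (Suc k))"
      using reaches_one[of "ev_next K y" "(Rt True ?I, ?w k)"] by simp
    moreover have "?R (Ev \<psi> ?G, ?w k) (?q + Suc ?p) (Rt True ?I, ?w k)"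
      using to_inv[OF that(2)] that(3) by simp
    ultimately show ?thesis by (rule reaches_trans[rotated])
  qed
  have inv_false: "?R (Ev \<psi> ?G, ?w k) (?q + Suc ?p + Suc (?n + 1)) (Rt False S, v)"
    if "k \<le> ?n" "\<not> sat y (?w k) \<psi>" "\<not> sat y (?w k) \<phi> \<or> \<not> k < ?n" for k
  proof -
    have "ev_next K y (Rt (sat y (?w k) \<phi>) ?I, ?w k) =
        (Back False \<delta> c S, displace \<delta> (int k - 1) v)"
      using c c_blank[of k] that(3) by (auto simp: ev_next_def displace_shift displace_opposite)
    with rewind[OF that(1)]
    have "?R (Rt (sat y (?w k) \<phi>) ?I, ?w k) (Suc (?n + 1)) (Rt False S, v)"
      by (intro reaches_step) simp
    with to_inv[OF that(2)] show ?thesis by (rule reaches_trans)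
  qed
  have loop: "?R (Ev \<psi> ?G, ?w k) ((d + 1) * (?p + ?q + 2) + ?n + 3) (Rt (?from k) S, v)"
    if "k + d = ?n" for k d
    using that
  proof (induction d arbitrary: k)
    case (0 k)
    then have k: "k \<le> ?n" "\<not> k < ?n" by auto
    show ?case
    proof (cases "sat y (?w k) \<psi>")
      case True
      then have "?from k" using k by (intro exI[of _ k]) auto
      then have eq: "?from k = True" by blast
      show ?thesis unfolding eq by (rule reaches_mono[OF goal_true[OF k(1) True]]) simp
    next
      case False
      then have eq: "?from k = False" using k by (metis le_antisym not_le_imp_less)
      show ?thesis unfolding eq
        by (rule reaches_mono[OF inv_false[OF k(1) False]]) (use k(2) in simp_all)
    qed
  next
    case (Suc d)
    then have k: "k < ?n" "k \<le> ?n" "Suc k + d = ?n" by auto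
    show ?case
    proof (cases "sat y (?w k) \<psi>")
      case True
      then have "?from k" using k by (intro exI[of _ k]) auto
      then have eq: "?from k = True" by blast
      show ?thesis unfolding eq by (rule reaches_mono[OF goal_true[OF k(2) True]]) simp
    next
      case not_\<psi>: False
      show ?thesis
      proof (cases "sat y (?w k) \<phi>")
        case True
        have "?from k = ?from (Suc k)"
          using True not_\<psi> by (metis Suc_leD Suc_leI le_neq_implies_less order_refl)
        then show ?thesis
          using reaches_mono[OF reaches_trans[OF inv_true[OF k(1) not_\<psi> True] Suc.IH[OF k(3)]]]
          by (simp add: algebra_simps)
      next
        case False
        then have eq: "?from k = False" using not_\<psi> by (metis le_neq_implies_less order_refl)
        show ?thesis unfolding eq
          by (rule reaches_mono[OF inv_false[OF k(2) not_\<psi>]]) (use False in simp_all)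
      qed
    qed
  qed
  have "ev_next K y (Ev (Until \<delta> c \<phi> \<psi>) S, v) = (Ev \<psi> ?G, ?w 0)"
    by (simp add: ev_next_def)
  then have "?R (Ev (Until \<delta> c \<phi> \<psi>) S, v) (Suc ((?n + 1) * (?p + ?q + 2) + ?n + 3)) (Rt (?from 0) S, v)"
    using loop[of 0 ?n] by (intro reaches_step) simp
  moreover have "?from 0 = sat y v (Until \<delta> c \<phi> \<psi>)" by auto
  ultimately have "?R (Ev (Until \<delta> c \<phi> \<psi>) S, v) (Suc ((?n + 1) * (?p + ?q + 2) + ?n + 3))
      (Rt (sat y v (Until \<delta> c \<phi> \<psi>)) S, v)" by simp
  then show ?case by (rule reaches_mono) (simp add: algebra_simps)
qed

section \<open>A polynomial-time Turing machine for a query\<close>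

text \<open>The input symbols 1 and 2 stand for the bits \<open>False\<close> and \<open>True\<close>.  A pair of bits becomes one
  token: 1 ends a letter, 2 separates the two sides, 3 and 4 are the digits 0 and 1.\<close>

fun token :: "nat \<Rightarrow> nat \<Rightarrow> nat" where
  "token a b = (if a = 1 then (if b = 1 then 1 else 2) else (if b = 1 then 3 else 4))"

definition bit_symbol :: "bool \<Rightarrow> nat" where "bit_symbol b = (if b then 2 else 1)"

fun tokens :: "bool list \<Rightarrow> nat list" where
  "tokens (a # b # x) = token (bit_symbol a) (bit_symbol b) # tokens x"
| "tokens _ = []"

lemma tokens_append: "even (length u) \<Longrightarrow> tokens (u @ r) = tokens u @ tokens r"
  by (induction u rule: tokens.induct) auto

lemma length_tokens: "length (tokens x) = length x div 2"
  by (induction x rule: tokens.induct) auto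

text \<open>All states that occur from \<open>Ev \<phi> S\<close> until the value of \<open>\<phi>\<close> is returned to \<open>S\<close>.  The stack
  grows only with the depth of the query, so these are finitely many, and a finite control can
  hold the whole stack.\<close>

fun ctls :: "query \<Rightarrow> frame list \<Rightarrow> ctl set" where
  "ctls (Tok i a) S = {Ev (Tok i a) S, Rt True S, Rt False S}"
| "ctls (Neg \<phi>) S = {Ev (Neg \<phi>) S, Rt True S, Rt False S} \<union> ctls \<phi> (FNeg # S)"
| "ctls (And \<phi> \<psi>) S = {Ev (And \<phi> \<psi>) S, Rt True S, Rt False S} \<union>
     ctls \<phi> (FAnd \<psi> # S) \<union> ctls \<psi> S"
| "ctls (Shift \<delta> \<phi>) S = {Ev (Shift \<delta> \<phi>) S, Rt True S, Rt False S} \<union> ctls \<phi> (FShift \<delta> # S)"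
| "ctls (Until \<delta> c \<phi> \<psi>) S =
     {Ev (Until \<delta> c \<phi> \<psi>) S, Rt True S, Rt False S, Back True \<delta> c S, Back False \<delta> c S} \<union>
     ctls \<phi> (FInv \<delta> c \<phi> \<psi> # S) \<union> ctls \<psi> (FGoal \<delta> c \<phi> \<psi> # S)"

lemma finite_ctls: "finite (ctls \<phi> S)"
  by (induction \<phi> arbitrary: S) auto

lemma Ev_in_ctls: "Ev \<phi> S \<in> ctls \<phi> S"
  by (cases \<phi>) auto

lemma Rt_in_ctls: "Rt b S \<in> ctls \<phi> S"
  by (cases \<phi>; cases b) auto

lemma ctls_closed:
  "q \<in> ctls \<phi> S \<Longrightarrow> \<forall>b. q \<noteq> Rt b S \<Longrightarrow> fst (ev_step q s) \<in> ctls \<phi> S"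
proof (induction \<phi> arbitrary: S)
  case (Tok i a)
  then show ?case by auto
next
  case (Neg \<phi>)
  show ?case
  proof (cases "\<exists>b. q = Rt b (FNeg # S)")
    case True
    then show ?thesis by (auto simp: Rt_in_ctls)
  next
    case False
    then show ?thesis using Neg Ev_in_ctls by auto
  qed
next
  case (And \<phi> \<psi>)
  show ?case
  proof (cases "\<exists>b. q = Rt b (FAnd \<psi> # S)")
    case True
    then show ?thesis using Ev_in_ctls by auto
  next
    case False
    then show ?thesis using And Ev_in_ctls by auto
  qed
next
  case (Shift \<delta> \<phi>)
  show ?case
  proof (cases "\<exists>b. q = Rt b (FShift \<delta> # S)")
    case True
    then show ?thesis by (auto simp: Rt_in_ctls)
  next
    case False
    then show ?thesis using Shift Ev_in_ctls by auto
  qed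
next
  case (Until \<delta> c \<phi> \<psi>)
  show ?case
  proof (cases "\<exists>b. q = Rt b (FInv \<delta> c \<phi> \<psi> # S) \<or> q = Rt b (FGoal \<delta> c \<phi> \<psi> # S)")
    case True
    then show ?thesis using Ev_in_ctls by auto
  next
    case False
    then show ?thesis using Until Ev_in_ctls by auto
  qed
qed

definition keep :: "nat \<Rightarrow> nat list \<Rightarrow> (nat \<Rightarrow> move) \<Rightarrow> (nat \<times> move) list" where
  "keep K xs \<delta> = (xs ! 0, Stay) # map (\<lambda>i. (xs ! i, \<delta> i)) [1..<Suc K]"

text \<open>The machine writes the tokens of its input between two separators on the tapes
  \<open>1, \<dots>, K\<close>, rewinds these tapes and evaluates the query.  \<open>Copy1\<close> remembers the first bit of a
  pair, so an input of odd length is detected and rejected.  Tape 0 holds the input and is idle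
  afterwards.\<close>

fun ctl_step :: "nat \<Rightarrow> query \<Rightarrow> ctl \<Rightarrow> nat list \<Rightarrow> ctl \<times> (nat \<times> move) list" where
  "ctl_step K \<Phi> Init xs = (Copy, (xs ! 0, Stay) # replicate K (2, Go_Right))"
| "ctl_step K \<Phi> Copy xs =
     (if xs ! 0 = 0 then (Rewind, (xs ! 0, Stay) # replicate K (2, Go_Left))
      else (Copy1 (xs ! 0), (xs ! 0, Go_Right) # replicate K (0, Stay)))"
| "ctl_step K \<Phi> (Copy1 a) xs =
     (if xs ! 0 = 0 then (Rej, (xs ! 0, Stay) # replicate K (0, Stay))
      else (Copy, (xs ! 0, Go_Right) # replicate K (token a (xs ! 0), Go_Right)))"
| "ctl_step K \<Phi> Rewind xs =
     (if xs ! 1 = 0 then (Ev \<Phi> [], keep K xs (\<lambda>_. Go_Right))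
      else (Rewind, keep K xs (\<lambda>_. Go_Left)))"
| "ctl_step K \<Phi> (Rt b []) xs = (if b then Acc else Rej, keep K xs still)"
| "ctl_step K \<Phi> q xs =
     (let (q', \<delta>) = ev_step q (\<lambda>i. if 1 \<le> i \<and> i \<le> K then xs ! i else 0) in (q', keep K xs \<delta>))"

definition all_ctls :: "query \<Rightarrow> ctl set" where
  "all_ctls \<Phi> = {Init, Copy, Rewind, Acc, Rej} \<union> Copy1 ` {0..4} \<union> ctls \<Phi> []"

lemma ctls_no_phase: "q \<in> ctls \<phi> S \<Longrightarrow>
    (\<exists>\<psi> T. q = Ev \<psi> T) \<or> (\<exists>b T. q = Rt b T) \<or> (\<exists>b \<delta> c T. q = Back b \<delta> c T)"
  by (induction \<phi> arbitrary: S) auto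

lemma ctl_step_ctls:
  assumes "q \<in> ctls \<Phi> []" "\<forall>b. q \<noteq> Rt b []"
  shows "ctl_step K \<Phi> q xs = (let (q', \<delta>) = ev_step q (\<lambda>i. if 1 \<le> i \<and> i \<le> K then xs ! i else 0)
    in (q', keep K xs \<delta>))"
proof -
  consider \<psi> T where "q = Ev \<psi> T" | b f T where "q = Rt b (f # T)" | b \<delta> c T where "q = Back b \<delta> c T"
    using ctls_no_phase[OF assms(1)] assms(2) by (metis list.exhaust)
  then show ?thesis by cases simp_all
qed

lemma keep_length: "length (keep K xs \<delta>) = Suc K"
  by (simp add: keep_def)

lemma keep_symbols:
  assumes "length xs = Suc K" "set xs \<subseteq> A"
  shows "fst ` set (keep K xs \<delta>) \<subseteq> A"
proof -
  have "xs ! i \<in> A" if "i < Suc K" for i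
    using that assms(1) subsetD[OF assms(2) nth_mem[of i xs]] by simp
  then show ?thesis by (auto simp: keep_def simp del: upt_Suc)
qed

lemma ctl_step_closed:
  assumes q: "q \<in> all_ctls \<Phi>" "q \<noteq> Acc" "q \<noteq> Rej"
    and xs: "length xs = Suc K" "set xs \<subseteq> {0..4}"
  shows "fst (ctl_step K \<Phi> q xs) \<in> all_ctls \<Phi> \<and> length (snd (ctl_step K \<Phi> q xs)) = Suc K \<and>
    fst ` set (snd (ctl_step K \<Phi> q xs)) \<subseteq> {0..4}"
proof -
  have "xs ! 0 \<in> set xs" using xs(1) by simp
  with xs(2) have x0: "xs ! 0 \<in> {0..4}" by (rule subsetD)
  note [simp] = keep_length
  note k = keep_symbols[OF xs]
  from q consider "q = Init" | "q = Copy" | a where "q = Copy1 a" | "q = Rewind"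
    | b where "q = Rt b []" | "q \<in> ctls \<Phi> []" "\<forall>b. q \<noteq> Rt b []"
    by (auto simp: all_ctls_def)
  then show ?thesis
  proof cases
    case 6
    have "fst (ctl_step K \<Phi> q xs) \<in> ctls \<Phi> []"
      unfolding ctl_step_ctls[OF 6] using ctls_closed[OF 6] by (simp add: case_prod_beta)
    then show ?thesis using k
      unfolding ctl_step_ctls[OF 6] by (simp add: case_prod_beta all_ctls_def)
  qed (use x0 k Ev_in_ctls in \<open>auto simp: all_ctls_def\<close>)
qed

text \<open>States of a Turing machine are numbers; \<open>enc\<close> is any numbering of the finitely many control
  states.\<close>

locale query_machine =
  fixes K :: nat and \<Phi> :: query and enc :: "ctl \<Rightarrow> nat"
  assumes K: "1 \<le> K" and wf: "wf_query K {1..K} \<Phi>" and enc: "inj_on enc (all_ctls \<Phi>)"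
begin

definition machine :: tm where
  "machine = \<lparr>tape_count = Suc K, states = enc ` all_ctls \<Phi>, symbols = {0..4},
     start = enc Init, acc = enc Acc, rej = enc Rej,
     delta = (\<lambda>n xs. let (q, as) = ctl_step K \<Phi> (inv_into (all_ctls \<Phi>) enc n) xs in (enc q, as))\<rparr>"

lemma enc_eq: "p \<in> all_ctls \<Phi> \<Longrightarrow> q \<in> all_ctls \<Phi> \<Longrightarrow> enc p = enc q \<longleftrightarrow> p = q"
  using enc by (meson inj_on_eq_iff)

lemma basic_ctls: "Init \<in> all_ctls \<Phi>" "Copy \<in> all_ctls \<Phi>" "Rewind \<in> all_ctls \<Phi>"
  "Acc \<in> all_ctls \<Phi>" "Rej \<in> all_ctls \<Phi>" "a \<le> 4 \<Longrightarrow> Copy1 a \<in> all_ctls \<Phi>"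
  "q \<in> ctls \<Phi> [] \<Longrightarrow> q \<in> all_ctls \<Phi>"
  by (auto simp: all_ctls_def)

lemma well_formed: "well_formed_tm machine"
proof -
  have "finite (all_ctls \<Phi>)" by (simp add: all_ctls_def finite_ctls)
  moreover have "fst (delta machine n xs) \<in> enc ` all_ctls \<Phi> \<and> length (snd (delta machine n xs)) = Suc K \<and>
      fst ` set (snd (delta machine n xs)) \<subseteq> {0..4}"
    if n: "n \<in> enc ` all_ctls \<Phi>" "n \<noteq> enc Acc" "n \<noteq> enc Rej"
      and xs: "length xs = Suc K" "set xs \<subseteq> {0..4}" for n xs
  proof -
    obtain q where q: "n = enc q" "q \<in> all_ctls \<Phi>" using n by blast
    then have "q \<noteq> Acc" "q \<noteq> Rej" using n by auto
    from ctl_step_closed[OF q(2) this xs] show ?thesis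
      using inv_into_f_f[OF enc q(2)] by (simp add: machine_def q(1) case_prod_beta)
  qed
  ultimately show ?thesis
    unfolding well_formed_tm_def using K basic_ctls enc_eq[of Acc Rej]
    by (auto simp: machine_def)
qed

lemma tm_step_ctl:
  assumes "q \<in> all_ctls \<Phi>" "q \<noteq> Acc" "q \<noteq> Rej"
  shows "tm_step machine (enc q, ts) =
    (let (q', as) = ctl_step K \<Phi> q (map read_tape ts) in (enc q', map2 act as ts))"
  using assms inv_into_f_f[OF enc assms(1)] enc_eq[OF assms(1)] basic_ctls
  by (simp add: tm_step_def machine_def case_prod_beta)

definition conf :: "tape \<Rightarrow> nat list \<Rightarrow> ctl \<times> (nat \<Rightarrow> int) \<Rightarrow> config" where
  "conf t y = (\<lambda>(q, v). (enc q, t # map (\<lambda>i. (cell y, v i)) [1..<Suc K]))"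

lemma act_keep:
  "map2 act (keep K (map read_tape (t # map (\<lambda>i. (cell y, v i)) [1..<Suc K])) \<delta>)
     (t # map (\<lambda>i. (cell y, v i)) [1..<Suc K]) =
   t # map (\<lambda>i. (cell y, displace \<delta> 1 v i)) [1..<Suc K]"
proof -
  have "map2 act (map (\<lambda>i. (cell y (v i), \<delta> i)) [1..<Suc K])
      (map (\<lambda>i. (cell y, v i)) [1..<Suc K]) =
    map (\<lambda>i. (cell y, displace \<delta> 1 v i)) [1..<Suc K]"
    by (simp add: map2_map_map displace_def fun_upd_idem del: upt_Suc)
  moreover have kept: "map (\<lambda>i. (map read_tape (t # map (\<lambda>i. (cell y, v i)) [1..<Suc K]) ! i, \<delta> i)) [1..<Suc K] =
      map (\<lambda>i. (cell y (v i), \<delta> i)) [1..<Suc K]"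
    by (rule map_cong[OF refl]) (auto simp: nth_Cons' simp del: upt_Suc)
  moreover have "act (read_tape t, Stay) t = t" by (cases t) simp
  ultimately show ?thesis
    unfolding keep_def kept
    by (simp only: list.map nth_Cons_0 zip_Cons_Cons prod.case)
qed

lemma conf_step_keep:
  assumes "q \<in> all_ctls \<Phi>" "q \<noteq> Acc" "q \<noteq> Rej"
    and "ctl_step K \<Phi> q (map read_tape (t # map (\<lambda>i. (cell y, v i)) [1..<Suc K])) =
      (q', keep K (map read_tape (t # map (\<lambda>i. (cell y, v i)) [1..<Suc K])) \<delta>)"
  shows "tm_step machine (conf t y (q, v)) = conf t y (q', displace \<delta> 1 v)"
  unfolding conf_def split_conv tm_step_ctl[OF assms(1-3)] assms(4) Let_def act_keep ..

lemma conf_step: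
  assumes "q \<in> ctls \<Phi> []" "\<forall>b. q \<noteq> Rt b []"
  shows "tm_step machine (conf t y (q, v)) = conf t y (ev_next K y (q, v))"
proof -
  let ?xs = "map read_tape (t # map (\<lambda>i. (cell y, v i)) [1..<Suc K])"
  have "(\<lambda>i. if 1 \<le> i \<and> i \<le> K then ?xs ! i else 0) =
      (\<lambda>i. if 1 \<le> i \<and> i \<le> K then cell y (v i) else 0)"
    by (rule ext) (auto simp: nth_Cons' simp del: upt_Suc)
  moreover obtain q' \<delta> where
    "ev_step q (\<lambda>i. if 1 \<le> i \<and> i \<le> K then cell y (v i) else 0) = (q', \<delta>)"
    by (cases "ev_step q (\<lambda>i. if 1 \<le> i \<and> i \<le> K then cell y (v i) else 0)")
  ultimately have "ctl_step K \<Phi> q ?xs = (q', keep K ?xs \<delta>)"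
    and "ev_next K y (q, v) = (q', displace \<delta> 1 v)"
    unfolding ctl_step_ctls[OF assms] by (simp_all add: ev_next_def del: upt_Suc)
  moreover have "q \<noteq> Acc" "q \<noteq> Rej" using ctls_no_phase[OF assms(1)] by auto
  ultimately show ?thesis using conf_step_keep basic_ctls(7)[OF assms(1)] by metis
qed

lemma conf_reaches:
  assumes "reaches (ev_next K y) (q, v) n (Rt b [], v')" "q \<in> ctls \<Phi> []"
  shows "reaches (tm_step machine) (conf t y (q, v)) n (conf t y (Rt b [], v'))"
proof -
  have "\<exists>u\<le>k. (tm_step machine ^^ u) (conf t y (q, v)) = conf t y (Rt b [], v')"
    if "(ev_next K y ^^ k) (q, v) = (Rt b [], v')" for k
    using that assms(2)
  proof (induction k arbitrary: q v)
    case 0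
    then show ?case by simp
  next
    case (Suc k)
    show ?case
    proof (cases "\<exists>c. q = Rt c []")
      case True
      then have "ev_next K y (q, v) = (q, v)" by (auto simp: ev_next_def)
      with Suc have "\<exists>u\<le>k. (tm_step machine ^^ u) (conf t y (q, v)) = conf t y (Rt b [], v')"
        by (simp add: funpow_swap1)
      then show ?thesis using le_SucI by blast
    next
      case False
      obtain q' v2 where n: "ev_next K y (q, v) = (q', v2)" by (cases "ev_next K y (q, v)")
      then have "q' \<in> ctls \<Phi> []"
        using ctls_closed[OF Suc.prems(2)] False
        unfolding ev_next_def by (auto simp: case_prod_beta)
      moreover have "(ev_next K y ^^ k) (q', v2) = (Rt b [], v')"
        using Suc.prems(1) n by (simp add: funpow_swap1)
      ultimately obtain u where u: "u \<le> k" "(tm_step machine ^^ u) (conf t y (q', v2)) = conf t y (Rt b [], v')"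
        using Suc.IH by blast
      then have "(tm_step machine ^^ Suc u) (conf t y (q, v)) = conf t y (Rt b [], v')"
        using conf_step[OF Suc.prems(2), of t y v] False n by (simp add: funpow_swap1)
      with u(1) show ?thesis by (intro exI[of _ "Suc u"]) simp
    qed
  qed
  with assms(1) show ?thesis unfolding reaches_def using le_trans by blast
qed

end

lemma cell_snoc: "(cell ys)(int (length ys) := a) = cell (ys @ [a])"
  by (rule ext) (auto simp: cell_def nth_append nat_less_iff)

lemma map2_act_replicate:
  "map2 act (a # replicate K b) (t # replicate K s) = act a t # replicate K (act b s)"
  by (simp add: zip_replicate)

lemma cell_end: "cell ys (int (length ys)) = 0"
  by (simp add: cell_def)

lemma tokens_nonzero: "0 \<notin> set (tokens x)"
  by (induction x rule: tokens.induct) auto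

context query_machine
begin

lemma map_conf_const: "map (\<lambda>i. (cell y, h)) [1..<Suc K] = replicate K (cell y, h)"
  by (simp add: map_replicate_const del: upt_Suc)

lemma rewind_reaches:
  assumes "0 \<notin> set y" "k \<le> length y"
  shows "reaches (tm_step machine) (conf t y (Rewind, \<lambda>_. int k - 1)) (k + 1) (conf t y (Ev \<Phi> [], \<lambda>_. 0))"
  using assms(2)
proof (induction k)
  case 0
  have "tm_step machine (conf t y (Rewind, \<lambda>_. - 1)) = conf t y (Ev \<Phi> [], displace (\<lambda>_. Go_Right) 1 (\<lambda>_. - 1))"
    by (rule conf_step_keep)
      (use K basic_ctls in \<open>simp_all add: cell_eq_0_iff[OF assms(1)] nth_Cons' del: upt_Suc\<close>)
  also have "displace (\<lambda>_. Go_Right) 1 (\<lambda>_. - 1) = (\<lambda>_. 0)" by (simp add: displace_def)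
  finally show ?case using reaches_one[of "tm_step machine" "conf t y (Rewind, \<lambda>_. - 1)"] by simp
next
  case (Suc k)
  have "tm_step machine (conf t y (Rewind, \<lambda>_. int k)) = conf t y (Rewind, displace (\<lambda>_. Go_Left) 1 (\<lambda>_. int k))"
    by (rule conf_step_keep)
      (use K Suc.prems basic_ctls in \<open>simp_all add: cell_eq_0_iff[OF assms(1)] nth_Cons' del: upt_Suc\<close>)
  also have "displace (\<lambda>_. Go_Left) 1 (\<lambda>_. int k) = (\<lambda>_. int k - 1)" by (simp add: displace_def)
  finally show ?case using Suc reaches_step[of "tm_step machine" "conf t y (Rewind, \<lambda>_. int k)" "k + 1"] by simp
qed

text \<open>The configurations of the copying phase, in which the tapes \<open>1, \<dots>, K\<close> are all equal.\<close>

definition copied :: "bool list \<Rightarrow> ctl \<Rightarrow> int \<Rightarrow> nat list \<Rightarrow> int \<Rightarrow> config" where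
  "copied x q h ys h' = (enc q, (fst (input_tape x), h) # replicate K (cell ys, h'))"

lemma copied_step:
  assumes "q \<in> all_ctls \<Phi>" "q \<noteq> Acc" "q \<noteq> Rej"
    and "ctl_step K \<Phi> q (fst (input_tape x) h # replicate K (cell ys h')) =
      (q', (fst (input_tape x) h, m) # replicate K (a, m'))"
  shows "tm_step machine (copied x q h ys h') =
    (enc q', (fst (input_tape x), h + offset m) # replicate K ((cell ys)(h' := a), h' + offset m'))"
  using assms(4) unfolding copied_def tm_step_ctl[OF assms(1-3)]
  by (simp add: map2_act_replicate)

lemma input_tape_nth: "fst (input_tape (u @ b # r)) (int (length u)) = bit_symbol b"
  by (simp add: input_tape_def bit_symbol_def nth_append)

lemma input_tape_end: "fst (input_tape x) (int (length x)) = 0"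
  by (simp add: input_tape_def)

lemma copy_reaches:
  assumes "x = u @ r" "even (length u)"
  shows "\<exists>ts. reaches (tm_step machine)
     (copied x Copy (int (length u)) (2 # tokens u) (int (length (tokens u)) + 1)) (length r + 1)
     (if even (length x)
      then copied x Rewind (int (length x)) (2 # tokens x @ [2]) (int (length (tokens x)))
      else (enc Rej, ts))"
  using assms
proof (induction r arbitrary: u rule: tokens.induct)
  case (1 a b r)
  let ?c = "copied x Copy (int (length u)) (2 # tokens u) (int (length (tokens u)) + 1)"
  have x: "x = (u @ [a, b]) @ r" "x = (u @ [a]) @ b # r" "x = u @ a # b # r" using "1.prems" by auto
  have a: "fst (input_tape x) (int (length u)) = bit_symbol a"
    unfolding x(3) by (rule input_tape_nth)
  have b: "fst (input_tape x) (int (length u) + 1) = bit_symbol b"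
    using input_tape_nth[of "u @ [a]" b r] unfolding x(2) by (simp add: add.commute)
  have bits: "bit_symbol a \<noteq> 0" "bit_symbol b \<noteq> 0" "bit_symbol a \<le> 4" by (auto simp: bit_symbol_def)
  have pos: "int (length (tokens u)) + 1 = int (length (2 # tokens u))" by simp
  have c0: "cell (2 # tokens u) (int (length (tokens u)) + 1) = 0"
    unfolding pos by (rule cell_end)
  have 1: "tm_step machine ?c = copied x (Copy1 (bit_symbol a)) (int (length u) + 1) (2 # tokens u)
      (int (length (tokens u)) + 1)"
    using copied_step[of Copy x "int (length u)" "2 # tokens u" "int (length (tokens u)) + 1"
        "Copy1 (bit_symbol a)" Go_Right 0 Stay] basic_ctls bits c0
    by (simp add: a copied_def fun_upd_idem)
  have 2: "tm_step machine (copied x (Copy1 (bit_symbol a)) (int (length u) + 1) (2 # tokens u)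
      (int (length (tokens u)) + 1)) =
    copied x Copy (int (length (u @ [a, b]))) (2 # tokens (u @ [a, b]))
      (int (length (tokens (u @ [a, b]))) + 1)"
  proof -
    have "tm_step machine (copied x (Copy1 (bit_symbol a)) (int (length u) + 1) (2 # tokens u)
        (int (length (tokens u)) + 1)) =
      (enc Copy, (fst (input_tape x), int (length u) + 1 + offset Go_Right) #
         replicate K ((cell (2 # tokens u))(int (length (tokens u)) + 1 := token (bit_symbol a) (bit_symbol b)),
           int (length (tokens u)) + 1 + offset Go_Right))"
      by (rule copied_step) (use basic_ctls bits in \<open>simp_all add: b del: token.simps\<close>)
    also have "\<dots> = copied x Copy (int (length (u @ [a, b]))) (2 # tokens (u @ [a, b]))
      (int (length (tokens (u @ [a, b]))) + 1)"
      unfolding pos cell_snoc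
      by (simp add: copied_def tokens_append[OF "1.prems"(2)] add.commute del: token.simps)
    finally show ?thesis .
  qed
  obtain ts where "reaches (tm_step machine)
     (copied x Copy (int (length (u @ [a, b]))) (2 # tokens (u @ [a, b]))
       (int (length (tokens (u @ [a, b]))) + 1)) (length r + 1)
     (if even (length x)
      then copied x Rewind (int (length x)) (2 # tokens x @ [2]) (int (length (tokens x)))
      else (enc Rej, ts))"
    using "1.IH"[OF x(1)] "1.prems"(2) by auto
  then have "reaches (tm_step machine) ?c (Suc (Suc (length r + 1)))
     (if even (length x)
      then copied x Rewind (int (length x)) (2 # tokens x @ [2]) (int (length (tokens x)))
      else (enc Rej, ts))"
    by (intro reaches_step) (simp only: 1 2)
  then show ?case by (intro exI[of _ ts]) simp
next
  case "2_1"
  then have x: "x = u" "even (length x)" by simp_all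
  have "tm_step machine (copied x Copy (int (length u)) (2 # tokens u) (int (length (tokens u)) + 1)) =
      copied x Rewind (int (length x)) (2 # tokens x @ [2]) (int (length (tokens x)))"
    using copied_step[of Copy x "int (length u)" "2 # tokens u" "int (length (tokens u)) + 1"
        Rewind Stay 2 Go_Left] basic_ctls cell_snoc[of "2 # tokens u" 2]
    by (simp add: copied_def x(1) input_tape_end add.commute)
  with reaches_one[of "tm_step machine"
      "copied x Copy (int (length u)) (2 # tokens u) (int (length (tokens u)) + 1)"]
  show ?case using x by simp
next
  case ("2_2" a)
  let ?c = "copied x Copy (int (length u)) (2 # tokens u) (int (length (tokens u)) + 1)"
  have x: "x = u @ [a]" "odd (length x)" using "2_2" by simp_all
  have a: "fst (input_tape x) (int (length u)) = bit_symbol a"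
    unfolding x(1) by (rule input_tape_nth)
  have b: "fst (input_tape x) (int (length u) + 1) = 0"
    using input_tape_end[of x] by (simp add: x(1) add.commute)
  have bits: "bit_symbol a \<noteq> 0" "bit_symbol a \<le> 4" by (auto simp: bit_symbol_def)
  have pos: "int (length (tokens u)) + 1 = int (length (2 # tokens u))" by simp
  have c0: "cell (2 # tokens u) (int (length (tokens u)) + 1) = 0"
    unfolding pos by (rule cell_end)
  have 1: "tm_step machine ?c = copied x (Copy1 (bit_symbol a)) (int (length u) + 1) (2 # tokens u)
      (int (length (tokens u)) + 1)"
    using copied_step[of Copy x "int (length u)" "2 # tokens u" "int (length (tokens u)) + 1"
        "Copy1 (bit_symbol a)" Go_Right 0 Stay] basic_ctls bits c0
    by (simp add: a copied_def fun_upd_idem)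
  obtain ts where 2: "tm_step machine (copied x (Copy1 (bit_symbol a)) (int (length u) + 1) (2 # tokens u)
      (int (length (tokens u)) + 1)) = (enc Rej, ts)"
    using copied_step[of "Copy1 (bit_symbol a)" x "int (length u) + 1" "2 # tokens u" "int (length (tokens u)) + 1"
        Rej Stay 0 Stay] basic_ctls bits by (simp add: b)
  have "reaches (tm_step machine) ?c (Suc 1) (enc Rej, ts)"
    by (rule reaches_step) (metis 1 2 reaches_one)
  then show ?case using x by auto
qed

lemma decides:
  "decides_in_time machine {x. even (length x) \<and> sat (2 # tokens x @ [2]) (\<lambda>_. 0) \<Phi>}
     (poly ([:5, 2:] + pcompose (time_poly \<Phi>) [:2, 1:]))"
  unfolding decides_in_time_def
proof
  fix x
  let ?y = "2 # tokens x @ [2]" and ?n = "length x"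
  let ?t = "poly ([:5, 2:] + pcompose (time_poly \<Phi>) [:2, 1:]) ?n"
  let ?ans = "if even ?n \<and> sat ?y (\<lambda>_. 0) \<Phi> then Acc else Rej"
  have y: "0 \<notin> set ?y" using tokens_nonzero by simp
  have len: "length ?y \<le> ?n + 2" by (simp add: length_tokens)
  have "cell [] = (\<lambda>_. 0)" by (rule ext) (simp add: cell_def)
  then have init: "initial_config machine x = copied x Init 0 [] 0"
    by (simp add: initial_config_def copied_def machine_def input_tape_def)
  have "tm_step machine (copied x Init 0 [] 0) = copied x Copy (int (length [])) (2 # tokens []) (int (length (tokens [])) + 1)"
    using copied_step[of Init x 0 "[]" 0 Copy Stay 2 Go_Right] basic_ctls cell_snoc[of "[]" 2]
    by (simp add: copied_def)
  then have start: "tm_step machine (initial_config machine x) =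
      copied x Copy (int (length [])) (2 # tokens []) (int (length (tokens [])) + 1)"
    unfolding init .
  obtain ts where "reaches (tm_step machine)
     (copied x Copy (int (length [])) (2 # tokens []) (int (length (tokens [])) + 1)) (?n + 1)
     (if even ?n then copied x Rewind (int ?n) ?y (int (length (tokens x))) else (enc Rej, ts))"
    using copy_reaches[of x "[]" x] by auto
  then have copy: "reaches (tm_step machine) (initial_config machine x) (Suc (?n + 1))
     (if even ?n then copied x Rewind (int ?n) ?y (int (length (tokens x))) else (enc Rej, ts))"
    unfolding start[symmetric] by (rule reaches_step)
  have "\<exists>ts. reaches (tm_step machine) (initial_config machine x) ?t (enc ?ans, ts)"
  proof (cases "even ?n")
    case False
    with copy have "reaches (tm_step machine) (initial_config machine x) (Suc (?n + 1)) (enc ?ans, ts)" by simp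
    then have "reaches (tm_step machine) (initial_config machine x) ?t (enc ?ans, ts)"
      by (rule reaches_mono) simp
    then show ?thesis ..
  next
    case True
    let ?tp = "(fst (input_tape x), int ?n)" and ?b = "sat ?y (\<lambda>_. 0) \<Phi>"
    have "copied x Rewind (int ?n) ?y (int (length (tokens x))) =
        conf ?tp ?y (Rewind, \<lambda>_. int (length (tokens x) + 1) - 1)"
      unfolding copied_def conf_def split_conv map_conf_const by simp
    with copy True have 1: "reaches (tm_step machine) (initial_config machine x) (Suc (?n + 1))
        (conf ?tp ?y (Rewind, \<lambda>_. int (length (tokens x) + 1) - 1))" by simp
    have 2: "reaches (tm_step machine) (conf ?tp ?y (Rewind, \<lambda>_. int (length (tokens x) + 1) - 1))
        (length (tokens x) + 1 + 1) (conf ?tp ?y (Ev \<Phi> [], \<lambda>_. 0))"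
      by (rule rewind_reaches[OF y]) simp
    have 3: "reaches (tm_step machine) (conf ?tp ?y (Ev \<Phi> [], \<lambda>_. 0)) (poly (time_poly \<Phi>) (length ?y))
        (conf ?tp ?y (Rt ?b [], \<lambda>_. 0))"
      using conf_reaches[OF eval_reaches[OF y wf] Ev_in_ctls] by simp
    have "tm_step machine (conf ?tp ?y (Rt ?b [], \<lambda>_. 0)) =
        conf ?tp ?y (if ?b then Acc else Rej, displace still 1 (\<lambda>_. 0))"
      by (rule conf_step_keep) (use Rt_in_ctls basic_ctls in simp_all)
    then have 4: "reaches (tm_step machine) (conf ?tp ?y (Rt ?b [], \<lambda>_. 0)) 1 (conf ?tp ?y (?ans, \<lambda>_. 0))"
      using reaches_one[of "tm_step machine" "conf ?tp ?y (Rt ?b [], \<lambda>_. 0)"] True by simp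
    have "reaches (tm_step machine) (initial_config machine x)
       (Suc (?n + 1) + (length (tokens x) + 1 + 1) + poly (time_poly \<Phi>) (length ?y) + 1)
       (conf ?tp ?y (?ans, \<lambda>_. 0))"
      by (rule reaches_trans[OF reaches_trans[OF reaches_trans[OF 1 2] 3] 4])
    moreover have "poly (time_poly \<Phi>) (length ?y) \<le> poly (time_poly \<Phi>) (?n + 2)"
      using len by (rule poly_nat_mono)
    ultimately have "reaches (tm_step machine) (initial_config machine x) ?t (conf ?tp ?y (?ans, \<lambda>_. 0))"
      by (elim reaches_mono) (simp add: poly_pcompose length_tokens add.commute)
    then show ?thesis unfolding conf_def split_conv by blast
  qed
  then obtain ts u where u: "u \<le> ?t" "(tm_step machine ^^ u) (initial_config machine x) = (enc ?ans, ts)"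
    unfolding reaches_def by blast
  then have "state_after machine x u = enc ?ans" by (simp add: state_after_def)
  moreover have "enc ?ans \<in> {acc machine, rej machine}" by (simp add: machine_def)
  ultimately have "state_after machine x u \<in> {acc machine, rej machine}" and u': "state_after machine x u = enc ?ans"
    by simp_all
  from state_after_halted[OF this(1) u(1)] have "state_after machine x ?t = enc ?ans"
    unfolding u' .
  then show "state_after machine x ?t =
      (if x \<in> {x. even (length x) \<and> sat (2 # tokens x @ [2]) (\<lambda>_. 0) \<Phi>} then acc machine else rej machine)"
    by (simp add: machine_def)
qed

end

text \<open>The separators around the tokens serve as end markers.\<close>

theorem query_in_class_P:
  assumes "1 \<le> K" "wf_query K {1..K} \<Phi>"
  shows "{x. even (length x) \<and> sat (2 # tokens x @ [2]) (\<lambda>_. 0) \<Phi>} \<in> class_P"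
proof -
  have "finite (all_ctls \<Phi>)" by (simp add: all_ctls_def finite_ctls)
  then obtain enc :: "ctl \<Rightarrow> nat" where "inj_on enc (all_ctls \<Phi>)"
    using finite_imp_inj_to_nat_seg by blast
  with assms interpret query_machine K \<Phi> enc by unfold_locales
  show ?thesis using well_formed decides by (auto simp: class_P_def)
qed

section \<open>Identities as lists of tokens\<close>

text \<open>Passing from decompositions of a list to positions, which are what a query can quantify
  over.\<close>

lemma between_iff:
  "(\<exists>A M B. W = A @ x # M @ y # B \<and> set M = T) \<longleftrightarrow>
   (\<exists>p q. p < q \<and> q < length W \<and> W ! p = x \<and> W ! q = y \<and> (!) W ` {p<..<q} = T)"
proof
  assume "\<exists>A M B. W = A @ x # M @ y # B \<and> set M = T"
  then obtain A M B where W: "W = A @ x # M @ y # B" and T: "set M = T" by blast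
  let ?p = "length A" and ?q = "length A + 1 + length M"
  have "(!) W ` {?p<..<?q} = (!) M ` {..<length M}"
  proof -
    have "{?p<..<?q} = (\<lambda>i. length A + 1 + i) ` {..<length M}"
    proof
      show "{?p<..<?q} \<subseteq> (\<lambda>i. length A + 1 + i) ` {..<length M}"
      proof
        fix r assume "r \<in> {?p<..<?q}"
        then have "r = length A + 1 + (r - length A - 1)" "r - length A - 1 \<in> {..<length M}" by auto
        then show "r \<in> (\<lambda>i. length A + 1 + i) ` {..<length M}" by blast
      qed
    qed auto
    then have "(!) W ` {?p<..<?q} = (\<lambda>i. W ! (length A + 1 + i)) ` {..<length M}"
      by (simp only: image_image)
    also have "\<dots> = (!) M ` {..<length M}"
      by (rule image_cong) (simp_all add: W nth_append)
    finally show ?thesis .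
  qed
  also have "\<dots> = T" using T by (auto simp: set_conv_nth)
  finally have "(!) W ` {?p<..<?q} = T" .
  moreover have "W ! ?p = x" "W ! ?q = y" "?q < length W" by (simp_all add: W nth_append)
  ultimately show "\<exists>p q. p < q \<and> q < length W \<and> W ! p = x \<and> W ! q = y \<and> (!) W ` {p<..<q} = T"
    by (intro exI[of _ ?p] exI[of _ ?q]) auto
next
  assume "\<exists>p q. p < q \<and> q < length W \<and> W ! p = x \<and> W ! q = y \<and> (!) W ` {p<..<q} = T"
  then obtain p q where pq: "p < q" "q < length W" "W ! p = x" "W ! q = y" "(!) W ` {p<..<q} = T"
    by blast
  let ?M = "map ((!) W) [Suc p..<q]"
  have "[0..<length W] = [0..<p] @ [p..<length W]"
    using upt_add_eq_append[of 0 p "length W - p"] pq(1,2) by simp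
  also have "[p..<length W] = p # [Suc p..<length W]"
    using pq(1,2) by (intro upt_conv_Cons) simp
  also have "[Suc p..<length W] = [Suc p..<q] @ [q..<length W]"
    using upt_add_eq_append[of "Suc p" q "length W - q"] pq(1,2) by simp
  also have "[q..<length W] = q # [Suc q..<length W]"
    using pq(2) by (rule upt_conv_Cons)
  finally have upt: "[0..<length W] = [0..<p] @ p # [Suc p..<q] @ q # [Suc q..<length W]" .
  have "map ((!) W) ([0..<p] @ p # [Suc p..<q] @ q # [Suc q..<length W]) = W"
    unfolding upt[symmetric] by (rule map_nth)
  then have "W = map ((!) W) [0..<p] @ x # ?M @ y # map ((!) W) [Suc q..<length W]"
    unfolding map_append list.map pq(3,4) by (rule sym)
  moreover have "set ?M = T" using pq(5) by (auto simp: atLeastSucLessThan_greaterThanLessThan)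
  ultimately show "\<exists>A M B. W = A @ x # M @ y # B \<and> set M = T" by blast
qed

lemma covers_nth:
  "covers W W' \<longleftrightarrow> (\<forall>p q. p < q \<longrightarrow> q < length W \<longrightarrow> (\<exists>p' q'. p' < q' \<and> q' < length W' \<and>
     W' ! p' = W ! p \<and> W' ! q' = W ! q \<and> (!) W' ` {p'<..<q'} \<subseteq> (!) W ` {p<..<q}))"
proof (intro iffI allI impI)
  fix p q assume cov: "covers W W'" and pq: "p < q" "q < length W"
  have "\<exists>a b. a < b \<and> b < length W \<and> W ! a = W ! p \<and> W ! b = W ! q \<and>
      (!) W ` {a<..<b} = (!) W ` {p<..<q}"
    by (rule exI[of _ p], rule exI[of _ q]) (use pq in simp)
  from iffD2[OF between_iff this]
  obtain A M B where "W = A @ W ! p # M @ W ! q # B" and M: "set M = (!) W ` {p<..<q}"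
    by (elim exE conjE)
  from cov[unfolded covers_def, rule_format, OF this(1)]
  obtain A' M' B' where W': "W' = A' @ W ! p # M' @ W ! q # B'" and M': "set M' \<subseteq> set M"
    by (elim exE conjE)
  then have "\<exists>A M B. W' = A @ W ! p # M @ W ! q # B \<and> set M = set M'" by blast
  from iffD1[OF between_iff this]
  obtain p' q' where "p' < q'" "q' < length W'" "W' ! p' = W ! p" "W' ! q' = W ! q"
      "(!) W' ` {p'<..<q'} = set M'" by (elim exE conjE)
  moreover from this(5) M M' have "(!) W' ` {p'<..<q'} \<subseteq> (!) W ` {p<..<q}" by (simp only:)
  ultimately show "\<exists>p' q'. p' < q' \<and> q' < length W' \<and> W' ! p' = W ! p \<and> W' ! q' = W ! q \<and>
      (!) W' ` {p'<..<q'} \<subseteq> (!) W ` {p<..<q}"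
    by (intro exI conjI)
next
  assume nth: "\<forall>p q. p < q \<longrightarrow> q < length W \<longrightarrow> (\<exists>p' q'. p' < q' \<and> q' < length W' \<and>
     W' ! p' = W ! p \<and> W' ! q' = W ! q \<and> (!) W' ` {p'<..<q'} \<subseteq> (!) W ` {p<..<q})"
  show "covers W W'"
    unfolding covers_def
  proof (intro allI impI)
    fix A x M y B assume "W = A @ x # M @ y # B"
    then have "\<exists>p q. p < q \<and> q < length W \<and> W ! p = x \<and> W ! q = y \<and> (!) W ` {p<..<q} = set M"
      by (intro between_iff[THEN iffD1]) blast
    then obtain p q where pq: "p < q" "q < length W" "W ! p = x" "W ! q = y"
      "(!) W ` {p<..<q} = set M" by blast
    from nth[rule_format, OF pq(1,2), unfolded pq(3-5)]
    obtain p' q' where pq': "p' < q'" "q' < length W'" "W' ! p' = x" "W' ! q' = y"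
      "(!) W' ` {p'<..<q'} \<subseteq> set M" by (elim exE conjE)
    then have "\<exists>A' M' B'. W' = A' @ x # M' @ y # B' \<and> set M' = (!) W' ` {p'<..<q'}"
      by (intro between_iff[THEN iffD2]) blast
    with pq'(5) show "\<exists>A' M' B'. W' = A' @ x # M' @ y # B' \<and> set M' \<subseteq> set M"
      by (elim exE conjE, intro exI conjI) (assumption, simp)
  qed
qed

text \<open>\<open>None\<close> stands for a separator.\<close>

fun block :: "nat option \<Rightarrow> nat list" where
  "block None = [2]"
| "block (Some i) = map (\<lambda>b. if b then 4 else 3) (binary i) @ [1]"

abbreviation (input) digit :: "nat \<Rightarrow> bool" where "digit a \<equiv> a = 3 \<or> a = 4"
abbreviation (input) marker :: "nat \<Rightarrow> bool" where "marker a \<equiv> a = 1 \<or> a = 2"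

abbreviation spell :: "nat option list \<Rightarrow> nat list" where
  "spell L \<equiv> concat (map block L)"

text \<open>The position of the marker that ends the block number \<open>a\<close>.  An entry of the list is identified
  with this position, and its letter can be read off by going backwards (\<open>run_before\<close>).\<close>

definition pos :: "nat option list \<Rightarrow> nat \<Rightarrow> nat" where
  "pos L a = length (spell (take a L)) + (length (block (L ! a)) - 1)"

definition run_before :: "nat list \<Rightarrow> nat \<Rightarrow> nat list" where
  "run_before y k = takeWhile digit (rev (take k y))"

lemma block_neq_Nil: "block z \<noteq> []"
  by (cases z) auto

lemma block_split: "block z = butlast (block z) @ [case z of None \<Rightarrow> 2 | Some _ \<Rightarrow> 1]"
  by (cases z) auto

lemma butlast_block_digits: "set (butlast (block z)) \<subseteq> {3, 4}"
  by (cases z) auto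

lemma spell_run: "takeWhile digit (rev (spell L)) = []"
proof (cases L rule: rev_cases)
  case (snoc Y z)
  have "rev (block z) = (case z of None \<Rightarrow> 2 | Some _ \<Rightarrow> 1) # rev (butlast (block z))"
    by (subst block_split) simp
  then show ?thesis by (simp add: snoc split: option.splits)
qed simp

lemma spell_at:
  assumes "a < length L"
  shows "spell L = spell (take a L) @ butlast (block (L ! a)) @
    (case L ! a of None \<Rightarrow> 2 | Some _ \<Rightarrow> 1) # spell (drop (Suc a) L)"
proof -
  have "spell L = spell (take a L @ L ! a # drop (Suc a) L)"
    using id_take_nth_drop[OF assms] by simp
  also have "\<dots> = spell (take a L) @ block (L ! a) @ spell (drop (Suc a) L)" by simp
  finally show ?thesis by (subst (asm) block_split) simp
qed

lemma
  assumes "a < length L"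
  shows pos_less_length: "pos L a < length (spell L)"
    and nth_pos: "spell L ! pos L a = (case L ! a of None \<Rightarrow> 2 | Some _ \<Rightarrow> 1)"
    and run_before_pos: "run_before (spell L) (pos L a) = rev (butlast (block (L ! a)))"
proof -
  have pos: "pos L a = length (spell (take a L) @ butlast (block (L ! a)))"
    by (simp add: pos_def)
  show "pos L a < length (spell L)" unfolding pos by (subst spell_at[OF assms]) simp
  show "spell L ! pos L a = (case L ! a of None \<Rightarrow> 2 | Some _ \<Rightarrow> 1)"
    unfolding pos by (subst spell_at[OF assms]) (simp add: nth_append)
  have "take (pos L a) (spell L) = spell (take a L) @ butlast (block (L ! a))"
    unfolding pos by (subst spell_at[OF assms]) simp
  moreover have "digit b" if "b \<in> set (rev (butlast (block (L ! a))))" for b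
    using that butlast_block_digits by auto
  then have "takeWhile digit (rev (butlast (block (L ! a))) @ rev (spell (take a L))) =
      rev (butlast (block (L ! a))) @ takeWhile digit (rev (spell (take a L)))"
    by (rule takeWhile_append2)
  ultimately show "run_before (spell L) (pos L a) = rev (butlast (block (L ! a)))"
    by (simp add: run_before_def spell_run)
qed

lemma pos_less:
  assumes "a < b" "b < length L"
  shows "pos L a < pos L b"
proof -
  have "take b L = take (Suc a) L @ take (b - Suc a) (drop (Suc a) L)"
    using take_add[of "Suc a" "b - Suc a" L] assms(1) by simp
  then have "length (spell (take (Suc a) L)) \<le> length (spell (take b L))" by simp
  moreover have "spell (take (Suc a) L) = spell (take a L) @ block (L ! a)"
    using assms by (simp add: take_Suc_conv_app_nth)
  moreover obtain n where "length (block (L ! a)) = Suc n"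
    using block_neq_Nil by (cases "block (L ! a)") auto
  ultimately show ?thesis unfolding pos_def by simp
qed

lemma pos_less_iff:
  assumes "a < length L" "b < length L"
  shows "pos L a < pos L b \<longleftrightarrow> a < b"
  using pos_less assms by (metis linorder_neq_iff order_less_asym)

lemma pos_eq_iff:
  assumes "a < length L" "b < length L"
  shows "pos L a = pos L b \<longleftrightarrow> a = b"
  using pos_less_iff[OF assms] pos_less_iff[OF assms(2,1)] by (metis linorder_neq_iff)

lemma marker_is_pos:
  assumes "k < length (spell L)" "marker (spell L ! k)"
  shows "\<exists>a<length L. k = pos L a"
  using assms
proof (induction L rule: rev_induct)
  case (snoc z L)
  show ?case
  proof (cases "k < length (spell L)")
    case True
    then obtain a where "a < length L" "k = pos L a" using snoc by (auto simp: nth_append)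
    then show ?thesis by (intro exI[of _ a]) (simp add: pos_def nth_append)
  next
    case False
    let ?j = "k - length (spell L)"
    have j: "?j < length (block z)" using False snoc.prems(1) by auto
    have "\<not> ?j < length (butlast (block z))"
    proof
      assume less: "?j < length (butlast (block z))"
      have "spell (L @ [z]) ! k = butlast (block z) ! ?j"
        using False j less by (simp add: nth_append nth_butlast)
      then have "digit (spell (L @ [z]) ! k)"
        using nth_mem[OF less] butlast_block_digits[of z] by auto
      with snoc.prems(2) show False by auto
    qed
    then have "k = pos (L @ [z]) (length L)" using False j by (simp add: pos_def)
    then show ?thesis by (intro exI[of _ "length L"]) simp
  qed
qed simp

lemma block_inject: "block z = block z' \<longleftrightarrow> z = z'"
proof -
  have "inj (\<lambda>b. if b then 4 else (3::nat))" by (auto simp: inj_def split: if_splits)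
  then show ?thesis
    by (cases z; cases z') (auto simp: inj_map_eq_map dest: binary_inject)
qed

lemma same_pos_iff:
  assumes "a < length L" "b < length L"
  shows "spell L ! pos L a = spell L ! pos L b \<and>
      run_before (spell L) (pos L a) = run_before (spell L) (pos L b) \<longleftrightarrow> L ! a = L ! b"
proof -
  have "block (L ! a) = block (L ! b) \<longleftrightarrow>
      (case L ! a of None \<Rightarrow> 2 | Some _ \<Rightarrow> 1) = (case L ! b of None \<Rightarrow> 2 | Some _ \<Rightarrow> (1::nat)) \<and>
      butlast (block (L ! a)) = butlast (block (L ! b))"
    by (subst (1 2) block_split) auto
  then show ?thesis
    using assms by (auto simp: nth_pos run_before_pos block_inject)
qed

lemma tokens_encode_letter: "tokens (encode_letter i @ r) = block (Some i) @ tokens r"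
proof -
  have "tokens (concat (map (\<lambda>b. [True, b]) bs) @ [False, False] @ r) =
      map (\<lambda>b. if b then 4 else 3) bs @ 1 # tokens r" for bs
    by (induction bs) (auto simp: bit_symbol_def)
  then show ?thesis by (simp add: encode_letter_def)
qed

lemma tokens_encode_word: "tokens (encode_word w @ r) = spell (map Some w) @ tokens r"
  by (induction w) (simp_all add: encode_word_def tokens_encode_letter)

lemma tokens_encode_identity:
  "tokens (encode_identity w w') = spell (map Some w @ None # map Some w')"
  using tokens_encode_word[of w' "[]"]
  by (simp add: encode_identity_def tokens_encode_word bit_symbol_def)

lemma even_encode_identity: "even (length (encode_identity w w'))"
proof -
  have 1: "even (length (concat (map (\<lambda>b. [True, b]) bs)))" for bs
    by (induction bs) auto
  have "even (length (encode_word w))" for w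
    by (induction w) (auto simp: encode_word_def encode_letter_def 1)
  then show ?thesis by (simp add: encode_identity_def)
qed

lemma token_inject: "token (bit_symbol a) (bit_symbol b) = token (bit_symbol c) (bit_symbol d) \<longleftrightarrow> a = c \<and> b = d"
  by (cases a; cases b; cases c; cases d) (simp_all add: bit_symbol_def)

lemma tokens_inject:
  "even (length x) \<Longrightarrow> even (length x') \<Longrightarrow> tokens x = tokens x' \<Longrightarrow> x = x'"
proof (induction x arbitrary: x' rule: tokens.induct)
  case (1 a b x)
  then obtain c d z where x': "x' = c # d # z"
    by (cases x' rule: tokens.cases) auto
  with 1 show ?case by (simp add: token_inject del: token.simps)
next
  case "2_1"
  then show ?case by (cases x' rule: tokens.cases) auto
qed simp

lemma tokens_range: "set (tokens x) \<subseteq> {1, 2, 3, 4}"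
  by (induction x rule: tokens.induct) (auto simp: bit_symbol_def)

lemma binary_0: "binary 0 = []"
  by (simp add: binary.simps)

lemma binary_surj: "bs = [] \<or> last bs \<Longrightarrow> \<exists>i. binary i = bs"
proof (induction bs)
  case Nil
  then show ?case by (metis binary.simps)
next
  case (Cons b bs)
  show ?case
  proof (cases "bs = []")
    case True
    with Cons.prems have "binary 1 = b # bs"
      by (subst binary.simps) (simp add: binary.simps[of 0])
    then show ?thesis ..
  next
    case False
    with Cons obtain i where i: "binary i = bs" by auto
    then have "i \<noteq> 0" using False binary_0 by metis
    then have "binary (2 * i + of_bool b) = b # bs"
      using i by (subst binary.simps) auto
    then show ?thesis ..
  qed
qed

text \<open>A numeral is canonical iff its most significant digit, which comes last, is 1; so a digit 0
  must not be followed by the end of a letter (and 0 has no digits at all).  A separator has to follow the end of a letter,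
  which also excludes empty sides.  At the left end of the list, the extra separator has no
  predecessor at all.\<close>

definition malformed :: "(nat \<times> nat) set" where
  "malformed = {(3, 1), (2, 2), (3, 2), (4, 2)}"

lemma factors_append_mono: "factors A \<union> factors B \<subseteq> factors (A @ B)"
proof
  fix p assume "p \<in> factors A \<union> factors B"
  moreover obtain x y where p: "p = (x, y)" by (cases p)
  ultimately consider C D where "A = C @ x # y # D" | C D where "B = C @ x # y # D"
    by (auto simp: in_factors_iff)
  then show "p \<in> factors (A @ B)"
  proof cases
    case 1
    then have "A @ B = C @ x # y # (D @ B)" by simp
    then show ?thesis unfolding p in_factors_iff by blast
  next
    case 2
    then have "A @ B = (A @ C) @ x # y # D" by simp
    then show ?thesis unfolding p in_factors_iff by blast
  qed
qed

lemma factors_append: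
  "A \<noteq> [] \<Longrightarrow> B \<noteq> [] \<Longrightarrow> factors (A @ B) = factors A \<union> {(last A, hd B)} \<union> factors B"
proof (induction A rule: factors.induct)
  case ("2_2" a)
  then show ?case by (cases B) auto
qed auto

text \<open>Cut the list after its first marker: the run of digits before it is a canonical numeral or
  empty, so one block has been found.\<close>

lemma spell_decode:
  assumes "set U \<subseteq> {1, 2, 3, 4}" "U = [] \<or> marker (last U)" "factors U \<inter> malformed = {}"
  shows "\<exists>L. U = spell L"
  using assms
proof (induction "length U" arbitrary: U rule: less_induct)
  case less
  show ?case
  proof (cases "U = []")
    case True
    then have "U = spell []" by simp
    then show ?thesis ..
  next
    case False
    have "dropWhile digit U \<noteq> []"
    proof
      assume "dropWhile digit U = []"
      then have "\<forall>a\<in>set U. digit a" by (simp add: dropWhile_eq_Nil_conv)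
      then have "digit (last U)" using False by simp
      then show False using False less.prems(2) by auto
    qed
    then obtain m V where "dropWhile digit U = m # V" by (cases "dropWhile digit U") auto
    then have "U = takeWhile digit U @ m # V" and "\<not> digit m"
      unfolding dropWhile_eq_Cons_conv by blast+
    moreover have "\<forall>a\<in>set (takeWhile digit U). digit a" by (auto dest: set_takeWhileD)
    ultimately obtain D where U: "U = D @ m # V" and "\<not> digit m" and D: "\<forall>a\<in>set D. digit a"
      by blast
    then have m: "marker m" using less.prems(1) by auto
    have "length V < length U" "set V \<subseteq> {1, 2, 3, 4}" "V = [] \<or> marker (last V)"
      using less.prems(1,2) unfolding U by (auto split: if_splits)
    moreover have "factors V \<inter> malformed = {}"
      using factors_append_mono[of "D @ [m]" V] less.prems(3) unfolding U by auto
    ultimately obtain L where L: "V = spell L" using less.hyps[of V] by blast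
    have end_pair: "(last D, m) \<in> factors U" if "D \<noteq> []"
      using factors_append[of D "m # V"] that unfolding U by auto
    have last_D: "digit (last D)" if "D \<noteq> []" using D that by simp
    have "\<exists>z. D @ [m] = block z"
    proof (cases "m = 2")
      case True
      have "D = []"
      proof (rule ccontr)
        assume "D \<noteq> []"
        from end_pair[OF this] last_D[OF this] True less.prems(3) show False
          by (auto simp: malformed_def)
      qed
      then have "D @ [m] = block None" using True by simp
      then show ?thesis ..
    next
      case False
      then have m: "m = 1" using m by simp
      let ?bs = "map (\<lambda>a. a = 4) D"
      have "last ?bs" if "D \<noteq> []"
        using end_pair[OF that] last_D[OF that] m less.prems(3) that
        by (auto simp: malformed_def last_map)
      then have "?bs = [] \<or> last ?bs" by auto
      then obtain i where "binary i = ?bs" using binary_surj by blast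
      moreover have "map (\<lambda>b. if b then 4 else 3) ?bs = D"
        using D by (auto intro!: map_idI)
      ultimately have "D @ [m] = block (Some i)" using m by simp
      then show ?thesis ..
    qed
    then obtain z where "D @ [m] = block z" ..
    then have "U = spell (z # L)" using U L by simp
    then show ?thesis ..
  qed
qed

lemma last_binary: "binary i \<noteq> [] \<Longrightarrow> last (binary i)"
proof (induction i rule: less_induct)
  case (less i)
  then have i: "i \<noteq> 0" using binary_0 by metis
  show ?case
  proof (cases "binary (i div 2) = []")
    case True
    then have "i div 2 = 0" by (subst (asm) binary.simps) (auto split: if_splits)
    then have "i = 1" using i by auto
    then show ?thesis using True by (subst binary.simps) simp
  next
    case False
    then show ?thesis using less.IH[of "i div 2"] i by (subst binary.simps) simp
  qed
qed

lemma factors_subset: "factors u \<subseteq> set u \<times> set u"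
  by (induction u rule: factors.induct) auto

lemma factors_block: "factors (block z) \<inter> malformed = {}"
proof (cases z)
  case (Some i)
  show ?thesis
  proof (cases "binary i = []")
    case False
    let ?D = "map (\<lambda>b. if b then 4 else (3::nat)) (binary i)"
    have "last ?D = 4" using False last_binary by (simp add: last_map)
    moreover have "factors ?D \<subseteq> {3, 4} \<times> {3, 4}"
      using factors_subset[of ?D] by auto
    ultimately show ?thesis using factors_append[of ?D "[1]"] False
      by (auto simp: Some malformed_def)
  qed (simp add: Some)
qed simp

lemma factors_spell:
  "(None, None) \<notin> factors L \<Longrightarrow> factors (spell L) \<inter> malformed = {}"
proof (induction L rule: factors.induct)
  case (1 z z' L)
  have "factors (block z @ spell (z' # L)) =
      factors (block z) \<union> {(last (block z), hd (block z'))} \<union> factors (spell (z' # L))"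
    using factors_append[of "block z" "spell (z' # L)"] block_neq_Nil by simp
  moreover have "(last (block z), hd (block z')) \<notin> malformed"
  proof -
    have "z \<noteq> None \<or> z' \<noteq> None" using "1.prems" by auto
    moreover have "marker (last (block z)) \<and> (last (block z) = 2 \<longrightarrow> z = None)"
      by (cases z) auto
    moreover have "hd (block z') = 2 \<longrightarrow> z' = None"
      by (cases z') (auto simp: hd_append hd_map)
    ultimately show ?thesis by (auto simp: malformed_def)
  qed
  ultimately show ?case using 1 factors_block[of z] by auto
qed (simp_all add: factors_block)

lemma None_None_map_Some:
  fixes u :: "'a list"
  shows "(None, None) \<in> factors (map Some u @ L) \<longleftrightarrow> (None, None) \<in> factors L"
proof (induction u)
  case (Cons a u)
  have "(None, None) \<in> factors (Some a # M) \<longleftrightarrow> (None, None) \<in> factors M" for M :: "'a option list"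
    by (cases M) auto
  with Cons show ?case by simp
qed simp

text \<open>The two sides share the middle marker, so that \<open>framed w\<close> is a prefix and \<open>framed w'\<close> is a
  suffix.\<close>

definition pair_frame :: "word \<Rightarrow> word \<Rightarrow> nat option list" where
  "pair_frame w w' = None # map Some w @ None # map Some w' @ [None]"

lemma None_None_pair_frame:
  "(None, None) \<in> factors (pair_frame w w') \<longleftrightarrow> w = [] \<or> w' = []"
proof -
  have step: "(None, None) \<in> factors (None # map Some u @ None # L) \<longleftrightarrow>
      u = [] \<or> (None, None) \<in> factors (None # L)" for u :: word and L
    using None_None_map_Some[of u "None # L"] by (cases u) auto
  show ?thesis using step[of w "map Some w' @ [None]"] step[of w' "[]"]
    by (auto simp: pair_frame_def)
qed

lemma option_list_split:
  assumes "a < length L" "L ! a = None" "\<And>b. b < length L \<Longrightarrow> L ! b = None \<Longrightarrow> b = a"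
  shows "\<exists>w w'. L = map Some w @ None # map Some w'"
proof -
  have some: "\<exists>w. A = map Some w" if "None \<notin> set A" for A :: "'b option list"
  proof
    show "A = map Some (map the A)" using that
      by (induction A) auto
  qed
  have L: "L = take a L @ None # drop (Suc a) L"
    using id_take_nth_drop[OF assms(1)] assms(2) by simp
  have "None \<notin> set (take a L)"
    using assms(3) by (fastforce simp: in_set_conv_nth)
  moreover have "None \<notin> set (drop (Suc a) L)"
  proof
    assume "None \<in> set (drop (Suc a) L)"
    then obtain b where "b < length (drop (Suc a) L)" "drop (Suc a) L ! b = None"
      by (auto simp: in_set_conv_nth)
    moreover from this have "Suc a + b < length L" by simp
    ultimately show False using assms(3)[of "Suc a + b"] by simp
  qed
  ultimately obtain w w' where "take a L = map Some w" "drop (Suc a) L = map Some w'"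
    using some by metis
  with L show ?thesis by metis
qed

text \<open>The separators other than the two added around the input.\<close>

definition inner :: "nat list \<Rightarrow> nat \<Rightarrow> bool" where
  "inner y k \<longleftrightarrow> k < length y \<and> y ! k = 2 \<and> k \<noteq> 0 \<and> k + 1 \<noteq> length y"

lemma inner_spell_iff:
  fixes L1 :: "nat option list"
  defines "L \<equiv> None # L1 @ [None]"
  shows "inner (spell L) k \<longleftrightarrow> (\<exists>a<length L1. L1 ! a = None \<and> k = pos L (Suc a))"
proof -
  let ?n = "Suc (length L1)"
  have len: "length L = Suc ?n" by (simp add: L_def)
  have first: "pos L 0 = 0" by (simp add: pos_def L_def)
  have last: "pos L ?n + 1 = length (spell L)" by (simp add: pos_def L_def)
  have two: "spell L ! pos L a = 2 \<longleftrightarrow> L ! a = None" if "a < length L" for a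
    using nth_pos[OF that] by (auto split: option.splits)
  have mid: "L ! Suc a = L1 ! a" if "a < length L1" for a
    using that by (simp add: L_def nth_append)
  show ?thesis
  proof
    assume k: "inner (spell L) k"
    then obtain b where b: "b < length L" "k = pos L b"
      using marker_is_pos[of k L] by (auto simp: inner_def)
    have "b \<noteq> 0" "b \<noteq> ?n" using k first last b(2) unfolding inner_def by metis+
    then obtain a where a: "b = Suc a" "a < length L1" using b(1) len by (cases b) auto
    then have "L1 ! a = None" using k two[OF b(1)] mid b(2) by (simp add: inner_def)
    with a b show "\<exists>a<length L1. L1 ! a = None \<and> k = pos L (Suc a)" by blast
  next
    assume "\<exists>a<length L1. L1 ! a = None \<and> k = pos L (Suc a)"
    then obtain a where a: "a < length L1" "L1 ! a = None" "k = pos L (Suc a)" by blast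
    have "Suc a < length L" "0 < length L" "?n < length L" using a len by auto
    then have "0 < k" "k < pos L ?n" "k < length (spell L)" "spell L ! k = 2"
      using pos_less[of 0 "Suc a" L] pos_less[of "Suc a" ?n L] a first
        pos_less_length[of "Suc a" L] two[of "Suc a"] mid by auto
    then show "inner (spell L) k" using last by (auto simp: inner_def)
  qed
qed

lemma inner_pair_frame:
  "inner (spell (pair_frame w w')) k \<longleftrightarrow> k = pos (pair_frame w w') (Suc (length w))"
proof -
  let ?L1 = "map Some w @ None # map Some w'"
  have "pair_frame w w' = None # ?L1 @ [None]" by (simp add: pair_frame_def)
  moreover have "a < length ?L1 \<and> ?L1 ! a = None \<longleftrightarrow> a = length w" for a
    by (auto simp: nth_append nth_Cons' split: if_splits)
  ultimately show ?thesis using inner_spell_iff[of ?L1 k] by metis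
qed

text \<open>Absence of malformed pairs yields a sequence of blocks with separators at both ends; a unique
  inner separator then splits it into two sides.\<close>

lemma well_formed_iff:
  assumes "set T \<subseteq> {1, 2, 3, 4}"
  shows "factors (2 # T @ [2]) \<inter> malformed = {} \<and>
      (\<exists>s. inner (2 # T @ [2]) s \<and> (\<forall>t. inner (2 # T @ [2]) t \<longrightarrow> t = s)) \<longleftrightarrow>
    (\<exists>w w'. w \<noteq> [] \<and> w' \<noteq> [] \<and> T = spell (map Some w @ None # map Some w'))"
    (is "?valid \<longleftrightarrow> ?word")
proof
  assume ?valid
  have "set (2 # T @ [2]) \<subseteq> {1, 2, 3, 4}" using assms by auto
  then obtain L where L: "2 # T @ [2] = spell L"
    using spell_decode[of "2 # T @ [2]"] \<open>?valid\<close> by auto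
  have "L \<noteq> []" using L by auto
  then obtain z L' where z: "L = z # L'" by (cases L) auto
  have "z = None" using L by (cases z) (auto simp: z split: if_splits list.splits simp: Cons_eq_append_conv Cons_eq_map_conv)
  moreover have "L' \<noteq> []" using L \<open>z = None\<close> by (auto simp: z)
  then obtain L1 z' where z': "L' = L1 @ [z']" by (cases L' rule: rev_cases) auto
  moreover have "z' = None"
    using arg_cong[OF L, of last] by (cases z') (auto simp: z z')
  ultimately have L1: "L = None # L1 @ [None]" using z by simp
  obtain s where s: "inner (spell L) s" "\<And>t. inner (spell L) t \<Longrightarrow> t = s"
    using \<open>?valid\<close> unfolding L by blast
  then obtain a where a: "a < length L1" "L1 ! a = None" "s = pos L (Suc a)"
    using inner_spell_iff[of L1] unfolding L1 by blast
  have "b = a" if "b < length L1" "L1 ! b = None" for b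
  proof -
    have "inner (spell L) (pos L (Suc b))"
      using inner_spell_iff[of L1 "pos L (Suc b)"] that unfolding L1 by blast
    then have "pos L (Suc b) = pos L (Suc a)" using s a by simp
    then show ?thesis using pos_eq_iff[of "Suc b" L "Suc a"] that a by (simp add: L1)
  qed
  with a obtain w w' where w: "L1 = map Some w @ None # map Some w'"
    using option_list_split by metis
  have "L = pair_frame w w'" by (simp add: L1 w pair_frame_def)
  moreover have "(None, None) \<notin> factors L"
  proof
    assume "(None, None) \<in> factors L"
    then obtain A B where "L = A @ None # None # B" by (auto simp: in_factors_iff)
    then have "spell L = spell A @ 2 # 2 # spell B" by simp
    then have "(2, 2) \<in> factors (spell L)" unfolding in_factors_iff by blast
    with \<open>?valid\<close> L show False by (auto simp: malformed_def)
  qed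
  ultimately have "w \<noteq> []" "w' \<noteq> []" by (auto simp: None_None_pair_frame)
  moreover have "T = spell (map Some w @ None # map Some w')"
    using L by (simp add: L1 w)
  ultimately show ?word by blast
next
  assume ?word
  then obtain w w' where w: "w \<noteq> []" "w' \<noteq> []" "T = spell (map Some w @ None # map Some w')"
    by blast
  have y: "2 # T @ [2] = spell (pair_frame w w')" by (simp add: w pair_frame_def)
  have "factors (2 # T @ [2]) \<inter> malformed = {}"
    unfolding y by (rule factors_spell) (simp add: None_None_pair_frame w)
  then show ?valid unfolding y inner_pair_frame by blast
qed

section \<open>The criterion for identities as a query\<close>

definition markers :: "nat list \<Rightarrow> nat set" where
  "markers y = {k. k < length y \<and> marker (y ! k)}"

definition same :: "nat list \<Rightarrow> nat \<Rightarrow> nat \<Rightarrow> bool" where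
  "same y k l \<longleftrightarrow> y ! k = y ! l \<and> run_before y k = run_before y l"

text \<open>The separator \<open>s\<close> belongs to both sides: as the right end of the first one and as the left end
  of the second one.\<close>

definition halves_match :: "nat list \<Rightarrow> nat \<Rightarrow> bool" where
  "halves_match y s \<longleftrightarrow> (\<forall>p\<in>markers y. \<forall>q\<in>markers y. p < q \<and> (q \<le> s \<or> s \<le> p) \<longrightarrow>
     (\<exists>p'\<in>markers y. \<exists>q'\<in>markers y. p' < q' \<and> (q \<le> s \<and> s \<le> p' \<or> s \<le> p \<and> q' \<le> s) \<and>
        same y p p' \<and> same y q q' \<and>
        (\<forall>r'\<in>markers y. p' < r' \<and> r' < q' \<longrightarrow> (\<exists>r\<in>markers y. p < r \<and> r < q \<and> same y r' r))))"

lemma markers_spell: "markers (spell L) = pos L ` {..<length L}"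
proof
  show "markers (spell L) \<subseteq> pos L ` {..<length L}"
    using marker_is_pos by (fastforce simp: markers_def)
  show "pos L ` {..<length L} \<subseteq> markers (spell L)"
    using nth_pos pos_less_length by (fastforce simp: markers_def split: option.splits)
qed

lemma same_spell: "a < length L \<Longrightarrow> b < length L \<Longrightarrow>
    same (spell L) (pos L a) (pos L b) \<longleftrightarrow> L ! a = L ! b"
  unfolding same_def by (rule same_pos_iff)

lemma pos_le_iff: "a < length L \<Longrightarrow> b < length L \<Longrightarrow> pos L a \<le> pos L b \<longleftrightarrow> a \<le> b"
  using pos_less_iff[of b L a] by (simp add: linorder_not_less[symmetric])

lemma halves_match_spell:
  assumes "n < length L"
  shows "halves_match (spell L) (pos L n) \<longleftrightarrow>
    (\<forall>p<length L. \<forall>q<length L. p < q \<and> (q \<le> n \<or> n \<le> p) \<longrightarrow>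
     (\<exists>p'<length L. \<exists>q'<length L. p' < q' \<and> (q \<le> n \<and> n \<le> p' \<or> n \<le> p \<and> q' \<le> n) \<and>
        L ! p = L ! p' \<and> L ! q = L ! q' \<and>
        (\<forall>r'<length L. p' < r' \<and> r' < q' \<longrightarrow> (\<exists>r<length L. p < r \<and> r < q \<and> L ! r' = L ! r))))"
  unfolding halves_match_def markers_spell ball_simps bex_simps
  using assms
  by (simp add: pos_less_iff pos_le_iff same_spell Ball_def Bex_def cong: conj_cong imp_cong)

lemma halves_match_pair_frame:
  "halves_match (spell (pair_frame w w')) (pos (pair_frame w w') (Suc (length w))) \<longleftrightarrow>
     covers (framed w) (framed w') \<and> covers (framed w') (framed w)"
proof -
  let ?L = "pair_frame w w'" and ?n = "Suc (length w)" and ?m = "Suc (length w')"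
  have len: "length ?L = Suc (?n + ?m)" by (simp add: pair_frame_def)
  have nth1: "?L ! a = framed w ! a" if "a \<le> ?n" for a
    using that by (auto simp: pair_frame_def framed_def nth_append nth_Cons')
  have nth2: "?L ! (?n + a) = framed w' ! a" if "a \<le> ?m" for a
    using that by (auto simp: pair_frame_def framed_def nth_append nth_Cons')
  have lens: "length (framed w) = Suc ?n" "length (framed w') = Suc ?m"
    by (simp_all add: framed_def)
  have ex1: "\<exists>p''<length ?L. \<exists>q''<length ?L. p'' < q'' \<and> q'' \<le> ?n \<and> x = ?L ! p'' \<and> y = ?L ! q'' \<and>
      (\<forall>r'<length ?L. p'' < r' \<and> r' < q'' \<longrightarrow> ?L ! r' \<in> T)"
    if "\<exists>p' q'. p' < q' \<and> q' < length (framed w) \<and> framed w ! p' = x \<and> framed w ! q' = y \<and>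
      (!) (framed w) ` {p'<..<q'} \<subseteq> T" for x y T
  proof -
    from that obtain p' q' where "p' < q'" "q' < length (framed w)" "framed w ! p' = x"
      "framed w ! q' = y" "(!) (framed w) ` {p'<..<q'} \<subseteq> T" by blast
    then show ?thesis using len lens
      by (intro exI[of _ p'] conjI exI[of _ q']) (auto simp: nth1)
  qed
  have ex2: "\<exists>p''<length ?L. \<exists>q''<length ?L. p'' < q'' \<and> ?n \<le> p'' \<and> x = ?L ! p'' \<and> y = ?L ! q'' \<and>
      (\<forall>r'<length ?L. p'' < r' \<and> r' < q'' \<longrightarrow> ?L ! r' \<in> T)"
    if "\<exists>p' q'. p' < q' \<and> q' < length (framed w') \<and> framed w' ! p' = x \<and> framed w' ! q' = y \<and>
      (!) (framed w') ` {p'<..<q'} \<subseteq> T" for x y T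
  proof -
    from that obtain p' q' where pq: "p' < q'" "q' < length (framed w')" "framed w' ! p' = x"
      "framed w' ! q' = y" "(!) (framed w') ` {p'<..<q'} \<subseteq> T" by blast
    have "?L ! r \<in> T" if "?n + p' < r" "r < ?n + q'" for r
    proof -
      have "?n \<le> r" using that by simp
      from le_Suc_ex[OF this] obtain r' where r': "r = ?n + r'" by blast
      then have "framed w' ! r' \<in> T" using that pq(5) by auto
      then show ?thesis using nth2[of r'] that pq(2) lens r' by simp
    qed
    then show ?thesis using pq len lens nth2[of p'] nth2[of q']
      by (intro exI[of _ "?n + p'"] conjI exI[of _ "?n + q'"]) auto
  qed
  have n: "?n < length ?L" using len by simp
  show ?thesis
    unfolding halves_match_spell[OF n]
  proof (intro iffI conjI allI impI)
    assume H: "\<forall>p<length ?L. \<forall>q<length ?L. p < q \<and> (q \<le> ?n \<or> ?n \<le> p) \<longrightarrow>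
     (\<exists>p'<length ?L. \<exists>q'<length ?L. p' < q' \<and> (q \<le> ?n \<and> ?n \<le> p' \<or> ?n \<le> p \<and> q' \<le> ?n) \<and>
        ?L ! p = ?L ! p' \<and> ?L ! q = ?L ! q' \<and>
        (\<forall>r'<length ?L. p' < r' \<and> r' < q' \<longrightarrow> (\<exists>r<length ?L. p < r \<and> r < q \<and> ?L ! r' = ?L ! r)))"
    show "covers (framed w) (framed w')"
      unfolding covers_nth
    proof (intro allI impI)
      fix p q assume pq: "p < q" "q < length (framed w)"
      then have "p < length ?L" "q < length ?L" "p < q \<and> (q \<le> ?n \<or> ?n \<le> p)" using len lens by auto
      from H[rule_format, OF this] obtain p' q' where p': "p' < length ?L" "q' < length ?L" "p' < q'"
          "q \<le> ?n \<and> ?n \<le> p' \<or> ?n \<le> p \<and> q' \<le> ?n" "?L ! p = ?L ! p'" "?L ! q = ?L ! q'"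
        and between: "\<forall>r'<length ?L. p' < r' \<and> r' < q' \<longrightarrow> (\<exists>r<length ?L. p < r \<and> r < q \<and> ?L ! r' = ?L ! r)"
        by blast
      have "?n \<le> p'" using p'(4) pq lens by auto
      moreover from this have "?n \<le> q'" using p'(3) by simp
      ultimately obtain a b where ab: "p' = ?n + a" "q' = ?n + b"
        using le_Suc_ex[of ?n p'] le_Suc_ex[of ?n q'] by blast
      then have "a < b" "b \<le> ?m" using p'(2,3) len by auto
      moreover have "framed w' ! c \<in> (!) (framed w) ` {p<..<q}" if "a < c" "c < b" for c
      proof -
        have "?n + c < length ?L" "p' < ?n + c \<and> ?n + c < q'"
          using that ab \<open>b \<le> ?m\<close> len by auto
        from between[rule_format, OF this] obtain r where "p < r" "r < q" "?L ! (?n + c) = ?L ! r"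
          by blast
        moreover from this have "framed w' ! c = framed w ! r"
          using nth1[of r] nth2[of c] that \<open>b \<le> ?m\<close> pq lens by auto
        ultimately show ?thesis by (intro image_eqI[of _ _ r]) auto
      qed
      ultimately show "\<exists>p' q'. p' < q' \<and> q' < length (framed w') \<and> framed w' ! p' = framed w ! p \<and>
          framed w' ! q' = framed w ! q \<and> (!) (framed w') ` {p'<..<q'} \<subseteq> (!) (framed w) ` {p<..<q}"
        using nth1[of p] nth1[of q] nth2[of a] nth2[of b] p'(5,6) ab pq lens
        by (intro exI[of _ a] exI[of _ b]) auto
    qed
    show "covers (framed w') (framed w)"
      unfolding covers_nth
    proof (intro allI impI)
      fix a b assume ab: "a < b" "b < length (framed w')"
      then have "?n + a < length ?L" "?n + b < length ?L"
        "?n + a < ?n + b \<and> (?n + b \<le> ?n \<or> ?n \<le> ?n + a)" using len lens by auto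
      from H[rule_format, OF this] obtain p' q' where p': "p' < length ?L" "q' < length ?L" "p' < q'"
          "?n + b \<le> ?n \<and> ?n \<le> p' \<or> ?n \<le> ?n + a \<and> q' \<le> ?n" "?L ! (?n + a) = ?L ! p'" "?L ! (?n + b) = ?L ! q'"
        and between: "\<forall>r'<length ?L. p' < r' \<and> r' < q' \<longrightarrow>
          (\<exists>r<length ?L. ?n + a < r \<and> r < ?n + b \<and> ?L ! r' = ?L ! r)"
        by blast
      have q': "q' \<le> ?n" using p'(4) ab by auto
      have "framed w ! c \<in> (!) (framed w') ` {a<..<b}" if "p' < c" "c < q'" for c
      proof -
        have "c < length ?L" "p' < c \<and> c < q'" using that p'(2) by auto
        from between[rule_format, OF this]
        obtain r where r: "?n + a < r" "r < ?n + b" "?L ! c = ?L ! r" by blast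
        then have "?n \<le> r" by simp
        from le_Suc_ex[OF this] obtain d where "r = ?n + d" by blast
        moreover from this r have "framed w ! c = framed w' ! d"
          using nth1[of c] nth2[of d] that q' ab lens by auto
        ultimately show ?thesis using r by (intro image_eqI[of _ _ d]) auto
      qed
      then show "\<exists>p' q'. p' < q' \<and> q' < length (framed w) \<and> framed w ! p' = framed w' ! a \<and>
          framed w ! q' = framed w' ! b \<and> (!) (framed w) ` {p'<..<q'} \<subseteq> (!) (framed w') ` {a<..<b}"
        using nth1[of p'] nth1[of q'] nth2[of a] nth2[of b] p' q' ab lens
        by (intro exI[of _ p'] exI[of _ q']) auto
    qed
  next
    fix p q
    assume cov: "covers (framed w) (framed w') \<and> covers (framed w') (framed w)"
      and p: "p < length ?L" and q: "q < length ?L" and pq: "p < q \<and> (q \<le> ?n \<or> ?n \<le> p)"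
    show "\<exists>p'<length ?L. \<exists>q'<length ?L. p' < q' \<and> (q \<le> ?n \<and> ?n \<le> p' \<or> ?n \<le> p \<and> q' \<le> ?n) \<and>
        ?L ! p = ?L ! p' \<and> ?L ! q = ?L ! q' \<and>
        (\<forall>r'<length ?L. p' < r' \<and> r' < q' \<longrightarrow> (\<exists>r<length ?L. p < r \<and> r < q \<and> ?L ! r' = ?L ! r))"
    proof (cases "q \<le> ?n")
      case True
      then have "\<exists>p' q'. p' < q' \<and> q' < length (framed w') \<and> framed w' ! p' = framed w ! p \<and>
          framed w' ! q' = framed w ! q \<and> (!) (framed w') ` {p'<..<q'} \<subseteq> (!) (framed w) ` {p<..<q}"
        using cov pq True unfolding covers_nth lens less_Suc_eq_le by blast
      from ex2[OF this] obtain p' q' where p': "p' < length ?L" "q' < length ?L" "p' < q'" "?n \<le> p'"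
          "framed w ! p = ?L ! p'" "framed w ! q = ?L ! q'"
        and between: "\<And>r'. r' < length ?L \<Longrightarrow> p' < r' \<Longrightarrow> r' < q' \<Longrightarrow> ?L ! r' \<in> (!) (framed w) ` {p<..<q}"
        by blast
      have "\<exists>r<length ?L. p < r \<and> r < q \<and> ?L ! r' = ?L ! r" if "r' < length ?L" "p' < r'" "r' < q'" for r'
      proof -
        from between[OF that] obtain r where "p < r" "r < q" "?L ! r' = framed w ! r" by auto
        then show ?thesis using nth1[of r] True q by (intro exI[of _ r]) auto
      qed
      then show ?thesis using p' True nth1[of p] nth1[of q] pq
        by (intro exI[of _ p'] conjI exI[of _ q']) auto
    next
      case False
      then have "?n \<le> p" "?n \<le> q" using pq by auto
      then obtain a b where ab: "p = ?n + a" "q = ?n + b"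
        using le_Suc_ex[of ?n p] le_Suc_ex[of ?n q] by blast
      have "a < b" using pq unfolding ab by simp
      moreover have "b < length (framed w')" using q unfolding ab len lens by simp
      ultimately have "\<exists>p' q'. p' < q' \<and> q' < length (framed w) \<and> framed w ! p' = framed w' ! a \<and>
          framed w ! q' = framed w' ! b \<and> (!) (framed w) ` {p'<..<q'} \<subseteq> (!) (framed w') ` {a<..<b}"
        using cov unfolding covers_nth by blast
      from ex1[OF this] obtain p' q' where p': "p' < length ?L" "q' < length ?L" "p' < q'" "q' \<le> ?n"
          "framed w' ! a = ?L ! p'" "framed w' ! b = ?L ! q'"
        and between: "\<And>r'. r' < length ?L \<Longrightarrow> p' < r' \<Longrightarrow> r' < q' \<Longrightarrow> ?L ! r' \<in> (!) (framed w') ` {a<..<b}"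
        by blast
      have "\<exists>r<length ?L. p < r \<and> r < q \<and> ?L ! r' = ?L ! r" if "r' < length ?L" "p' < r'" "r' < q'" for r'
      proof -
        from between[OF that] obtain c where "a < c" "c < b" "?L ! r' = framed w' ! c" by auto
        then show ?thesis using nth2[of c] \<open>b < length (framed w')\<close> lens ab q
          by (intro exI[of _ "?n + c"]) auto
      qed
      then show ?thesis using p' nth2[of a] nth2[of b] ab \<open>a < b\<close> \<open>b < length (framed w')\<close> lens
        by (intro exI[of _ p'] conjI exI[of _ q']) auto
    qed
  qed
qed

definition moves :: "nat list \<Rightarrow> nat list \<Rightarrow> nat \<Rightarrow> move" where
  "moves ls rs i = (if i \<in> set ls then Go_Left else if i \<in> set rs then Go_Right else Stay)"

definition Or :: "query \<Rightarrow> query \<Rightarrow> query" where "Or \<phi> \<psi> = Neg (And (Neg \<phi>) (Neg \<psi>))"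
definition Imp :: "query \<Rightarrow> query \<Rightarrow> query" where "Imp \<phi> \<psi> = Neg (And \<phi> (Neg \<psi>))"
definition Always :: query where "Always = Neg (And (Tok 1 0) (Neg (Tok 1 0)))"
definition Marker :: "nat \<Rightarrow> query" where "Marker i = Or (Tok i 1) (Tok i 2)"
definition Digit :: "nat \<Rightarrow> query" where "Digit i = Or (Tok i 3) (Tok i 4)"

text \<open>Quantification over markers only keeps the heads inside the list, which \<open>Less\<close> relies
  on.\<close>

definition Some_Marker :: "nat \<Rightarrow> query \<Rightarrow> query" where
  "Some_Marker i \<phi> = Until (moves [] [i]) i Always (And (Marker i) \<phi>)"
definition Every_Marker :: "nat \<Rightarrow> query \<Rightarrow> query" where "Every_Marker i \<phi> = Neg (Some_Marker i (Neg \<phi>))"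

text \<open>Both heads go left in step, and the smaller position is the one that falls off first.  Head 1
  is reserved for counting.\<close>

definition Less :: "nat \<Rightarrow> nat \<Rightarrow> query" where
  "Less i j = Until (moves [i, j] [1]) 1 Always (And (Tok i 0) (Neg (Tok j 0)))"

definition Agree :: "nat \<Rightarrow> nat \<Rightarrow> nat \<Rightarrow> nat \<Rightarrow> query" where
  "Agree i j a b = Or (And (Tok i a) (Tok j a)) (And (Tok i b) (Tok j b))"

text \<open>The heads go left from two markers of the same kind through the digits that precede them, as
  long as these agree, and have to leave both runs of digits at the same time.\<close>

definition Same :: "nat \<Rightarrow> nat \<Rightarrow> query" where
  "Same i j = And (Agree i j 1 2) (Shift (moves [i, j] [])
     (Until (moves [i, j] [1]) 1 (Agree i j 3 4) (And (Neg (Digit i)) (Neg (Digit j)))))"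

definition Inner :: "nat \<Rightarrow> query" where
  "Inner i = And (Tok i 2) (And (Shift (moves [i] []) (Neg (Tok i 0)))
     (Shift (moves [] [i]) (Neg (Tok i 0))))"

text \<open>Meant to be evaluated with head 3 one cell to the right of head 2, so that both heads run through
  the pairs of neighbouring tokens.\<close>

definition Regular :: query where
  "Regular = Neg (Until (moves [] [2, 3]) 2 Always (Or (Or (And (Tok 2 3) (Tok 3 1)) (And (Tok 2 2) (Tok 3 2)))
      (Or (And (Tok 2 3) (Tok 3 2)) (And (Tok 2 4) (Tok 3 2)))))"

text \<open>The heads 3, 4, 5, 6, 7, 8 are the positions \<open>p, q, p', q', r', r\<close> of \<open>halves_match\<close>, and
  head 2 is \<open>s\<close>.\<close>

definition Halves_Match :: query where
  "Halves_Match = Every_Marker 3 (Every_Marker 4 (Imp (And (Less 3 4) (Or (Neg (Less 2 4)) (Neg (Less 3 2))))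
     (Some_Marker 5 (Some_Marker 6 (And (Less 5 6) (And
        (Or (And (Neg (Less 2 4)) (Neg (Less 5 2))) (And (Neg (Less 3 2)) (Neg (Less 2 6))))
        (And (Same 3 5) (And (Same 4 6)
          (Every_Marker 7 (Imp (And (Less 5 7) (Less 7 6))
             (Some_Marker 8 (And (Less 3 8) (And (Less 8 4) (Same 7 8))))))))))))))"

definition Criterion :: query where
  "Criterion = And (Shift (moves [] [3]) Regular) (Some_Marker 2 (And (Inner 2)
     (And (Every_Marker 3 (Imp (Inner 3) (And (Neg (Less 2 3)) (Neg (Less 3 2))))) Halves_Match)))"

lemmas query_defs = Or_def Imp_def Always_def Marker_def Digit_def Some_Marker_def Every_Marker_def Less_def Agree_def
  Same_def Inner_def Regular_def Halves_Match_def Criterion_def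

lemma wf_Criterion: "wf_query 8 {1..8} Criterion"
  by (simp add: query_defs moves_def)

lemma sat_Or [simp]: "sat y v (Or \<phi> \<psi>) \<longleftrightarrow> sat y v \<phi> \<or> sat y v \<psi>"
  by (simp add: Or_def)

lemma sat_Imp [simp]: "sat y v (Imp \<phi> \<psi>) \<longleftrightarrow> (sat y v \<phi> \<longrightarrow> sat y v \<psi>)"
  by (simp add: Imp_def)

lemma sat_Always [simp]: "sat y v Always"
  by (auto simp: Always_def)

lemma cell_int: "cell y (int k) = (if k < length y then y ! k else 0)"
  by (simp add: cell_def)

lemma displace_one: "v i = 0 \<Longrightarrow> displace (moves [] [i]) (int k) v = v(i := int k)"
  by (rule ext) (simp add: displace_def moves_def)

lemma sat_Some_Marker:
  assumes "v i = 0"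
  shows "sat y v (Some_Marker i \<phi>) \<longleftrightarrow> (\<exists>k\<in>markers y. sat y (v(i := int k)) \<phi>)"
proof -
  have "sat y v (Some_Marker i \<phi>) \<longleftrightarrow>
      (\<exists>k\<le>length y. marker (cell y (int k)) \<and> sat y (v(i := int k)) \<phi>)"
    using assms by (simp add: Some_Marker_def Marker_def displace_one)
  also have "\<dots> \<longleftrightarrow> (\<exists>k\<in>markers y. sat y (v(i := int k)) \<phi>)"
    by (auto simp: markers_def cell_int split: if_splits)
  finally show ?thesis .
qed

lemma sat_Every_Marker:
  "v i = 0 \<Longrightarrow> sat y v (Every_Marker i \<phi>) \<longleftrightarrow> (\<forall>k\<in>markers y. sat y (v(i := int k)) \<phi>)"
  by (simp add: Every_Marker_def sat_Some_Marker)

lemma sat_Less: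
  assumes y: "0 \<notin> set y" and v: "v 1 = 0" "v i = int k" "v j = int l"
    and kl: "k \<in> markers y" "l \<in> markers y"
  shows "sat y v (Less i j) \<longleftrightarrow> k < l"
proof -
  have bounds: "k < length y" "l < length y" using kl by (auto simp: markers_def)
  have "sat y v (Less i j) \<longleftrightarrow>
      (\<exists>d\<le>length y. cell y (int k - int d) = 0 \<and> cell y (int l - int d) \<noteq> 0)"
    using v by (simp add: Less_def displace_def moves_def)
  also have "\<dots> \<longleftrightarrow> k < l"
    unfolding cell_eq_0_iff[OF y] using bounds
    by (auto intro!: exI[of _ "Suc k"])
  finally show ?thesis .
qed

text \<open>Reading two lists in parallel up to the first place where a run ends in both of them amounts to
  comparing the runs; \<open>g c j\<close> is the entry read in round \<open>j\<close>, which is blank beyond the end.\<close>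

lemma takeWhile_eq_iff_first_stop:
  fixes a b :: "'a list" and g :: "'a list \<Rightarrow> nat \<Rightarrow> 'a option"
  assumes g: "\<And>c j. g c j = (if j < length c then Some (c ! j) else None)"
    and D: "\<And>z. D z \<longleftrightarrow> z \<noteq> None \<and> P (the z)" and len: "length a \<le> n"
  shows "(\<exists>m\<le>n. \<not> D (g a m) \<and> \<not> D (g b m) \<and> (\<forall>j<m. D (g a j) \<and> g a j = g b j)) \<longleftrightarrow>
    takeWhile P a = takeWhile P b"
proof
  assume "\<exists>m\<le>n. \<not> D (g a m) \<and> \<not> D (g b m) \<and> (\<forall>j<m. D (g a j) \<and> g a j = g b j)"
  then obtain m where m: "\<not> D (g a m)" "\<not> D (g b m)" "\<And>j. j < m \<Longrightarrow> D (g a j) \<and> g a j = g b j"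
    by blast
  have m': "\<And>j. j < m \<Longrightarrow> D (g b j)" using m(3) by metis
  have run: "takeWhile P c = take m c" if "\<not> D (g c m)" "\<And>j. j < m \<Longrightarrow> D (g c j)" for c
  proof (rule takeWhile_eq_take_P_nth)
    show "P (c ! j)" if "j < m" "j < length c" for j
      using \<open>\<And>j. j < m \<Longrightarrow> D (g c j)\<close>[OF that(1)] that(2) by (simp add: D g)
    show "\<not> P (c ! m)" if "m < length c"
      using \<open>\<not> D (g c m)\<close> that by (simp add: D g)
  qed
  have "take m a = take m b"
  proof (rule nth_take_lemma)
    have le: "m \<le> length c" if "\<And>j. j < m \<Longrightarrow> D (g c j)" for c
    proof (rule ccontr)
      assume "\<not> m \<le> length c"
      with that[of "length c"] show False by (simp add: D g)
    qed
    show "m \<le> length a" using m(3) by (intro le) blast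
    show "m \<le> length b" using m' by (rule le)
    show "j < m \<longrightarrow> a ! j = b ! j" for j
      using m(3)[of j] m'[of j] by (auto simp: D g split: if_splits)
  qed
  moreover have "takeWhile P a = take m a" using m by (intro run) blast+
  moreover have "takeWhile P b = take m b" using m(2) m' by (rule run)
  ultimately show "takeWhile P a = takeWhile P b" by simp
next
  assume eq: "takeWhile P a = takeWhile P b"
  let ?m = "length (takeWhile P a)"
  have stop: "\<not> D (g c (length (takeWhile P c)))" for c
    using nth_length_takeWhile[of P c] by (auto simp: D g)
  have before: "g c j = Some (takeWhile P c ! j) \<and> D (g c j)" if "j < length (takeWhile P c)" for c j
    using that length_takeWhile_le[of P c] nth_mem[OF that]
    by (auto simp: D g takeWhile_nth dest: set_takeWhileD)
  have "?m \<le> n" using length_takeWhile_le[of P a] len by (rule le_trans)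
  moreover have "\<not> D (g b ?m)" using stop[of b] eq by simp
  moreover have "D (g a j) \<and> g a j = g b j" if "j < ?m" for j
    using before[OF that] before[of j b] that unfolding eq by metis
  ultimately show "\<exists>m\<le>n. \<not> D (g a m) \<and> \<not> D (g b m) \<and> (\<forall>j<m. D (g a j) \<and> g a j = g b j)"
    using stop[of a] by blast
qed

lemma cell_before:
  assumes "k \<le> length y"
  shows "cell y (int k - 1 - int j) =
    (if j < length (rev (take k y)) then rev (take k y) ! j else 0)"
proof -
  have "nat (int k - 1 - int j) = k - Suc j" by simp
  then show ?thesis using assms by (auto simp: cell_def rev_nth)
qed

lemma sat_Same:
  assumes y: "0 \<notin> set y" and v: "v 1 = 0" "v i = int k" "v j = int l"
    and kl: "k \<in> markers y" "l \<in> markers y" and ij: "i \<noteq> 1" "j \<noteq> 1"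
  shows "sat y v (Same i j) \<longleftrightarrow> same y k l"
proof -
  have bounds: "k < length y" "l < length y"
    and mark: "marker (y ! k)" "marker (y ! l)" using kl by (auto simp: markers_def)
  let ?a = "rev (take k y)" and ?b = "rev (take l y)"
  let ?g = "\<lambda>c j. if j < length c then Some (c ! j) else None :: nat option"
  let ?D = "\<lambda>z. z \<noteq> None \<and> digit (the z)"
  let ?c = "\<lambda>k m. cell y (int k - 1 - int m)"
  have D: "digit (?c k m) \<longleftrightarrow> ?D (?g (rev (take k y)) m)" if "k < length y" for k m
    unfolding cell_before[OF less_imp_le[OF that]] by simp
  have eq: "?D (?g ?a m) \<and> ?g ?a m = ?g ?b m \<longleftrightarrow>
      ?c k m = 3 \<and> ?c l m = 3 \<or> ?c k m = 4 \<and> ?c l m = 4" for m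
    unfolding cell_before[OF less_imp_le[OF bounds(1)]] cell_before[OF less_imp_le[OF bounds(2)]]
    by auto
  have "sat y v (Same i j) \<longleftrightarrow> y ! k = y ! l \<and>
    (\<exists>m\<le>length y. \<not> digit (?c k m) \<and> \<not> digit (?c l m) \<and>
       (\<forall>j<m. ?c k j = 3 \<and> ?c l j = 3 \<or> ?c k j = 4 \<and> ?c l j = 4))"
    using v ij mark bounds
    by (auto simp: Same_def Agree_def Digit_def displace_def moves_def cell_int)
  also have "\<dots> \<longleftrightarrow> y ! k = y ! l \<and>
    (\<exists>m\<le>length y. \<not> ?D (?g ?a m) \<and> \<not> ?D (?g ?b m) \<and> (\<forall>j<m. ?D (?g ?a j) \<and> ?g ?a j = ?g ?b j))"
    unfolding eq D[OF bounds(1)] D[OF bounds(2)] ..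
  also have "\<dots> \<longleftrightarrow> same y k l"
    unfolding same_def run_before_def
    using bounds takeWhile_eq_iff_first_stop[where g = ?g and D = ?D and P = digit and
        a = ?a and b = ?b and n = "length y"] by simp
  finally show ?thesis .
qed

lemma sat_Inner:
  assumes y: "0 \<notin> set y" and v: "v i = int k" and k: "k \<in> markers y"
  shows "sat y v (Inner i) \<longleftrightarrow> inner y k"
proof -
  have bound: "k < length y" using k by (auto simp: markers_def)
  have "sat y v (Inner i) \<longleftrightarrow> y ! k = 2 \<and> cell y (int k - 1) \<noteq> 0 \<and> cell y (int k + 1) \<noteq> 0"
    using v bound by (simp add: Inner_def displace_def moves_def cell_int)
  then show ?thesis unfolding cell_eq_0_iff[OF y] inner_def using bound by auto
qed

lemma inner_marker: "inner y k \<Longrightarrow> k \<in> markers y"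
  by (simp add: inner_def markers_def)

lemma in_factors_nth_iff: "(a, b) \<in> factors y \<longleftrightarrow> (\<exists>k. Suc k < length y \<and> y ! k = a \<and> y ! Suc k = b)"
proof
  assume "(a, b) \<in> factors y"
  then obtain A B where "y = A @ a # b # B" by (auto simp: in_factors_iff)
  then show "\<exists>k. Suc k < length y \<and> y ! k = a \<and> y ! Suc k = b"
    by (intro exI[of _ "length A"]) (simp add: nth_append)
next
  assume "\<exists>k. Suc k < length y \<and> y ! k = a \<and> y ! Suc k = b"
  then obtain k where k: "Suc k < length y" "y ! k = a" "y ! Suc k = b" by blast
  then have "y = take k y @ a # b # drop (Suc (Suc k)) y"
    using id_take_nth_drop[of k y] Cons_nth_drop_Suc[of "Suc k" y] by simp
  then show "(a, b) \<in> factors y" unfolding in_factors_iff by blast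
qed

lemma cell_factor_iff:
  assumes "b \<noteq> 0"
  shows "(\<exists>k\<le>length y. cell y (1 + int k) = b \<and> cell y (int k) = a) \<longleftrightarrow> (a, b) \<in> factors y"
proof -
  have "cell y (1 + int k) = (if Suc k < length y then y ! Suc k else 0)" for k
    using cell_int[of y "Suc k"] by (simp add: add.commute)
  then show ?thesis unfolding in_factors_nth_iff cell_int using assms
    by (auto split: if_splits)
qed

lemma sat_Regular:
  "sat y (\<lambda>_. 0) (Shift (moves [] [3]) Regular) \<longleftrightarrow> factors y \<inter> malformed = {}"
proof -
  have "sat y (\<lambda>_. 0) (Shift (moves [] [3]) Regular) \<longleftrightarrow>
    \<not> (\<exists>k\<le>length y. cell y (1 + int k) = 1 \<and> cell y (int k) = 3) \<and>
    \<not> (\<exists>k\<le>length y. cell y (1 + int k) = 2 \<and> cell y (int k) = 2) \<and>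
    \<not> (\<exists>k\<le>length y. cell y (1 + int k) = 2 \<and> cell y (int k) = 3) \<and>
    \<not> (\<exists>k\<le>length y. cell y (1 + int k) = 2 \<and> cell y (int k) = 4)"
    by (auto simp: Regular_def displace_def moves_def)
  also have "\<dots> \<longleftrightarrow> factors y \<inter> malformed = {}"
    by (subst (1 2 3 4) cell_factor_iff) (auto simp: malformed_def)
  finally show ?thesis .
qed

lemma sat_Halves_Match:
  assumes "0 \<notin> set y" "s \<in> markers y"
  shows "sat y ((\<lambda>_. 0)(2 := int s)) Halves_Match \<longleftrightarrow> halves_match y s"
  using assms
  by (simp add: Halves_Match_def halves_match_def sat_Some_Marker sat_Every_Marker sat_Less sat_Same linorder_not_less
      cong: ball_cong bex_cong)

lemma sat_Criterion:
  assumes y: "0 \<notin> set y"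
  shows "sat y (\<lambda>_. 0) Criterion \<longleftrightarrow> factors y \<inter> malformed = {} \<and>
    (\<exists>s. inner y s \<and> (\<forall>t. inner y t \<longrightarrow> t = s) \<and> halves_match y s)"
proof -
  have "sat y ((\<lambda>_. 0)(2 := int s)) (Every_Marker 3 (Imp (Inner 3) (And (Neg (Less 2 3)) (Neg (Less 3 2))))) \<longleftrightarrow>
      (\<forall>t\<in>markers y. inner y t \<longrightarrow> t = s)" if "s \<in> markers y" for s
    using that y by (simp add: sat_Every_Marker sat_Less sat_Inner linorder_not_less cong: ball_cong)
      (metis order_antisym order_refl)
  with y show ?thesis
    unfolding Criterion_def sat.simps(3) sat_Regular
    by (simp add: sat_Some_Marker sat_Inner sat_Halves_Match cong: bex_cong)
      (metis inner_marker)
qed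

lemma Criterion_iff:
  assumes "even (length x)"
  shows "sat (2 # tokens x @ [2]) (\<lambda>_. 0) Criterion \<longleftrightarrow>
    (\<exists>w w'. w \<noteq> [] \<and> w' \<noteq> [] \<and> x = encode_identity w w' \<and> identity_holds (jones 4) w w')"
    (is "?sat \<longleftrightarrow> ?id")
proof -
  let ?y = "2 # tokens x @ [2]"
  have "0 \<notin> set ?y" using tokens_nonzero by simp
  note sat = sat_Criterion[OF this]
  have y: "?y = spell (pair_frame w w')" if "x = encode_identity w w'" for w w'
    using that by (simp add: tokens_encode_identity pair_frame_def)
  have match: "halves_match ?y s \<longleftrightarrow> identity_holds (jones 4) w w'"
    if "x = encode_identity w w'" "w \<noteq> []" "w' \<noteq> []" "inner ?y s" for w w' s
    using that(4) unfolding y[OF that(1)] inner_pair_frame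
    by (simp add: halves_match_pair_frame identity_holds_jones_iff[OF that(2,3)])
  show ?thesis
  proof
    assume ?sat
    then obtain s where s: "inner ?y s" "\<forall>t. inner ?y t \<longrightarrow> t = s" "halves_match ?y s"
      and "factors ?y \<inter> malformed = {}"
      unfolding sat by blast
    then have "factors ?y \<inter> malformed = {} \<and> (\<exists>s. inner ?y s \<and> (\<forall>t. inner ?y t \<longrightarrow> t = s))"
      by (intro conjI exI[of _ s])
    from iffD1[OF well_formed_iff[OF tokens_range] this]
    obtain w w' where w: "w \<noteq> []" "w' \<noteq> []"
      and "tokens x = spell (map Some w @ None # map Some w')"
      by (elim exE conjE)
    then have "tokens x = tokens (encode_identity w w')" by (simp add: tokens_encode_identity)
    then have "x = encode_identity w w'"
      by (rule tokens_inject[OF assms even_encode_identity])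
    moreover from match[OF this w s(1)] s(3) have "identity_holds (jones 4) w w'" by (rule iffD1)
    ultimately show ?id using w by (intro exI conjI)
  next
    assume ?id
    then obtain w w' where w: "w \<noteq> []" "w' \<noteq> []" and x: "x = encode_identity w w'"
      and holds: "identity_holds (jones 4) w w'" by blast
    have "tokens x = spell (map Some w @ None # map Some w')"
      unfolding x by (rule tokens_encode_identity)
    with w have "\<exists>w w'. w \<noteq> [] \<and> w' \<noteq> [] \<and> tokens x = spell (map Some w @ None # map Some w')"
      by (intro exI conjI)
    from iffD2[OF well_formed_iff[OF tokens_range] this]
    obtain s where regular: "factors ?y \<inter> malformed = {}" and s: "inner ?y s"
      "\<forall>t. inner ?y t \<longrightarrow> t = s" by (elim exE conjE)
    from match[OF x w s(1)] holds have "halves_match ?y s" by (rule iffD2)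
    with regular s show ?sat unfolding sat by (intro conjI exI)
  qed
qed

theorem mainTheorem3:
  shows "Check_Id (jones 4) \<in> class_P"
proof -
  have "Check_Id (jones 4) = {x. even (length x) \<and> sat (2 # tokens x @ [2]) (\<lambda>_. 0) Criterion}"
  proof (rule Set.set_eqI)
    fix x
    have check: "x \<in> Check_Id (jones 4) \<longleftrightarrow>
        (\<exists>w w'. w \<noteq> [] \<and> w' \<noteq> [] \<and> x = encode_identity w w' \<and> identity_holds (jones 4) w w')"
      unfolding Check_Id_def by blast
    then have "even (length x)" if "x \<in> Check_Id (jones 4)"
      using that even_encode_identity by metis
    then show "x \<in> Check_Id (jones 4) \<longleftrightarrow>
        x \<in> {x. even (length x) \<and> sat (2 # tokens x @ [2]) (\<lambda>_. 0) Criterion}"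
      using Criterion_iff[of x] check by (metis (mono_tags, lifting) mem_Collect_eq)
  qed
  also have "\<dots> \<in> class_P"
    by (rule query_in_class_P[OF _ wf_Criterion]) simp
  finally show ?thesis .
qed

end
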